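(* Let $N \ge 1$, let $\Omega \subset \mathbb{R}^N$ be a bounded domain with $C^2$ boundary, let $k \in \{1,2,\dots,N\}$, $0 < p, q \le \infty$, $\lambda > 0$, and let $M : \mathbb{R}_+ \times \mathbb{R}_+ \to \mathbb{R}_+$ be a positive function (no continuity is assumed). Consider the overdetermined problem $$(\mathrm{P}_\Omega)\qquad \begin{cases} M\left(\|u\|_{L^p(\Omega)}, \|\nabla u\|_{L^q(\Omega)}\right) S_k(D^2 u) = \lambda & \text{in } \Omega, \\ u = 0 & \text{on } \partial\Omega, \\ \dfrac{\partial u}{\partial \nu} = c > 0 & \text{on } \partial\Omega, \end{cases}$$ where $c>0$ is an unknown constant. (1) If $(\mathrm{P}_\Omega)$ admits a solution $u \in C^2(\overline{\Omega})$ for some (unknown) constant $c > 0$, then $\Omega$ must be a ball and $u$ must be radially symmetric with respect to the center of the ball. (2) Let $\Omega = B_R(x_0)$ with $R>0$ and $x_0 \in \mathbb{R}^N$, and let $U_{R,x_0}(x) = \frac{|x-x_0|^2 - R^2}{2}$. Consider the system of equations for $(s,t) \in \mathbb{R}_+ \times \mathbb{R}_+$: $$(\mathrm{S})\qquad \begin{cases} s = \left\{ \frac{M(s,t)}{\lambda} \binom{N}{k} \right\}^{-1/k} \|U_{R,x_0}\|_{L^p(B_R(x_0))}, \\[4pt] t = \left\{ \frac{M(s,t)}{\lambda} \binom{N}{k} \right\}^{-1/k} \|\nabla U_{R,x_0}\|_{L^q(B_R(x_0))}. \end{cases}$$ Then the problem $(\mathrm{P}_{B_R(x_0)})$ has the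 same number of solutions as the system $(\mathrm{S})$. (3) With $\Omega = B_R(x_0)$ as in (2), define for $s>0$ $$g(s) = s^k\, M\left(s, \frac{\|\nabla U_{R,x_0}\|_{L^q(B_R(x_0))}}{\|U_{R,x_0}\|_{L^p(B_R(x_0))}}\, s\right) \binom{N}{k}.$$ Then the number of solutions of $(\mathrm{S})$ is the same as the number of solutions $s>0$ of the equation $$(\mathrm{E})\qquad g(s) = \lambda \|U_{R,x_0}\|_{L^p(B_R(x_0))}^k .$$ (4) Moreover, any solution $u_\lambda$ of $(\mathrm{P}_{B_R(x_0)})$ has the form $$u_\lambda(x) = s_* \frac{U_{R,x_0}(x)}{\|U_{R,x_0}\|_{L^p(B_R(x_0))}},$$ where $s_* > 0$ is a solution of $(\mathrm{E})$.
   Context: $\mathbb{R}_+ = (0,\infty)$. $\nu$ is the outer unit normal to $\partial\Omega$. For a real symmetric $N\times N$ matrix $A$ with eigenvalues $\lambda_1,\dots,\lambda_N$ (counted with multiplicity), $S_k(A) = \sum_{1 \le i_1 < \cdots < i_k \le N} \lambda_{i_1}\cdots\lambda_{i_k}$ is the $k$-th elementary symmetric function of the eigenvalues. $D^2u$ is the Hessian matrix of $u$, and $S_k(D^2u)$ is the $k$-Hessian operator (so $S_1(D^2u)=\Delta u$, $S_N(D^2u)=\det D^2u$). $\|f\|_{L^p(\Omega)} = (\int_\Omega |f|^p\,dx)^{1/p}$ for $0<p<\infty$ (also when $p<1$), and $\|f\|_{L^\infty(\Omega)}$ is the essential supremum of $|f|$. $B_R(x_0)$ is the open ball of radius $R$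 centered at $x_0$. A solution of the overdetermined problem is a function $u \in C^2(\overline{\Omega})$ satisfying it for some constant $c>0$ (the constant $c$ is part of the unknown). "Number of solutions" means the cardinality of the set of solutions (possibly zero or infinite). *)

theory Defs
  imports
    "HOL-Analysis.Analysis"
    "HOL-Probability.Essential_Supremum"
    "HOL-Library.Equipollence"
begin

definition grad :: "('a::euclidean_space \<Rightarrow> real) \<Rightarrow> 'a \<Rightarrow> 'a" where
  "grad f x = (THE D. GDERIV f x :> D)"

definition hessian :: "(real^'n \<Rightarrow> real) \<Rightarrow> real^'n \<Rightarrow> real^'n^'n" where
  "hessian f x = matrix (frechet_derivative (grad f) (at x))"

text \<open>Only meaningful for open \<open>V\<close>.\<close>

definition C2_on :: "(real^'n) set \<Rightarrow> (real^'n \<Rightarrow> real) \<Rightarrow> bool" where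
  "C2_on V f \<longleftrightarrow>
     (\<forall>x\<in>V. f differentiable (at x)) \<and>
     (\<forall>x\<in>V. grad f differentiable (at x)) \<and>
     continuous_on V (hessian f)"

text \<open>The space \<open>C\<^sup>2\<close> of the closure of an open set: the function is \<open>C\<^sup>2\<close> in the open set,
  and all its derivatives of order at most two extend continuously to the closure.\<close>

definition C2_closure :: "(real^'n) set \<Rightarrow> (real^'n \<Rightarrow> real) \<Rightarrow> bool" where
  "C2_closure \<Omega> u \<longleftrightarrow>
     C2_on \<Omega> u \<and>
     continuous_on (closure \<Omega>) u \<and>
     (\<exists>G. continuous_on (closure \<Omega>) G \<and> (\<forall>x\<in>\<Omega>. G x = grad u x)) \<and>
     (\<exists>H. continuous_on (closure \<Omega>) H \<and> (\<forall>x\<in>\<Omega>. H x = hessian u x))"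

definition local_defining_function ::
    "(real^'n) set \<Rightarrow> real^'n \<Rightarrow> (real^'n) set \<Rightarrow> (real^'n \<Rightarrow> real) \<Rightarrow> bool" where
  "local_defining_function \<Omega> x V \<phi> \<longleftrightarrow>
     open V \<and> x \<in> V \<and> C2_on V \<phi> \<and> grad \<phi> x \<noteq> 0 \<and> \<Omega> \<inter> V = {y\<in>V. \<phi> y < 0}"

definition C2_boundary :: "(real^'n) set \<Rightarrow> bool" where
  "C2_boundary \<Omega> \<longleftrightarrow> (\<forall>x\<in>frontier \<Omega>. \<exists>V \<phi>. local_defining_function \<Omega> x V \<phi>)"

definition bounded_C2_domain :: "(real^'n) set \<Rightarrow> bool" where
  "bounded_C2_domain \<Omega> \<longleftrightarrow>
     \<Omega> \<noteq> {} \<and> open \<Omega> \<and> connected \<Omega> \<and> bounded \<Omega> \<and> C2_boundary \<Omega>"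

text \<open>The direction of the gradient at a boundary point does not depend on the defining function,
  so the description is unique at every point of a \<open>C\<^sup>2\<close> boundary.\<close>

definition outer_normal :: "(real^'n) set \<Rightarrow> real^'n \<Rightarrow> real^'n" where
  "outer_normal \<Omega> x =
     (THE \<nu>. \<exists>V \<phi>. local_defining_function \<Omega> x V \<phi> \<and> \<nu> = sgn (grad \<phi> x))"

text \<open>At a boundary point the gradient is the value of its continuous extension from \<open>\<Omega>\<close>.\<close>

definition normal_derivative :: "(real^'n) set \<Rightarrow> (real^'n \<Rightarrow> real) \<Rightarrow> real^'n \<Rightarrow> real" where
  "normal_derivative \<Omega> u x = Lim (at x within \<Omega>) (grad u) \<bullet> outer_normal \<Omega> x"

text \<open>\<open>l\<close> lists the eigenvalues of the symmetric matrix \<open>A\<close>, each one repeated as often as the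
  dimension of its eigenspace. For symmetric \<open>A\<close> such an \<open>l\<close> exists and is unique up to
  permutation, so that \<open>S\<^sub>k\<close> below does not depend on the choice; for a matrix without an
  eigenbasis \<open>S\<^sub>k\<close> is unspecified.\<close>

definition eigenvalue_listing :: "real^'n^'n \<Rightarrow> ('n \<Rightarrow> real) \<Rightarrow> bool" where
  "eigenvalue_listing A l \<longleftrightarrow> (\<forall>t. card {i. l i = t} = dim {v. A *v v = t *\<^sub>R v})"

definition S_elem :: "nat \<Rightarrow> real^'n^'n \<Rightarrow> real" where
  "S_elem k A = (let l = (SOME l. eigenvalue_listing A l) in
     \<Sum>I | I \<subseteq> (UNIV :: 'n set) \<and> card I = k. \<Prod>i\<in>I. l i)"

definition Lp_norm ::
    "ennreal \<Rightarrow> 'a::euclidean_space set \<Rightarrow> ('a \<Rightarrow> 'b::real_normed_vector) \<Rightarrow> real" where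
  "Lp_norm p \<Omega> f =
     (if p = \<infinity> then real_of_ereal (esssup (lebesgue_on \<Omega>) (\<lambda>x. ereal (norm (f x))))
      else (\<integral>x. norm (f x) powr enn2real p \<partial>lebesgue_on \<Omega>) powr (1 / enn2real p))"

definition is_solution ::
    "(real^'n) set \<Rightarrow> nat \<Rightarrow> ennreal \<Rightarrow> ennreal \<Rightarrow> real \<Rightarrow> (real \<Rightarrow> real \<Rightarrow> real) \<Rightarrow>
     (real^'n \<Rightarrow> real) \<Rightarrow> bool" where
  "is_solution \<Omega> k p q lam M u \<longleftrightarrow>
     C2_closure \<Omega> u \<and>
     (\<forall>x\<in>\<Omega>. M (Lp_norm p \<Omega> u) (Lp_norm q \<Omega> (grad u)) * S_elem k (hessian u x) = lam) \<and>
     (\<forall>x\<in>frontier \<Omega>. u x = 0) \<and>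
     (\<exists>c>0. \<forall>x\<in>frontier \<Omega>. normal_derivative \<Omega> u x = c)"

text \<open>A solution is a function on the closure of \<open>\<Omega>\<close>. To count solutions, its values elsewhere are
  fixed by extensionality.\<close>

definition solution_set ::
    "(real^'n) set \<Rightarrow> nat \<Rightarrow> ennreal \<Rightarrow> ennreal \<Rightarrow> real \<Rightarrow> (real \<Rightarrow> real \<Rightarrow> real) \<Rightarrow>
     (real^'n \<Rightarrow> real) set" where
  "solution_set \<Omega> k p q lam M = {u \<in> extensional (closure \<Omega>). is_solution \<Omega> k p q lam M u}"

definition radially_symmetric_on :: "(real^'n) set \<Rightarrow> real^'n \<Rightarrow> (real^'n \<Rightarrow> real) \<Rightarrow> bool" where
  "radially_symmetric_on X x0 u \<longleftrightarrow> (\<exists>f. \<forall>x\<in>X. u x = f (norm (x - x0)))"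

definition U_fun :: "real \<Rightarrow> real^'n \<Rightarrow> real^'n \<Rightarrow> real" where
  "U_fun R x0 x = ((norm (x - x0))\<^sup>2 - R\<^sup>2) / 2"

definition U_norm :: "ennreal \<Rightarrow> real \<Rightarrow> real^'n \<Rightarrow> real" where
  "U_norm p R x0 = Lp_norm p (ball x0 R) (U_fun R x0)"

definition grad_U_norm :: "ennreal \<Rightarrow> real \<Rightarrow> real^'n \<Rightarrow> real" where
  "grad_U_norm q R x0 = Lp_norm q (ball x0 R) (grad (U_fun R x0))"

definition system_solutions ::
    "real \<Rightarrow> real^'n \<Rightarrow> nat \<Rightarrow> ennreal \<Rightarrow> ennreal \<Rightarrow> real \<Rightarrow> (real \<Rightarrow> real \<Rightarrow> real) \<Rightarrow> (real \<times> real) set" where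
  "system_solutions R x0 k p q lam M =
     {(s, t). s > 0 \<and> t > 0 \<and>
        s = (M s t / lam * real (CARD('n) choose k)) powr (- 1 / real k) * U_norm p R x0 \<and>
        t = (M s t / lam * real (CARD('n) choose k)) powr (- 1 / real k) * grad_U_norm q R x0}"

definition g_fun ::
    "real \<Rightarrow> real^'n \<Rightarrow> nat \<Rightarrow> ennreal \<Rightarrow> ennreal \<Rightarrow> (real \<Rightarrow> real \<Rightarrow> real) \<Rightarrow> real \<Rightarrow> real" where
  "g_fun R x0 k p q M s =
     s ^ k * M s (grad_U_norm q R x0 / U_norm p R x0 * s) * real (CARD('n) choose k)"

definition equation_solutions ::
    "real \<Rightarrow> real^'n \<Rightarrow> nat \<Rightarrow> ennreal \<Rightarrow> ennreal \<Rightarrow> real \<Rightarrow> (real \<Rightarrow> real \<Rightarrow> real) \<Rightarrow> real set" where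
  "equation_solutions R x0 k p q lam M =
     {s. s > 0 \<and> g_fun R x0 k p q M s = lam * U_norm p R x0 ^ k}"

end

theory Submission
  imports Defs "HOL-Computational_Algebra.Fundamental_Theorem_Algebra" "HOL-Combinatorics.Permutations"
begin

text \<open>
  The symmetry result is Serrin's theorem for \<open>k\<close>-Hessian equations. For a fixed solution the nonlocal
  factor \<open>M\<close> is a positive number, so \<open>S\<^sub>k(D\<^sup>2u)\<close> is a positive constant; rescaling \<open>u\<close> makes this
  constant \<open>N choose k\<close>, and the claim becomes \<open>D\<^sup>2u = I\<close>. The proof follows the integral method
  of Brandolini, Nitsch, Salani and Trombetti. Write \<open>T\<^sub>j\<close> for the Newton tensor of \<open>D\<^sup>2u\<close>, the derivative
  of \<open>S\<^sub>j\<close> with respect to the matrix. It is divergence free, and testing this against suitable fields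
  gives two facts about \<open>P = |\<nabla>u|\<^sup>2 - 2u - c\<^sup>2\<close>, which vanishes on the boundary.

  \<^item> Lemma \<open>P_identity\<close> writes \<open>k (N choose k) \<integral>P\<close> as \<open>2\<integral>u E\<close> with an expression \<open>E\<close> in the
    \<open>S\<^sub>j(D\<^sup>2u)\<close> that Maclaurin's inequality makes nonnegative. As \<open>u < 0\<close>, \<open>\<integral>P \<le> 0\<close>.

  \<^item> Lemma \<open>pohozaev_identity\<close> expresses \<open>c\<^sup>2\<integral>trace T\<^sub>k\<close> by \<open>\<integral>u\<close>. Combined with
    \<open>\<integral>|\<nabla>u|\<^sup>2 = -\<integral>u \<Delta>u\<close> and again Maclaurin's inequality, this gives
    \<open>\<integral>P \<ge> \<integral>(-u)(\<Delta>u - N) \<ge> 0\<close>.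

  Hence equality holds throughout, and the equality case of Maclaurin's inequality forces \<open>D\<^sup>2u = I\<close>
  (\<open>hessian_identity\<close>). A function with constant Hessian \<open>s I\<close> is a paraboloid up to a constant, and its
  domain is a ball (\<open>quadratic_solution_ball\<close>).

  Two points need care because \<open>u\<close> is merely \<open>C\<^sup>2\<close> up to the boundary. The divergence of \<open>T\<^sub>j\<close> involves
  third derivatives, so its vanishing is used in weak form only. It comes from the change of variables
  formula: if \<open>X\<close> is \<open>C\<^sup>1\<close> with compact support and \<open>t\<close> is large, then \<open>x \<mapsto> t x + X(x)\<close> maps a box
  containing the support bijectively onto a scaled box, so \<open>\<integral>det(tI + DX)\<close> is independent of \<open>X\<close>.
  Differentiating in the direction of a second field and comparing powers of \<open>t\<close> yields
  \<open>\<integral>trace(T\<^sub>j(DX) DY) = 0\<close> (\<open>integral_newton_tensor_zero\<close>). Nor is a divergence theorem on \<open>\<Omega>\<close> used: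
  fields are cut off near the boundary by functions of \<open>u\<close>, and the error disappears in the limit as soon
  as the flux \<open>\<nabla>u \<bullet> T\<^sub>j\<psi>\<close> vanishes on the boundary (\<open>weakly_divergence_free\<close>). For the field behind
  the Pohozaev identity this uses that \<open>\<nabla>u\<close> is an eigenvector of \<open>D\<^sup>2u\<close> there, which holds because
  \<open>|\<nabla>u| = c\<close> along the boundary (\<open>gradient_parallel_normal\<close>).

  That \<open>D\<^sup>2u\<close> lies in the cone where Maclaurin's inequality applies is clear at an interior minimum of
  \<open>u\<close>, which exists as \<open>c > 0\<close>, and it spreads over \<open>\<Omega>\<close> by connectedness (\<open>garding_cone_connected\<close>).

  On a ball every solution is therefore \<open>s U\<close> with \<open>s > 0\<close> and
  \<open>M(s\<parallel>U\<parallel>, s\<parallel>\<nabla>U\<parallel>) s\<^sup>k (N choose k) = \<lambda>\<close>. The solutions of the problem, of the system and of the scalar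
  equation are all parametrized by this set of amplitudes \<open>s\<close>.
\<close>

section \<open>The Newton and Maclaurin inequalities\<close>

definition esym :: "'i set \<Rightarrow> nat \<Rightarrow> ('i \<Rightarrow> real) \<Rightarrow> real" where
  "esym J j l = (\<Sum>I | I \<subseteq> J \<and> card I = j. \<Prod>i\<in>I. l i)"

definition split_poly :: "real poly \<Rightarrow> bool" where
  "split_poly p \<longleftrightarrow> (\<exists>c xs. p = smult c (\<Prod>x\<leftarrow>xs. [:-x, 1:]))"

lemma map_poly_of_real_mult:
  "map_poly complex_of_real (p * q) = map_poly complex_of_real p * map_poly complex_of_real q"
  by (intro poly_eqI) (simp add: coeff_map_poly coeff_mult)

lemma map_poly_of_real_pderiv:
  "map_poly complex_of_real (pderiv p) = pderiv (map_poly complex_of_real p)"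
  by (intro poly_eqI) (simp add: coeff_map_poly coeff_pderiv)

text \<open>The logarithmic derivative of a product of factors \<open>z - x\<close> with real \<open>x\<close> is a sum of terms
  \<open>1/(z - x)\<close>, whose imaginary parts all have the sign opposite to that of \<open>Im z\<close>. Multiplying by
  \<open>|q|\<^sup>2\<close> avoids the division. This is the case of the Gauss-Lucas theorem that says that the derivative
  of a real-rooted polynomial has only real roots.\<close>

lemma gauss_lucas_step:
  fixes xs :: "real list" and z :: complex
  defines "q \<equiv> \<Prod>x\<leftarrow>xs. [:- complex_of_real x, 1:]"
  assumes z: "Im z \<noteq> 0"
  shows "poly q z \<noteq> 0 \<and> Im z * Im (poly (pderiv q) z * cnj (poly q z)) \<le> 0 \<and>
     (xs \<noteq> [] \<longrightarrow> Im z * Im (poly (pderiv q) z * cnj (poly q z)) < 0)"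
  unfolding q_def
proof (induction xs)
  case Nil
  then show ?case by simp
next
  case (Cons x xs)
  define q where "q = (\<Prod>x\<leftarrow>xs. [:- complex_of_real x, 1:])"
  have q0: "poly q z \<noteq> 0" and IH: "Im z * Im (poly (pderiv q) z * cnj (poly q z)) \<le> 0"
    using Cons.IH by (simp_all add: q_def)
  have zx: "z - of_real x \<noteq> 0" using z by (auto simp: complex_eq_iff)
  have Q: "poly ([:- complex_of_real x, 1:] * q) z = (z - of_real x) * poly q z"
    by (simp add: algebra_simps)
  have Q': "poly (pderiv ([:- complex_of_real x, 1:] * q)) z = poly q z + (z - of_real x) * poly (pderiv q) z"
    unfolding pderiv_mult by (simp add: pderiv_pCons algebra_simps)
  have id: "(poly q z + (z - of_real x) * poly (pderiv q) z) * cnj ((z - of_real x) * poly q z)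
      = of_real ((cmod (poly q z))\<^sup>2) * cnj (z - of_real x)
        + of_real ((cmod (z - of_real x))\<^sup>2) * (poly (pderiv q) z * cnj (poly q z))"
    by (simp only: complex_norm_square complex_cnj_mult) (simp add: algebra_simps)
  have Im: "Im z * Im ((poly q z + (z - of_real x) * poly (pderiv q) z) * cnj ((z - of_real x) * poly q z))
     = - ((cmod (poly q z))\<^sup>2) * (Im z)\<^sup>2 + (cmod (z - of_real x))\<^sup>2 * (Im z * Im (poly (pderiv q) z
         * cnj (poly q z)))"
    unfolding id by (simp add: power2_eq_square algebra_simps)
  have "\<dots> < 0"
  proof -
    have "(cmod (poly q z))\<^sup>2 * (Im z)\<^sup>2 > 0" using q0 z by simp
    moreover have "(cmod (z - of_real x))\<^sup>2 * (Im z * Im (poly (pderiv q) z * cnj (poly q z))) \<le> 0"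
      using IH by (simp add: mult_nonneg_nonpos)
    ultimately show ?thesis by linarith
  qed
  then show ?case using q0 zx Im Q Q' unfolding q_def
    by (auto simp del: mult_pCons_left)
qed

lemma split_poly_if_complex_roots_real:
  fixes p :: "real poly"
  assumes "p \<noteq> 0" "\<And>z::complex. poly (map_poly of_real p) z = 0 \<Longrightarrow> Im z = 0"
  shows "split_poly p"
  using assms
proof (induction "degree p" arbitrary: p)
  case 0
  then obtain c where "p = [:c:]" by (metis degree_eq_zeroE)
  then have "p = smult c (\<Prod>x\<leftarrow>[]. [:-x, 1:])" by simp
  then show ?case unfolding split_poly_def by blast
next
  case (Suc n)
  have "\<not> constant (poly (map_poly complex_of_real p))"
    using Suc.hyps(2) by (simp add: constant_degree degree_map_poly)
  then obtain z where z: "poly (map_poly complex_of_real p) z = 0"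
    using fundamental_theorem_of_algebra by blast
  with Suc.prems have "Im z = 0" by blast
  then have zr: "z = of_real (Re z)" by (simp add: complex_eq_iff)
  have "poly (map_poly complex_of_real p) (of_real (Re z)) = of_real (poly p (Re z))"
    by (simp add: poly_altdef degree_map_poly coeff_map_poly)
  with z zr have "poly p (Re z) = 0" by (metis of_real_eq_0_iff)
  then obtain q where q: "p = [:- Re z, 1:] * q" by (auto simp: poly_eq_0_iff_dvd dvd_def)
  have q0: "q \<noteq> 0" using q Suc.prems by auto
  have "degree p = Suc (degree q)" using q q0 by (simp add: degree_mult_eq del: mult_pCons_left)
  then have dq: "n = degree q" using Suc.hyps(2) by simp
  have "Im w = 0" if "poly (map_poly complex_of_real q) w = 0" for w
  proof (rule Suc.prems(2))
    have "map_poly complex_of_real p = map_poly complex_of_real [:- Re z, 1:] * map_poly complex_of_real q"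
      unfolding q by (rule map_poly_of_real_mult)
    then show "poly (map_poly complex_of_real p) w = 0" using that by (simp del: mult_pCons_left)
  qed
  from Suc.hyps(1)[OF dq q0 this] obtain c xs where "q = smult c (\<Prod>x\<leftarrow>xs. [:-x, 1:])"
    unfolding split_poly_def by blast
  then have "p = smult c (\<Prod>x\<leftarrow>(Re z # xs). [:-x, 1:])" using q by (simp del: mult_pCons_left)
  then show ?case unfolding split_poly_def by blast
qed

lemma split_poly_pderiv:
  assumes "split_poly p" shows "split_poly (pderiv p)"
proof (cases "pderiv p = 0")
  case True
  then show ?thesis unfolding split_poly_def by (intro exI[of _ 0]) simp
next
  case False
  obtain c xs where p: "p = smult c (\<Prod>x\<leftarrow>xs. [:-x, 1:])" using assms unfolding split_poly_def by blast
  define P where "P = (\<Prod>x\<leftarrow>xs. [:- complex_of_real x, 1:])"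
  have xs: "xs \<noteq> []" "c \<noteq> 0" using False p by (auto simp: pderiv_smult)
  have P: "map_poly complex_of_real (\<Prod>x\<leftarrow>xs. [:-x, 1:]) = P"
    unfolding P_def by (induction xs) (auto simp: map_poly_of_real_mult map_poly_pCons simp del:
        mult_pCons_left)
  have "map_poly complex_of_real (pderiv p) = smult (of_real c) (pderiv P)"
    unfolding p P[symmetric]
    by (simp add: pderiv_smult map_poly_smult  map_poly_of_real_pderiv)
  show ?thesis
  proof (rule split_poly_if_complex_roots_real[OF False])
    fix z assume "poly (map_poly complex_of_real (pderiv p)) z = 0"
    then have "poly (pderiv P) z = 0"
      using xs by (simp add: \<open>map_poly complex_of_real (pderiv p) = smult (of_real c) (pderiv P)\<close>)
    then show "Im z = 0" using gauss_lucas_step[of z xs] xs unfolding P_def by fastforce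
  qed
qed

text \<open>Equivalent to the Cauchy-Schwarz inequality \<open>(\<Sum>1/(t - x\<^sub>i))\<^sup>2 \<le> n \<Sum>1/(t - x\<^sub>i)\<^sup>2\<close>, since the left
  and right sums are \<open>q'/q\<close> and \<open>(q'/q)\<^sup>2 - q''/q\<close>. The induction on the roots covers the roots of
  \<open>q\<close> as well, where these quotients make no sense.\<close>

lemma laguerre_inequality:
  fixes xs :: "real list" and t :: real
  defines "q \<equiv> \<Prod>x\<leftarrow>xs. [:-x, 1:]"
  shows "real (length xs) * (poly q t * poly (pderiv (pderiv q)) t)
    \<le> (real (length xs) - 1) * (poly (pderiv q) t)\<^sup>2"
  unfolding q_def
proof (induction xs)
  case Nil
  then show ?case by simp
next
  case (Cons x xs)
  define q where "q = (\<Prod>x\<leftarrow>xs. [:-x, 1:])"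
  define n where "n = real (length xs)"
  define a b c y where "a = poly q t" and "b = poly (pderiv q) t" and "c = poly (pderiv (pderiv q)) t"
      and "y = t - x"
  have IH: "n * (a * c) \<le> (n - 1) * b\<^sup>2" using Cons.IH unfolding a_def b_def c_def n_def q_def .
  have Q0: "poly ([:-x, 1:] * q) t = y * a" by (simp add: algebra_simps a_def y_def)
  have Q1: "poly (pderiv ([:-x, 1:] * q)) t = a + y * b"
    unfolding pderiv_mult by (simp add: pderiv_pCons algebra_simps a_def b_def y_def)
  have Q2: "poly (pderiv (pderiv ([:-x, 1:] * q))) t = 2 * b + y * c"
    unfolding pderiv_mult pderiv_add by (simp add: pderiv_pCons pderiv_mult algebra_simps a_def b_def
        c_def y_def)
  have "(n + 1) * ((y * a) * (2 * b + y * c)) \<le> n * (a + y * b)\<^sup>2"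
  proof (cases "xs = []")
    case True
    then have "b = 0" "c = 0" "n = 0" unfolding b_def c_def n_def q_def by simp_all
    then show ?thesis by simp
  next
    case False
    then have n: "n \<ge> 1" unfolding n_def by (cases xs) auto
    \<comment> \<open>Completing the square leaves a multiple of the induction hypothesis.\<close>
    have "n * (n * (a + y * b)\<^sup>2 - (n + 1) * ((y * a) * (2 * b + y * c)))
      = (n * a - y * b)\<^sup>2 + y\<^sup>2 * ((n + 1) * ((n - 1) * b\<^sup>2 - n * (a * c)))"
      by (simp add: power2_eq_square algebra_simps)
    also have "\<dots> \<ge> 0" using IH n by simp
    finally show ?thesis using n by (simp add: zero_le_mult_iff)
  qed
  then show ?case unfolding prod_list.Cons list.map q_def[symmetric] Q0 Q1 Q2 n_def
    by (simp add: algebra_simps)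
qed

lemma degree_prod_list_linear: "degree (\<Prod>x\<leftarrow>xs. [:-x, 1::real:]) = length xs \<and> (\<Prod>x\<leftarrow>xs. [:-x, 1::real:]) \<noteq> 0"
  by (induction xs) (auto simp: degree_mult_eq simp del: mult_pCons_left)

lemma split_poly_low_coeffs:
  assumes "split_poly p"
  shows "2 * real (degree p) * (coeff p 0 * coeff p 2) \<le> (real (degree p) - 1) * (coeff p 1)\<^sup>2"
proof -
  obtain c xs where p: "p = smult c (\<Prod>x\<leftarrow>xs. [:-x, 1:])" using assms unfolding split_poly_def by blast
  define q where "q = (\<Prod>x\<leftarrow>xs. [:-x, 1::real:])"
  have d: "degree q = length xs" using degree_prod_list_linear unfolding q_def by blast
  show ?thesis
  proof (cases "c = 0")
    case True then show ?thesis unfolding p by simp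
  next
    case False
    have 1: "poly q 0 = coeff q 0" "poly (pderiv q) 0 = coeff q 1" "poly (pderiv (pderiv q)) 0 = 2 * coeff q 2"
      by (simp_all add: poly_0_coeff_0 coeff_pderiv numeral_2_eq_2)
    have "real (length xs) * (coeff q 0 * (2 * coeff q 2)) \<le> (real (length xs) - 1) * (coeff q 1)\<^sup>2"
      using laguerre_inequality[of xs 0] unfolding q_def[symmetric] 1 .
    then have "c\<^sup>2 * (real (length xs) * (coeff q 0 * (2 * coeff q 2)))
        \<le> c\<^sup>2 * ((real (length xs) - 1) * (coeff q 1)\<^sup>2)"
      by (rule mult_left_mono) simp
    then show ?thesis unfolding p q_def[symmetric] using False
      by (simp add: d power2_eq_square algebra_simps)
  qed
qed

lemma split_poly_iterated: "split_poly p \<Longrightarrow> split_poly ((pderiv ^^ m) p)"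
  by (induction m) (auto intro: split_poly_pderiv)

lemma degree_iterated: "degree ((pderiv ^^ m) (p::real poly)) = degree p - m"
  by (induction m) (auto simp: degree_pderiv)

lemma coeff_iterated: "coeff ((pderiv ^^ m) (p::real poly)) i = coeff p (i + m) * (fact (i + m) / fact i)"
  by (induction m arbitrary: i) (auto simp: coeff_pderiv)

lemma coeff_prod_linear:
  assumes J: "finite J" and j: "j \<le> card J"
  shows "coeff (\<Prod>i\<in>J. [:l i, 1:]) (card J - j) = esym J j l"
proof -
  have "(\<Prod>i\<in>J. [:l i, 1:]) = (\<Prod>i\<in>J. [:l i:] + [:0, 1:])" by simp
  also have "\<dots> = (\<Sum>X\<in>Pow J. (\<Prod>i\<in>X. [:l i:]) * (\<Prod>i\<in>J - X. [:0, 1:]))"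
    by (rule prod_add[OF J])
  also have "\<dots> = (\<Sum>X\<in>Pow J. monom (\<Prod>i\<in>X. l i) (card J - card X))"
  proof (rule sum.cong[OF refl])
    fix X assume X: "X \<in> Pow J"
    then have "finite X" using J finite_subset by auto
    have "(\<Prod>i\<in>X. [:l i:]) = [:\<Prod>i\<in>X. l i:]"
      using \<open>finite X\<close> by (induction X rule: finite_induct) auto
    then show "(\<Prod>i\<in>X. [:l i:]) * (\<Prod>i\<in>J - X. [:0, 1:]) = monom (\<Prod>i\<in>X. l i) (card J - card X)"
      using X \<open>finite X\<close> by (simp add: card_Diff_subset monom_altdef)
  qed
  finally have "coeff (\<Prod>i\<in>J. [:l i, 1:]) (card J - j)
      = (\<Sum>X\<in>Pow J. if card J - card X = card J - j then \<Prod>i\<in>X. l i else 0)"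
    by (simp add: coeff_sum)
  also have "\<dots> = (\<Sum>X | X \<in> Pow J \<and> card X = j. \<Prod>i\<in>X. l i)"
  proof -
    have "card J - card X = card J - j \<longleftrightarrow> card X = j" if "X \<in> Pow J" for X
      using card_mono[OF J, of X] that j by auto
    then have "(\<Sum>X\<in>Pow J. if card J - card X = card J - j then \<Prod>i\<in>X. l i else 0)
      = (\<Sum>X\<in>Pow J. if card X = j then \<Prod>i\<in>X. l i else 0)"
      by (intro sum.cong) auto
    also have "\<dots> = (\<Sum>X | X \<in> Pow J \<and> card X = j. \<Prod>i\<in>X. l i)"
      using J by (simp add: sum.inter_filter del: Pow_iff)
    finally show ?thesis .
  qed
  finally show ?thesis unfolding esym_def by simp
qed

lemma esym_0 [simp]: "finite J \<Longrightarrow> esym J 0 l = 1"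
proof -
  assume "finite J"
  then have "{I. I \<subseteq> J \<and> card I = 0} = {{}}" using finite_subset by fastforce
  then show ?thesis by (simp add: esym_def)
qed

lemma esym_gt_card: "finite J \<Longrightarrow> card J < j \<Longrightarrow> esym J j l = 0"
proof -
  assume "finite J" "card J < j"
  then have "{I. I \<subseteq> J \<and> card I = j} = {}" using card_mono leD by blast
  then show ?thesis unfolding esym_def by (simp only: sum.empty)
qed

text \<open>Differentiating \<open>\<Prod>(X + l\<^sub>i)\<close> keeps it real-rooted and only rescales its coefficients. After
  \<open>n - (j + 1)\<close> derivatives the elementary symmetric functions of orders \<open>j + 1\<close>, \<open>j\<close>, \<open>j - 1\<close> are, up to
  factorials, the three lowest coefficients, and Laguerre's inequality at \<open>0\<close> relates them.\<close>

lemma newton_inequality: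
  fixes l :: "'i \<Rightarrow> real"
  assumes J: "finite J" and j: "1 \<le> j" "j < card J"
  shows "(esym J (j - 1) l / (card J choose (j - 1))) * (esym J (j + 1) l / (card J choose (j + 1)))
    \<le> (esym J j l / (card J choose j))\<^sup>2"
proof -
  define n where "n = card J"
  obtain ys where ys: "set ys = J" "distinct ys" using finite_distinct_list[OF J] by blast
  define p where "p = (\<Prod>i\<in>J. [:l i, 1:])"
  have "p = (\<Prod>x\<leftarrow>map (\<lambda>i. - l i) ys. [:-x, 1:])"
    unfolding p_def ys(1)[symmetric] by (simp add: prod.distinct_set_conv_list[OF ys(2)] o_def)
  then have sp: "split_poly p" unfolding split_poly_def by (metis smult_1_left)
  have dp: "degree p = n" unfolding p_def n_def by (subst degree_prod_eq_sum_degree) auto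
  define m where "m = n - (j + 1)"
  define q where "q = (pderiv ^^ m) p"
  have m: "m + (j + 1) = n" unfolding m_def using j n_def by simp
  have dq: "degree q = j + 1" unfolding q_def degree_iterated dp using m by simp
  have c0: "coeff q 0 = esym J (j + 1) l * fact m"
    using coeff_prod_linear[OF J, of "j + 1" l] j unfolding q_def coeff_iterated p_def
    by (simp add: m_def n_def)
  have m1: "card J - j = 1 + m" using m n_def by simp
  have c1: "coeff q 1 = esym J j l * fact (m + 1)"
    using coeff_prod_linear[OF J, of j l] j unfolding q_def coeff_iterated p_def m1 by (simp add: add.commute)
  have m2: "card J - (j - 1) = 2 + m" using m n_def j by simp
  have c2: "coeff q 2 = esym J (j - 1) l * fact (m + 2) / 2"
    using coeff_prod_linear[OF J, of "j - 1" l] j unfolding q_def coeff_iterated p_def m2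
        by (simp add: add.commute)
  have ineq: "2 * real (j + 1) * (coeff q 0 * coeff q 2) \<le> (real (j + 1) - 1) * (coeff q 1)\<^sup>2"
    using split_poly_low_coeffs[OF split_poly_iterated[OF sp, of m]] dq unfolding q_def by simp
  define a b c where "a = esym J (j - 1) l" and "b = esym J j l" and "c = esym J (j + 1) l"
  define F where "F = (fact m :: real)"
  have F: "F > 0" "fact (m + 1) = (m + 1) * F" "fact (m + 2) = (m + 2) * ((m + 1) * F)"
    unfolding F_def by (auto simp: algebra_simps)
  have "F\<^sup>2 * (m + 1) * ((j + 1) * (m + 2) * (c * a)) \<le> F\<^sup>2 * (m + 1) * (j * (m + 1) * b\<^sup>2)"
    using ineq unfolding c0 c1 c2 F F_def[symmetric] a_def[symmetric] b_def[symmetric] c_def[symmetric]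
    by (simp add: power2_eq_square algebra_simps)
  then have main: "(j + 1) * (m + 2) * (c * a) \<le> j * (m + 1) * b\<^sup>2"
    using F(1) by (subst (asm) mult_le_cancel_left_pos) auto
  define B where "B = real (n choose j)"
  have B: "B > 0" unfolding B_def using j n_def by simp
  have r1: "real (n choose (j + 1)) * (j + 1) = B * (m + 1)"
  proof -
    have "(n choose (j + 1)) * (j + 1) = (n choose j) * (n - j)"
      using binomial_absorb_comp[of n j] binomial_absorption[of j n] m by (simp add: mult.commute)
    then show ?thesis unfolding B_def using m1 n_def by (metis of_nat_mult add.commute)
  qed
  have r2: "real (n choose (j - 1)) * (m + 2) = B * j"
  proof -
    obtain i where i: "j = Suc i" using j by (cases j) auto
    have "(n choose (i + 1)) * (i + 1) = (n choose i) * (n - i)"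
      using binomial_absorb_comp[of n i] binomial_absorption[of i n] m by (simp add: mult.commute)
    then show ?thesis unfolding B_def using m2 n_def i
        by (metis of_nat_mult add.commute diff_Suc_1 Suc_eq_plus1)
  qed
  have e1: "real (n choose (j + 1)) = B * (m + 1) / (j + 1)" using r1 by (simp add: field_simps)
  have e2: "real (n choose (j - 1)) = B * j / (m + 2)" using r2 by (simp add: field_simps)
  have "(a / real (n choose (j - 1))) * (c / real (n choose (j + 1)))
      = ((j + 1) * (m + 2) * (c * a)) / (j * (m + 1) * B\<^sup>2)"
  proof -
    have "(a / (x * y / z)) * (c / (x * v / w)) = (w * z * (c * a)) / (y * v * x\<^sup>2)" for x y z v w :: real
      by (simp add: power2_eq_square mult_ac)
    then show ?thesis unfolding e1 e2 of_nat_mult .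
  qed
  also have "\<dots> \<le> (j * (m + 1) * b\<^sup>2) / (j * (m + 1) * B\<^sup>2)"
    by (rule divide_right_mono[OF main]) simp
  also have "\<dots> = (b / B)\<^sup>2"
  proof -
    have "real j * real (m + 1) \<noteq> 0" using j by simp
    then show ?thesis unfolding power_divide of_nat_mult by (rule mult_divide_mult_cancel_left)
  qed
  finally show ?thesis unfolding a_def b_def c_def B_def n_def .
qed

text \<open>The quotients \<open>E (j + 1) / E j\<close> decrease. If some \<open>E j\<close> were below \<open>E 0 = 1\<close>, one of the quotients
  before \<open>j\<close> would be below \<open>1\<close>, hence all later ones, and \<open>E k = 1\<close> could not be reached.\<close>

lemma log_concave_maclaurin:
  fixes E :: "nat \<Rightarrow> real"
  assumes k: "1 \<le> k" and pos: "\<And>j. j \<le> k \<Longrightarrow> E j > 0"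
    and newton: "\<And>j. 1 \<le> j \<Longrightarrow> j < k \<Longrightarrow> E (j - 1) * E (j + 1) \<le> (E j)\<^sup>2"
    and E0: "E 0 = 1" and Ek: "E k = 1"
  shows "\<And>j. j \<le> k \<Longrightarrow> E j \<ge> 1"
proof -
  have dec: "E (j + 1) / E j \<le> E j / E (j - 1)" if "1 \<le> j" "j < k" for j
    using newton[OF that] pos[of j] pos[of "j - 1"] that by (simp add: field_simps power2_eq_square)
  have mono: "E (Suc i + 1) / E (Suc i) \<le> E (Suc j) / E j" if "j \<le> i" "Suc i < k" for i j
    using that
  proof (induction "i - j" arbitrary: i)
    case 0 then show ?case using dec[of "Suc j"] by simp
  next
    case (Suc d)
    then obtain i' where i': "i = Suc i'" by (cases i) auto
    then have "E (Suc i' + 1) / E (Suc i') \<le> E (Suc j) / E j" using Suc by auto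
    then show ?case using dec[of "Suc i"] Suc.prems i' by simp
  qed
  have r: "E (Suc i) / E i \<le> E (Suc j) / E j" if "j \<le> i" "i < k" for i j
  proof (cases "i = j")
    case False
    then have "j \<le> i - 1" "Suc (i - 1) = i" using that by auto
    then show ?thesis using mono[of j "i - 1"] that by simp
  qed simp
  show "E j \<ge> 1" if "j \<le> k" for j
  proof (rule ccontr)
    assume "\<not> E j \<ge> 1"
    then have lt: "E j < 1" by simp
    have "\<exists>i<j. E (Suc i) / E i < 1"
    proof (rule ccontr)
      assume n: "\<not> ?thesis"
      have "E i \<ge> 1" if "i \<le> j" for i
        using that
      proof (induction i)
        case (Suc i)
        have "\<not> E (Suc i) / E i < 1" using n Suc.prems Suc_le_lessD by blast
        then have "E (Suc i) / E i \<ge> 1" by linarith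
        moreover have "E i > 0" using pos[of i] Suc.prems \<open>j \<le> k\<close> by linarith
        ultimately have "E (Suc i) \<ge> E i" by (simp add: le_divide_eq)
        then show ?case using Suc by simp
      qed (simp add: E0)
      then show False using lt by force
    qed
    then obtain i where i: "i < j" "E (Suc i) / E i < 1" by blast
    have "E m < 1" if "j \<le> m" "m \<le> k" for m
      using that
    proof (induction m rule: dec_induct)
      case (step m)
      have "E (Suc m) / E m \<le> E (Suc i) / E i" using r[of i m] i step by simp
      then have "E (Suc m) / E m < 1" using i by linarith
      then show ?case using step pos[of m] by (simp add: divide_less_eq)
    qed (rule lt)
    then show False using Ek that by force
  qed
qed

text \<open>The normalization makes the value at \<open>(1, \<dots>, 1)\<close> the extremal one for the other elementary
  symmetric functions: a minimum below order \<open>k\<close>, a maximum at order \<open>k + 1\<close>.\<close>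

lemma maclaurin_esym:
  fixes l :: "'i \<Rightarrow> real"
  assumes J: "finite J" and k: "1 \<le> k" "k \<le> card J"
    and pos: "\<And>j. j \<le> k \<Longrightarrow> esym J j l > 0" and Ek: "esym J k l = card J choose k"
  shows "j \<le> k \<Longrightarrow> esym J j l \<ge> card J choose j"
    and "esym J (k + 1) l \<le> card J choose (k + 1)"
proof -
  define E where "E j = esym J j l / (card J choose j)" for j
  have p: "E j > 0" if "j \<le> k" for j unfolding E_def using pos[OF that] that k by simp
  have nt: "E (j - 1) * E (j + 1) \<le> (E j)\<^sup>2" if "1 \<le> j" "j < card J" for j
    unfolding E_def using newton_inequality[OF J that] .
  have E0: "E 0 = 1" and Ek1: "E k = 1" using J Ek k by (auto simp: E_def)
  have ge: "E j \<ge> 1" if "j \<le> k" for j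
    by (rule log_concave_maclaurin[OF k(1) p _ E0 Ek1 that]) (use nt k in auto)
  show "esym J j l \<ge> card J choose j" if "j \<le> k" 
    using ge[OF that] that k unfolding E_def by (simp add: le_divide_eq)
  show "esym J (k + 1) l \<le> card J choose (k + 1)"
  proof (cases "k = card J")
    case True
    then show ?thesis using esym_gt_card[OF J, of "k + 1" l] by simp
  next
    case False
    then have "E (k - 1) * E (k + 1) \<le> 1" using nt[of k] k Ek1 by simp
    have "E (k - 1) \<ge> 1" using ge by simp
    have "E (k + 1) \<le> 1"
    proof (rule ccontr)
      assume "\<not> ?thesis"
      then have "1 * E (k + 1) > 1" "1 * E (k + 1) \<le> E (k - 1) * E (k + 1)"
        using \<open>E (k - 1) \<ge> 1\<close> by (auto intro: mult_right_mono)
      then show False using \<open>E (k - 1) * E (k + 1) \<le> 1\<close> by linarith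
    qed
    then show ?thesis using False k unfolding E_def by (simp add: divide_le_eq)
  qed
qed

section \<open>Spectral decomposition of symmetric matrices\<close>

lemma symmetric_matrix_inner:
  fixes A :: "real^'n^'n"
  assumes "transpose A = A"
  shows "(A *v x) \<bullet> y = x \<bullet> (A *v y)"
  by (metis assms dot_lmul_matrix inner_commute transpose_matrix_vector)

text \<open>A maximizer of \<open>x \<bullet> Ax\<close> on the unit sphere of the subspace is an eigenvector, because the
  first variation in directions orthogonal to it vanishes.\<close>

lemma invariant_subspace_eigenvector:
  fixes A :: "real^'n^'n"
  assumes sym: "transpose A = A" and V: "subspace V" and inv: "\<And>v. v \<in> V \<Longrightarrow> A *v v \<in> V"
    and nz: "V \<noteq> {0}"
  obtains x t where "x \<in> V" "norm x = 1" "A *v x = t *\<^sub>R x"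
proof -
  define S where "S = V \<inter> sphere 0 1"
  have cS: "compact S" unfolding S_def using closed_subspace[OF V] by (simp add: closed_Int_compact)
  obtain v where "v \<in> V" "v \<noteq> 0" using nz subspace_0[OF V] by auto
  then have "v /\<^sub>R norm v \<in> S" unfolding S_def using V by (simp add: subspace_scale)
  then have nS: "S \<noteq> {}" by auto
  have cont: "continuous_on S (\<lambda>x. x \<bullet> (A *v x))"
    by (intro continuous_intros linear_continuous_on) (simp add: linear_conv_bounded_linear[symmetric])
  obtain x where x: "x \<in> S" and mx: "\<And>y. y \<in> S \<Longrightarrow> y \<bullet> (A *v y) \<le> x \<bullet> (A *v x)"
    using continuous_attains_sup[OF cS nS cont] by blast
  define m where "m = x \<bullet> (A *v x)"
  have xV: "x \<in> V" and nx: "norm x = 1" using x unfolding S_def by auto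
  have quad: "y \<bullet> (A *v y) \<le> m * (y \<bullet> y)" if "y \<in> V" for y
  proof (cases "y = 0")
    case False
    have "y /\<^sub>R norm y \<in> S" unfolding S_def using V that False by (simp add: subspace_scale)
    then have "(y /\<^sub>R norm y) \<bullet> (A *v (y /\<^sub>R norm y)) \<le> m" using mx m_def by blast
    then have "(y \<bullet> (A *v y)) / (norm y)\<^sup>2 \<le> m"
      by (simp add: matrix_vector_mult_scaleR power2_eq_square divide_inverse algebra_simps)
    then show ?thesis using False by (simp add: divide_le_eq dot_square_norm)
  qed simp
  have orth: "v \<bullet> (A *v x) = 0" if v: "v \<in> V" "v \<bullet> x = 0" for v
  proof (rule ccontr)
    assume nz: "v \<bullet> (A *v x) \<noteq> 0"
    define b where "b = v \<bullet> (A *v x)"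
    define c where "c = m * (v \<bullet> v) - v \<bullet> (A *v v)"
    have ineq: "2 * t * b \<le> t\<^sup>2 * c" for t
    proof -
      have "(x + t *\<^sub>R v) \<bullet> (A *v (x + t *\<^sub>R v)) \<le> m * ((x + t *\<^sub>R v) \<bullet> (x + t *\<^sub>R v))"
        by (rule quad) (use V xV v in \<open>simp add: subspace_add subspace_scale\<close>)
      moreover have "x \<bullet> (A *v v) = b" unfolding b_def
        using symmetric_matrix_inner[OF sym, of x v] by (simp add: inner_commute)
      moreover have "x \<bullet> x = 1" using nx by (simp add: dot_square_norm)
      ultimately show ?thesis using v(2) unfolding c_def m_def b_def
        by (simp add: matrix_vector_right_distrib matrix_vector_mult_scaleR inner_add_left inner_add_right
            inner_commute power2_eq_square algebra_simps)
    qed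
    \<comment> \<open>A step so small that the linear term dominates the quadratic one.\<close>
    define s where "s = b / (\<bar>c\<bar> + 1)"
    have "2 * s * b \<le> s\<^sup>2 * (\<bar>c\<bar> + 1)"
    proof -
      have "c \<le> \<bar>c\<bar> + 1" by linarith
      then have "s\<^sup>2 * c \<le> s\<^sup>2 * (\<bar>c\<bar> + 1)" by (rule mult_left_mono) simp
      then show ?thesis using ineq[of s] by linarith
    qed
    also have "\<dots> = s * b" unfolding s_def by (simp add: power2_eq_square)
    finally have "s * b \<le> 0" by linarith
    moreover have "s * b = b\<^sup>2 / (\<bar>c\<bar> + 1)" unfolding s_def by (simp add: power2_eq_square)
    moreover have "b\<^sup>2 / (\<bar>c\<bar> + 1) > 0" using nz unfolding b_def by (intro divide_pos_pos) auto
    ultimately show False by linarith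
  qed
  define w where "w = A *v x - m *\<^sub>R x"
  have wV: "w \<in> V" unfolding w_def using V xV inv by (simp add: subspace_diff subspace_scale)
  have "x \<bullet> x = 1" using nx by (simp add: dot_square_norm)
  then have wx: "w \<bullet> x = 0" unfolding w_def m_def
    by (simp add: inner_diff_left inner_diff_right inner_commute)
  have "w \<bullet> w = w \<bullet> (A *v x) - m * (w \<bullet> x)" unfolding w_def by (simp add: inner_diff_right)
  also have "\<dots> = 0" using orth[OF wV wx] wx by simp
  finally have "A *v x = m *\<^sub>R x" unfolding w_def by simp
  then show ?thesis using that xV nx by blast
qed

lemma invariant_subspace_eigenbasis:
  fixes A :: "real^'n^'n"
  assumes sym: "transpose A = A"
  shows "subspace V \<Longrightarrow> (\<And>v. v \<in> V \<Longrightarrow> A *v v \<in> V) \<Longrightarrow>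
    \<exists>B. pairwise orthogonal B \<and> (\<forall>b\<in>B. norm b = 1 \<and> (\<exists>t. A *v b = t *\<^sub>R b)) \<and> B \<subseteq> V \<and> card B = dim V \<and> finite B"
proof (induction "dim V" arbitrary: V)
  case 0
  then show ?case by (intro exI[of _ "{}"]) auto
next
  case (Suc d)
  have "V \<noteq> {0}" using Suc.hyps(2) by auto
  then obtain x t where x: "x \<in> V" "norm x = 1" "A *v x = t *\<^sub>R x"
    using invariant_subspace_eigenvector[OF sym Suc.prems] by blast
  define W where "W = {v \<in> V. orthogonal x v}"
  have W: "subspace W" unfolding W_def using Suc.prems(1)
    by (auto simp: subspace_def orthogonal_def inner_add_right)
  have Winv: "A *v v \<in> W" if "v \<in> W" for v
    using that Suc.prems(2) symmetric_matrix_inner[OF sym, of x v] x(3)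
    unfolding W_def orthogonal_def by simp
  have dW: "dim V = Suc (dim W)"
  proof -
    have sp: "dim {x} = 1" using x(2) by (metis dim_singleton norm_zero zero_neq_one)
    have "dim {y \<in> span V. \<forall>z \<in> span {x}. orthogonal z y} + dim (span {x}) = dim (span V)"
      by (rule dim_subspace_orthogonal_to_vectors) (use x(1) in \<open>auto simp: span_base span_mono\<close>)
    moreover have "{y \<in> span V. \<forall>z \<in> span {x}. orthogonal z y} = W"
      unfolding W_def span_eq_iff[THEN iffD2, OF Suc.prems(1)]
      by (auto simp: span_singleton orthogonal_def)
    ultimately show ?thesis using sp by simp
  qed
  obtain B where B: "pairwise orthogonal B" "\<forall>b\<in>B. norm b = 1 \<and> (\<exists>t. A *v b = t *\<^sub>R b)" "B \<subseteq> W" "card B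
      = dim W" "finite B"
    using Suc.hyps(1)[of W] Suc.hyps(2) dW W Winv by auto
  have xB: "x \<notin> B" using B(3) x(2) unfolding W_def by (auto simp: orthogonal_def)
  show ?case
  proof (intro exI[of _ "insert x B"] conjI)
    show "pairwise orthogonal (insert x B)"
      using B unfolding W_def pairwise_insert by (auto simp: orthogonal_commute)
    show "insert x B \<subseteq> V" using B x unfolding W_def by auto
    show "card (insert x B) = dim V" using xB B dW by simp
  qed (use B x in auto)
qed

theorem symmetric_matrix_eigenbasis:
  fixes A :: "real^'n^'n"
  assumes sym: "transpose A = A"
  obtains e :: "'n \<Rightarrow> real^'n" and l :: "'n \<Rightarrow> real"
  where "\<And>i j. e i \<bullet> e j = (if i = j then 1 else 0)" "\<And>i. A *v e i = l i *\<^sub>R e i"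
proof -
  obtain B where B: "pairwise orthogonal B" "\<forall>b\<in>B. norm b = 1 \<and> (\<exists>t. A *v b = t *\<^sub>R b)" "card B
      = dim (UNIV :: (real^'n) set)" "finite B"
    using invariant_subspace_eigenbasis[OF sym, of UNIV] by auto
  have "card B = card (UNIV :: 'n set)" using B by simp
  then obtain e where e: "bij_betw e (UNIV :: 'n set) B"
    using B(4) by (metis finite_same_card_bij finite)
  define l where "l i = (SOME t. A *v e i = t *\<^sub>R e i)" for i
  have eB: "e i \<in> B" for i using e by (auto simp: bij_betw_def)
  have inj: "inj e" using e by (auto simp: bij_betw_def)
  show ?thesis
  proof
    show "A *v e i = l i *\<^sub>R e i" for i unfolding l_def by (rule someI_ex) (use B eB in auto)
    show "e i \<bullet> e j = (if i = j then 1 else 0)" for i j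
    proof (cases "i = j")
      case True
      then show ?thesis using B eB[of j] by (simp add: dot_square_norm)
    next
      case False
      then have "e i \<noteq> e j" using inj by (auto dest: injD)
      then show ?thesis using B(1) eB False unfolding pairwise_def orthogonal_def by auto
    qed
  qed
qed

text \<open>An orthonormal basis of eigenvectors reduces every identity between polynomials in \<open>A\<close> to an identity
  between symmetric functions of the eigenvalues.\<close>

locale eigenbasis =
  fixes A :: "real^'n^'n" and e :: "'n \<Rightarrow> real^'n" and l :: "'n \<Rightarrow> real"
  assumes orthonormal: "\<And>i j. e i \<bullet> e j = (if i = j then 1 else 0)"
    and eigen: "\<And>i. A *v e i = l i *\<^sub>R e i"
begin

lemma inj_e: "inj e"
  by (rule injI) (metis orthonormal zero_neq_one)

lemma independent_image: "independent (e ` J)"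
  by (rule pairwise_orthogonal_independent)
     (auto simp: pairwise_def orthogonal_def orthonormal, (metis inner_zero_left orthonormal zero_neq_one)+)

lemma span_range: "span (range e) = UNIV"
proof -
  have "dim (range e) = CARD('n)"
    using dim_eq_card_independent[OF independent_image[of UNIV]] card_image[OF inj_e] by simp
  then show ?thesis using dim_eq_full[of "range e"] by simp
qed

lemma vector_ext: "(\<And>i. v \<bullet> e i = w \<bullet> e i) \<Longrightarrow> v = w"
proof -
  assume "\<And>i. v \<bullet> e i = w \<bullet> e i"
  then have "\<And>b. b \<in> range e \<Longrightarrow> orthogonal (v - w) b" by (auto simp: orthogonal_def inner_diff_left)
  then have "orthogonal (v - w) x" if "x \<in> span (range e)" for x
    using orthogonal_to_span[OF that, of "v - w"] by (simp add: orthogonal_commute)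
  then show "v = w" using span_range orthogonal_self[of "v - w"] by simp
qed

lemma expand: "v = (\<Sum>i\<in>UNIV. (v \<bullet> e i) *\<^sub>R e i)"
  by (rule vector_ext) (simp add: inner_sum_left orthonormal if_distrib sum.delta cong: if_cong)

lemma matrix_ext: "(\<And>i. M *v e i = M' *v e i) \<Longrightarrow> M = M'" for M M' :: "real^'n^'n"
proof -
  assume *: "\<And>i. M *v e i = M' *v e i"
  have "M *v v = M' *v v" for v
    by (subst (1 2) expand[of v]) (simp add: matrix_vector_mult_scaleR
        * linear_sum[OF matrix_vector_mul_linear])
  then show "M = M'" by (simp add: matrix_eq)
qed

lemma trace_eq: "trace M = (\<Sum>i\<in>UNIV. e i \<bullet> (M *v e i))" for M :: "real^'n^'n"
proof -
  define Q where "Q = (\<chi> i j. e j $ i)"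
  have QQ: "transpose Q ** Q = mat 1"
    by (simp add: Q_def matrix_matrix_mult_def transpose_def mat_def vec_eq_iff inner_vec_def[symmetric,
        simplified] orthonormal[unfolded inner_vec_def inner_real_def])
  have "(\<Sum>i\<in>UNIV. e i \<bullet> (M *v e i)) = trace (transpose Q ** (M ** Q))"
    by (simp add: Q_def matrix_matrix_mult_def transpose_def trace_def matrix_vector_mult_def inner_vec_def)
  also have "\<dots> = trace ((M ** Q) ** transpose Q)" by (rule trace_mul_sym)
  also have "\<dots> = trace (M ** (Q ** transpose Q))" by (simp add: matrix_mul_assoc)
  also have "Q ** transpose Q = mat 1" using QQ matrix_left_right_inverse by blast
  finally show ?thesis by simp
qed

lemma det_shift: "det (t *\<^sub>R mat 1 + A) = (\<Prod>i\<in>UNIV. t + l i)"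
proof -
  define Q where "Q = (\<chi> i j. e j $ i)"
  define D where "D = (\<chi> i j. if i = j then t + l i else 0)"
  have QQ: "transpose Q ** Q = mat 1"
    by (simp add: Q_def matrix_matrix_mult_def transpose_def mat_def vec_eq_iff orthonormal[unfolded
        inner_vec_def inner_real_def])
  have "((t *\<^sub>R mat 1 + A) ** Q) = Q ** D"
  proof -
    have "(t *\<^sub>R mat 1 + A) *v e j = (t + l j) *\<^sub>R e j" for j
      by (simp add: matrix_vector_mult_add_rdistrib eigen scaleR_matrix_vector_assoc[symmetric] scaleR_add_left)
    then have "((t *\<^sub>R mat 1 + A) *v e j) $ i = (t + l j) * e j $ i" for i j by simp
    then show ?thesis
      by (simp add: Q_def D_def matrix_matrix_mult_def vec_eq_iff matrix_vector_mult_def if_distrib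
          sum.delta cong: if_cong)
  qed
  then have "det (t *\<^sub>R mat 1 + A) * det Q = det Q * det D" by (metis det_mul)
  moreover have "det Q \<noteq> 0" using QQ by (metis det_mul det_I mult_zero_right zero_neq_one)
  moreover have "det D = (\<Prod>i\<in>UNIV. t + l i)" unfolding D_def by (subst det_diagonal) auto
  ultimately show ?thesis by simp
qed

lemma eigenvalue_listing: "eigenvalue_listing A l"
  unfolding eigenvalue_listing_def
proof
  fix t
  have "{v. A *v v = t *\<^sub>R v} = span (e ` {i. l i = t})"
  proof
    show "span (e ` {i. l i = t}) \<subseteq> {v. A *v v = t *\<^sub>R v}"
      by (rule span_minimal) (auto simp: eigen subspace_def matrix_vector_right_distrib scaleR_add_right
          matrix_vector_mult_scaleR)
    show "{v. A *v v = t *\<^sub>R v} \<subseteq> span (e ` {i. l i = t})"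
    proof
      fix v assume "v \<in> {v. A *v v = t *\<^sub>R v}"
      then have v: "A *v v = t *\<^sub>R v" by simp
      have "A *v v = (\<Sum>i\<in>UNIV. (v \<bullet> e i) *\<^sub>R (l i *\<^sub>R e i))"
        by (subst expand[of v]) (simp add: linear_sum[OF matrix_vector_mul_linear]
            matrix_vector_mult_scaleR eigen)
      then have "(A *v v) \<bullet> e j = (v \<bullet> e j) * l j" for j
        by (simp add: inner_sum_left orthonormal if_distrib sum.delta cong: if_cong)
      then have z: "v \<bullet> e j = 0" if "l j \<noteq> t" for j using v that
          by (metis inner_scaleR_left mult.commute mult_cancel_left)
      have "(v \<bullet> e i) *\<^sub>R e i \<in> span (e ` {i. l i = t})" for i
        using z[of i] by (cases "l i = t") (auto intro: span_scale span_base span_zero)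
      then show "v \<in> span (e ` {i. l i = t})" by (subst expand[of v]) (rule span_sum)
    qed
  qed
  then show "card {i. l i = t} = dim {v. A *v v = t *\<^sub>R v}"
    using dim_eq_card_independent[OF independent_image] card_image[OF inj_on_subset[OF inj_e]]
    by (simp add: dim_span)
qed

text \<open>Any two listings of the eigenvalues have the same multiplicities, so they differ by a permutation of the
  indices; the choice made in the definition of \<open>S_elem\<close> is therefore immaterial.\<close>

lemma S_elem_eq: "S_elem j A = esym UNIV j l"
proof -
  define l' where "l' = (SOME l. eigenvalue_listing A l)"
  have "eigenvalue_listing A l'" unfolding l'_def
      by (rule someI[of "eigenvalue_listing A"]) (rule eigenvalue_listing)
  then have c: "card {i. l' i = t} = card {i. l i = t}" for t
    using eigenvalue_listing unfolding eigenvalue_listing_def by metis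
  have "image_mset l' (mset_set UNIV) = image_mset l (mset_set UNIV)"
  proof (rule multiset_eqI)
    fix t
    show "count (image_mset l' (mset_set UNIV)) t = count (image_mset l (mset_set UNIV)) t"
      using c[of t] by (simp add: count_image_mset vimage_def)
  qed
  then obtain p where p: "p permutes UNIV" "\<And>i. l' i = l (p i)"
    using image_mset_eq_implies_permutes[of UNIV l' l] by auto
  have bp: "bij p" using p(1) by (rule permutes_bij)
  have "S_elem j A = (\<Sum>I | card I = j. \<Prod>i\<in>I. l (p i))"
    unfolding S_elem_def Let_def l'_def[symmetric] by (simp add: p)
  also have "\<dots> = (\<Sum>I | card I = j. \<Prod>i\<in>p ` I. l i)"
    using inj_on_subset[OF bij_is_inj[OF bp]] by (intro sum.cong refl) (simp add: prod.reindex)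
  also have "\<dots> = (\<Sum>I | card I = j. \<Prod>i\<in>I. l i)"
  proof (rule sum.reindex_bij_betw)
    have "card (p ` I) = card I" for I by (rule card_image[OF inj_on_subset[OF bij_is_inj[OF bp]]]) simp
    moreover have "p ` (inv p ` I) = I" "inv p ` (p ` I) = I" for I
      using bp by (auto simp: image_comp bij_def surj_f_inv_f inv_f_f image_iff)
    ultimately show "bij_betw ((`) p) {I. card I = j} {I. card I = j}"
      by (intro bij_betw_byWitness[where f' = "(`) (inv p)"]) (auto, metis)
  qed
  finally show ?thesis unfolding esym_def by simp
qed

end

section \<open>Sums of principal minors and Newton tensors\<close>

text \<open>Expanding each factor \<open>A $ i $ p i + t * B $ i $ p i\<close> of the Leibniz formula exhibits the determinant as a polynomial in
  \<open>t\<close>. It serves twice: for the characteristic polynomial (\<open>B\<close> the matrix, \<open>A\<close> the identity) and for perturbing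
  a Jacobian.\<close>

lemma det_add_scaled_rows:
  fixes A B :: "real^'n^'n"
  shows "det (A + t *\<^sub>R B) = (\<Sum>I\<in>UNIV. t ^ card I * det (\<chi> i. if i \<in> I then B $ i else A $ i))"
proof -
  have "(\<Prod>i\<in>UNIV. (A + t *\<^sub>R B) $ i $ p i)
      = (\<Sum>I\<in>UNIV. t ^ card I * (\<Prod>i\<in>UNIV. (\<chi> i. if i \<in> I then B $ i else A $ i) $ i $ p i))" for p
  proof -
    have "(\<Prod>i\<in>UNIV. (A + t *\<^sub>R B) $ i $ p i) = (\<Prod>i\<in>UNIV. t * B $ i $ p i + A $ i $ p i)"
      by (simp add: add.commute)
    also have "\<dots> = (\<Sum>I\<in>Pow UNIV. (\<Prod>i\<in>I. t * B $ i $ p i) * (\<Prod>i\<in>UNIV - I. A $ i $ p i))"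
      by (rule prod_add) simp
    also have "\<dots> = (\<Sum>I\<in>UNIV. t ^ card I * (\<Prod>i\<in>UNIV. (\<chi> i. if i \<in> I then B $ i else A $ i) $ i $ p i))"
    proof (rule sum.cong)
      fix I :: "'n set"
      have "(\<Prod>i\<in>UNIV. (if i \<in> I then B $ i else A $ i) $ p i)
          = (\<Prod>i\<in>UNIV. if i \<in> I then B $ i $ p i else A $ i $ p i)" by (intro prod.cong) auto
      also have "\<dots> = (\<Prod>i\<in>I. B $ i $ p i) * (\<Prod>i\<in>UNIV - I. A $ i $ p i)"
        by (subst prod.If_cases) (auto simp: Compl_eq_Diff_UNIV)
      finally show "(\<Prod>i\<in>I. t * B $ i $ p i) * (\<Prod>i\<in>UNIV - I. A $ i $ p i)
          = t ^ card I * (\<Prod>i\<in>UNIV. (\<chi> i. if i \<in> I then B $ i else A $ i) $ i $ p i)"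
        by (simp add: prod.distrib)
    qed auto
    finally show ?thesis .
  qed
  then show ?thesis unfolding det_def
    by (simp add: sum_distrib_left mult_ac) (subst sum.swap, simp)
qed

text \<open>The sum of the principal minors of order \<open>j\<close>, which for symmetric matrices is \<open>S_elem\<close>. Being a polynomial
  in the entries it is visibly continuous, unlike the definition by eigenvalues.\<close>

definition sigma :: "nat \<Rightarrow> real^'n^'n \<Rightarrow> real" where
  "sigma j A = (\<Sum>I | card I = j. det (\<chi> i. if i \<in> I then A $ i else mat 1 $ i))"

lemma sum_over_subsets_by_card:
  fixes f :: "'n::finite set \<Rightarrow> real"
  shows "(\<Sum>I\<in>UNIV. t ^ card I * f I) = (\<Sum>j\<le>CARD('n). (\<Sum>I | card I = j. f I) * t ^ j)"
proof -
  have "(\<Sum>I\<in>UNIV. t ^ card I * f I) = (\<Sum>j\<le>CARD('n). \<Sum>I | I \<in> UNIV \<and> card I = j. t ^ card I * f I)"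
    by (rule sum.group[symmetric]) (auto intro: card_mono)
  also have "\<dots> = (\<Sum>j\<le>CARD('n). \<Sum>I | card I = j. f I * t ^ j)"
    by (intro sum.cong) auto
  finally show ?thesis by (simp only: sum_distrib_right)
qed

lemma det_shift_sigma:
  fixes A :: "real^'n^'n"
  shows "det (mat 1 + s *\<^sub>R A) = (\<Sum>j\<le>CARD('n). sigma j A * s ^ j)"
  unfolding det_add_scaled_rows sum_over_subsets_by_card sigma_def ..

lemma matrix_mult_scaleR_left: "(c *\<^sub>R A) ** B = c *\<^sub>R (A ** (B :: real^'n^'n))"
  by (simp add: matrix_matrix_mult_def vec_eq_iff sum_distrib_left mult_ac)

lemma matrix_mult_scaleR_right: "A ** (c *\<^sub>R B) = c *\<^sub>R (A ** (B :: real^'n^'n))"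
  by (simp add: matrix_matrix_mult_def vec_eq_iff sum_distrib_left mult_ac)

lemma matrix_mult_diff_left: "(A - B) ** C = A ** C - B ** (C :: real^'n^'n)"
  by (simp add: matrix_matrix_mult_def vec_eq_iff sum_subtractf left_diff_distrib)

lemma matrix_mult_diff_right: "A ** (B - C) = A ** B - A ** (C :: real^'n^'n)"
  by (simp add: matrix_matrix_mult_def vec_eq_iff sum_subtractf right_diff_distrib)

lemma matrix_mult_zero_right: "A ** (0 :: real^'n^'n) = 0"
  by (simp add: matrix_matrix_mult_def vec_eq_iff)

lemma matrix_mult_add_right: "A ** (B + C) = A ** B + A ** (C :: real^'n^'n)"
  by (simp add: matrix_matrix_mult_def vec_eq_iff sum.distrib distrib_left)

lemma trace_scaleR: "trace (c *\<^sub>R A) = c * trace (A :: real^'n^'n)"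
  by (simp add: trace_def sum_distrib_left)

lemma det_scaleR: "det (c *\<^sub>R A) = c ^ CARD('n) * det (A :: real^'n^'n)"
proof -
  have "c *\<^sub>R A = (c *\<^sub>R mat 1) ** A" by (simp add: matrix_mult_scaleR_left)
  moreover have "det (c *\<^sub>R mat 1 :: real^'n^'n) = c ^ CARD('n)"
    by (subst det_diagonal) (auto simp: mat_def)
  ultimately show ?thesis by (simp add: det_mul)
qed

lemma det_shift_sigma':
  fixes A :: "real^'n^'n"
  assumes t: "t \<noteq> 0"
  shows "det (t *\<^sub>R mat 1 + A) = (\<Sum>j\<le>CARD('n). sigma j A * t ^ (CARD('n) - j))"
proof -
  have "t *\<^sub>R mat 1 + A = t *\<^sub>R (mat 1 + inverse t *\<^sub>R A)" using t by (simp add: scaleR_add_right)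
  then have "det (t *\<^sub>R mat 1 + A) = t ^ CARD('n) * det (mat 1 + inverse t *\<^sub>R A)" by (simp only: det_scaleR)
  also have "\<dots> = (\<Sum>j\<le>CARD('n). sigma j A * (t ^ CARD('n) * inverse t ^ j))"
    by (simp add: det_shift_sigma sum_distrib_left mult_ac)
  also have "\<dots> = (\<Sum>j\<le>CARD('n). sigma j A * t ^ (CARD('n) - j))"
    using t by (intro sum.cong) (auto simp: power_diff power_inverse divide_inverse)
  finally show ?thesis .
qed

text \<open>This is how identities that hold for all large parameters are split into identities for the
  single coefficients.\<close>

lemma polyfun_zero_if_zero_on_infinite:
  fixes c :: "nat \<Rightarrow> real"
  assumes "infinite Z" "\<And>t. t \<in> Z \<Longrightarrow> (\<Sum>i\<le>n. c i * t ^ i) = 0" "i \<le> n"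
  shows "c i = 0"
proof (rule ccontr)
  assume "c i \<noteq> 0"
  then have "finite {t. (\<Sum>i\<le>n. c i * t ^ i) = 0}" using polyfun_finite_roots[of c n] assms(3) by auto
  moreover have "Z \<subseteq> {t. (\<Sum>i\<le>n. c i * t ^ i) = 0}" using assms(2) by auto
  ultimately show False using assms(1) finite_subset by blast
qed

lemma sum_reverse_power:
  fixes c :: "nat \<Rightarrow> real"
  shows "(\<Sum>j\<le>n. c j * t ^ (n - j)) = (\<Sum>i\<le>n. c (n - i) * t ^ i)"
  by (rule sum.reindex_bij_witness[of _ "\<lambda>i. n - i" "\<lambda>i. n - i"]) auto

lemma continuous_on_det [continuous_intros]:
  fixes f :: "'a::topological_space \<Rightarrow> real^'n^'n"
  assumes "continuous_on S f"
  shows "continuous_on S (\<lambda>x. det (f x))"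
  unfolding det_def using assms by (intro continuous_intros)

lemma continuous_on_matrix_mult [continuous_intros]:
  fixes f :: "'a::topological_space \<Rightarrow> real^'n^'m" and g :: "'a \<Rightarrow> real^'p^'n"
  assumes "continuous_on S f" "continuous_on S g"
  shows "continuous_on S (\<lambda>x. f x ** g x)"
  unfolding matrix_matrix_mult_def by (rule continuous_on_vec_lambda)+ (intro continuous_intros assms)

lemma continuous_on_matrix_vector_mult [continuous_intros]:
  fixes f :: "'a::topological_space \<Rightarrow> real^'n^'m" and g :: "'a \<Rightarrow> real^'n"
  assumes "continuous_on S f" "continuous_on S g"
  shows "continuous_on S (\<lambda>x. f x *v g x)"
  unfolding matrix_vector_mult_def by (rule continuous_on_vec_lambda) (intro continuous_intros assms)

lemma continuous_on_sigma [continuous_intros]: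
  fixes f :: "'a::topological_space \<Rightarrow> real^'n^'n"
  assumes "continuous_on S f"
  shows "continuous_on S (\<lambda>x. sigma j (f x))"
proof -
  have *: "continuous_on S (\<lambda>x. \<chi> i. if i \<in> I then f x $ i else mat 1 $ i)" for I
  proof (rule continuous_on_vec_lambda)
    fix i
    show "continuous_on S (\<lambda>x. if i \<in> I then f x $ i else mat 1 $ i)"
      using assms by (cases "i \<in> I") (auto intro!: continuous_intros)
  qed
  show ?thesis unfolding sigma_def by (intro continuous_on_sum continuous_on_det *)
qed

lemma continuous_on_trace [continuous_intros]:
  fixes f :: "'a::topological_space \<Rightarrow> real^'n^'n"
  assumes "continuous_on S f"
  shows "continuous_on S (\<lambda>x. trace (f x))"
  unfolding trace_def using assms by (intro continuous_intros)

lemma sigma_0: "sigma 0 (B::real^'n^'n) = 1"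
proof -
  have "{I::'n set. card I = 0} = {{}}" by auto
  then show ?thesis by (simp add: sigma_def)
qed

lemma sigma_gt_card:
  fixes B :: "real^'n^'n"
  assumes "j > CARD('n)" shows "sigma j B = 0"
proof -
  have "{I. card I = j} = ({} :: 'n set set)"
    using assms card_mono[of "UNIV :: 'n set"]
        by (metis (mono_tags, lifting) Collect_empty_eq finite leD subset_UNIV)
  then show ?thesis unfolding sigma_def by simp
qed

lemma sigma_scaleR:
  fixes B :: "real^'n^'n"
  shows "sigma j (s *\<^sub>R B) = s ^ j * sigma j B"
proof (cases "j \<le> CARD('n)")
  case True
  have "(\<Sum>i\<le>CARD('n). (sigma i (s *\<^sub>R B) - s ^ i * sigma i B) * t ^ i) = 0" for t
  proof -
    have "(\<Sum>i\<le>CARD('n). sigma i (s *\<^sub>R B) * t ^ i) = (\<Sum>i\<le>CARD('n). sigma i B * (t * s) ^ i)"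
      unfolding det_shift_sigma[symmetric] by simp
    also have "\<dots> = (\<Sum>i\<le>CARD('n). s ^ i * sigma i B * t ^ i)"
      by (simp add: power_mult_distrib mult_ac)
    finally show ?thesis by (simp only: left_diff_distrib sum_subtractf)
  qed
  then show ?thesis
    using polyfun_zero_if_zero_on_infinite[of "UNIV :: real set" "\<lambda>i. sigma i (s *\<^sub>R B) - s ^ i
        * sigma i B" "CARD('n)" j] True
    by (simp add: infinite_UNIV_char_0)
qed (simp add: sigma_gt_card)

text \<open>The recursion gives the sum of \<open>(-1)\<^sup>m S\<^sub>i(A) A\<^sup>m\<close> over \<open>i + m = j - 1\<close>, the gradient of \<open>S\<^sub>j\<close> with
  respect to the matrix. Starting at \<open>0\<close> instead of at the identity for \<open>j = 1\<close> keeps the recursion uniform.\<close>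

primrec newton_tensor :: "nat \<Rightarrow> real^'n^'n \<Rightarrow> real^'n^'n" where
  "newton_tensor 0 A = 0"
| "newton_tensor (Suc j) A = sigma j A *\<^sub>R mat 1 - A ** newton_tensor j A"

lemma continuous_on_newton_tensor [continuous_intros]:
  fixes f :: "'a::topological_space \<Rightarrow> real^'n^'n"
  assumes "continuous_on S f"
  shows "continuous_on S (\<lambda>x. newton_tensor j (f x))"
  by (induction j) (auto intro!: continuous_intros assms)

lemma newton_tensor_commute: "newton_tensor j A ** A = A ** newton_tensor j A"
proof (induction j)
  case (Suc j)
  have "(A ** newton_tensor j A) ** A = A ** (A ** newton_tensor j A)"
    using Suc by (metis matrix_mul_assoc)
  then show ?case
    by (simp add: matrix_mult_diff_left matrix_mult_diff_right matrix_mult_scaleR_left matrix_mult_scaleR_right)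
qed (simp add: matrix_matrix_mult_def zero_vec_def)

lemma transpose_newton_tensor:
  fixes A :: "real^'n^'n"
  assumes "transpose A = A"
  shows "transpose (newton_tensor j A) = newton_tensor j A"
proof (induction j)
  case (Suc j)
  have "transpose (A ** newton_tensor j A) = A ** newton_tensor j A"
    using Suc assms newton_tensor_commute[of j A] by (simp add: matrix_transpose_mul)
  moreover have "transpose (X - Y) = transpose X - transpose Y" for X Y :: "real^'n^'n"
    by (simp add: transpose_def vec_eq_iff)
  moreover have "transpose (c *\<^sub>R mat 1 :: real^'n^'n) = c *\<^sub>R mat 1" for c
    by (simp add: transpose_def mat_def vec_eq_iff)
  ultimately show ?case by simp
qed (simp add: transpose_def zero_vec_def)

text \<open>Subsets of size \<open>j + 1\<close> are split by whether they contain \<open>i\<close>.\<close>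

lemma esym_Suc:
  assumes "finite J" "i \<in> J"
  shows "esym J (Suc j) l = esym (J - {i}) (Suc j) l + l i * esym (J - {i}) j l"
proof -
  have fin: "finite {I. I \<subseteq> J \<and> card I = m \<and> P I}" for m P using assms(1)
      by (auto intro: finite_subset[of _ "Pow J"])
  have "{I. I \<subseteq> J \<and> card I = Suc j} = {I. I \<subseteq> J - {i} \<and> card I
      = Suc j} \<union> insert i ` {I. I \<subseteq> J - {i} \<and> card I = j}"
  proof (intro set_eqI iffI)
    fix I assume I: "I \<in> {I. I \<subseteq> J \<and> card I = Suc j}"
    then have fI: "finite I" using assms(1) finite_subset by blast
    show "I \<in> {I. I \<subseteq> J - {i} \<and> card I = Suc j} \<union> insert i ` {I. I \<subseteq> J - {i} \<and> card I = j}"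
    proof (cases "i \<in> I")
      case True
      then have "I = insert i (I - {i})" "I - {i} \<subseteq> J - {i}" "card (I - {i}) = j" using I fI by auto
      then show ?thesis by blast
    qed (use I in auto)
  next
    fix I assume "I \<in> {I. I \<subseteq> J - {i} \<and> card I = Suc j} \<union> insert i ` {I. I \<subseteq> J - {i} \<and> card I = j}"
    then show "I \<in> {I. I \<subseteq> J \<and> card I = Suc j}"
    proof
      assume "I \<in> insert i ` {I. I \<subseteq> J - {i} \<and> card I = j}"
      then obtain K where K: "I = insert i K" "K \<subseteq> J - {i}" "card K = j" by auto
      then have "finite K" "i \<notin> K" using assms(1) finite_subset by blast+
      then show ?thesis using K assms(2) by auto
    qed auto
  qed
  then have "esym J (Suc j) l = esym (J - {i}) (Suc j) l + (\<Sum>I\<in>insert i ` {I. I \<subseteq> J - {i} \<and> card I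
      = j}. \<Prod>i\<in>I. l i)"
    unfolding esym_def using assms(1) by (auto intro!: sum.union_disjoint finite_imageI intro:
        finite_subset[of _ "Pow J"])
  also have "(\<Sum>I\<in>insert i ` {I. I \<subseteq> J - {i} \<and> card I = j}. \<Prod>i\<in>I. l i)
     = (\<Sum>I | I \<subseteq> J - {i} \<and> card I = j. \<Prod>i\<in>insert i I. l i)"
    by (subst sum.reindex) (auto simp: inj_on_def)
  also have "\<dots> = (\<Sum>I | I \<subseteq> J - {i} \<and> card I = j. l i * (\<Prod>i\<in>I. l i))"
  proof (rule sum.cong[OF refl])
    fix I assume "I \<in> {I. I \<subseteq> J - {i} \<and> card I = j}"
    then have "finite I" "i \<notin> I" using assms(1) finite_subset by blast+
    then show "prod l (insert i I) = l i * prod l I" by simp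
  qed
  finally show ?thesis unfolding esym_def by (simp add: sum_distrib_left)
qed

lemma sum_esym_delete:
  assumes "finite J"
  shows "(\<Sum>i\<in>J. esym (J - {i}) j l) = (real (card J) - real j) * esym J j l"
proof -
  have finP: "finite {I. I \<subseteq> J \<and> card I = j}" using assms by (auto intro: finite_subset[of _ "Pow J"])
  have "(\<Sum>i\<in>J. esym (J - {i}) j l) = (\<Sum>i\<in>J. \<Sum>I | I \<in> {I. I \<subseteq> J \<and> card I = j} \<and> i \<notin> I. prod l I)"
    unfolding esym_def by (intro sum.cong) auto
  also have "\<dots> = (\<Sum>I | I \<subseteq> J \<and> card I = j. \<Sum>i | i \<in> J \<and> i \<notin> I. prod l I)"
    by (rule sum.swap_restrict[OF assms finP])
  also have "\<dots> = (\<Sum>I | I \<subseteq> J \<and> card I = j. (real (card J) - real j) * prod l I)"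
  proof (rule sum.cong[OF refl])
    fix I assume I: "I \<in> {I. I \<subseteq> J \<and> card I = j}"
    then have "card (J - I) = card J - j" "j \<le> card J" 
      using I card_Diff_subset[of I J] card_mono[OF assms, of I] finite_subset[OF _ assms, of I] by auto
    moreover have "{i. i \<in> J \<and> i \<notin> I} = J - I" by auto
    ultimately show "(\<Sum>i | i \<in> J \<and> i \<notin> I. prod l I) = (real (card J) - real j) * prod l I"
      by simp
  qed
  finally show ?thesis unfolding esym_def by (simp add: sum_distrib_left)
qed

lemma prod_shift_esym:
  assumes "finite J"
  shows "(\<Prod>i\<in>J. t + l i) = (\<Sum>j\<le>card J. esym J j l * t ^ (card J - j))"
proof -
  have "(\<Prod>i\<in>J. t + l i) = (\<Prod>i\<in>J. l i + t)" by (simp add: add.commute)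
  also have "\<dots> = (\<Sum>X\<in>Pow J. (\<Prod>x\<in>X. l x) * (\<Prod>x\<in>J - X. t))" by (rule prod_add[OF assms])
  also have "\<dots> = (\<Sum>X\<in>Pow J. prod l X * t ^ (card J - card X))"
    using assms by (intro sum.cong) (auto simp: card_Diff_subset finite_subset)
  also have "\<dots> = (\<Sum>j\<le>card J. \<Sum>X | X \<in> Pow J \<and> card X = j. prod l X * t ^ (card J - card X))"
    using assms by (intro sum.group[symmetric]) (auto intro: card_mono)
  finally show ?thesis unfolding esym_def by (simp add: sum_distrib_right)
qed

context eigenbasis begin

lemma sigma_eq: "sigma j A = esym UNIV j l"
proof (cases "j \<le> CARD('n)")
  case True
  define c where "c i = sigma (CARD('n) - i) A - esym UNIV (CARD('n) - i) l" for i
  have "(\<Sum>i\<le>CARD('n). c i * t ^ i) = 0" if "t \<in> {0<..}" for t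
  proof -
    have "(\<Sum>j\<le>CARD('n). sigma j A * t ^ (CARD('n) - j)) = (\<Sum>j\<le>CARD('n). esym UNIV j l * t ^ (CARD('n) - j))"
      using det_shift_sigma'[of t A] det_shift[of t] prod_shift_esym[of UNIV t l] that by simp
    then have "(\<Sum>j\<le>CARD('n). (sigma j A - esym UNIV j l) * t ^ (CARD('n) - j)) = 0"
      by (simp add: left_diff_distrib sum_subtractf)
    then show ?thesis unfolding c_def sum_reverse_power .
  qed
  then have "c (CARD('n) - j) = 0"
    by (intro polyfun_zero_if_zero_on_infinite[of "{0<..}" c "CARD('n)"]) (auto simp: infinite_Ioi)
  then show ?thesis unfolding c_def using True by simp
next
  case False
  then show ?thesis by (simp add: sigma_gt_card esym_gt_card)
qed

lemma newton_tensor_eigen: "newton_tensor (Suc j) A *v e i = esym (UNIV - {i}) j l *\<^sub>R e i"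
proof (induction j)
  case 0
  then show ?case by (simp add: sigma_eq)
next
  case (Suc j)
  have "newton_tensor (Suc (Suc j)) A *v e i = sigma (Suc j) A *\<^sub>R e i - A *v (newton_tensor (Suc j) A *v e i)"
    unfolding newton_tensor.simps(2)[of "Suc j"]
    by (simp add: matrix_vector_mult_diff_rdistrib scaleR_matrix_vector_assoc[symmetric]
        matrix_vector_mul_assoc del: newton_tensor.simps)
  also have "\<dots> = (esym UNIV (Suc j) l - l i * esym (UNIV - {i}) j l) *\<^sub>R e i"
    unfolding Suc by (simp add: matrix_vector_mult_scaleR eigen sigma_eq scaleR_diff_left mult.commute)
  also have "\<dots> = esym (UNIV - {i}) (Suc j) l *\<^sub>R e i" by (subst esym_Suc[of UNIV i]) auto
  finally show ?case .
qed

text \<open>This is the Cayley-Hamilton theorem.\<close>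

lemma newton_tensor_top: "newton_tensor (Suc CARD('n)) A = 0"
  by (rule matrix_ext) (simp only: newton_tensor_eigen, simp add: esym_gt_card)

lemma trace_newton_tensor: "trace (newton_tensor (Suc j) A) = (real CARD('n) - real j) * sigma j A"
  unfolding trace_eq newton_tensor_eigen sigma_eq using sum_esym_delete[of UNIV j l] by (simp add: orthonormal)

text \<open>The Newton tensors are the coefficients of the adjugate of \<open>tI + A\<close>.\<close>

lemma resolvent:
  "(t *\<^sub>R mat 1 + A) ** (\<Sum>j<CARD('n). t ^ (CARD('n) - Suc j) *\<^sub>R newton_tensor (Suc j) A)
      = det (t *\<^sub>R mat 1 + A) *\<^sub>R mat 1"
proof (rule matrix_ext)
  fix i :: 'n
  have c: "card (UNIV - {i}) = CARD('n) - 1" by (simp add: card_Diff_singleton)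
  have N: "CARD('n) = Suc (CARD('n) - 1)" by (simp add: Suc_leI)
  have lin: "(\<Sum>j\<in>S. M j) *v v = (\<Sum>j\<in>S. M j *v v)" for S and M :: "nat \<Rightarrow> real^'n^'n" and v
    by (induction S rule: infinite_finite_induct) (auto simp: matrix_vector_mult_add_rdistrib)
  have "(\<Sum>j<CARD('n). t ^ (CARD('n) - Suc j) *\<^sub>R newton_tensor (Suc j) A) *v e i
      = (\<Sum>j<CARD('n). t ^ (CARD('n) - Suc j) * esym (UNIV - {i}) j l) *\<^sub>R e i"
    by (simp only: lin scaleR_matrix_vector_assoc[symmetric] newton_tensor_eigen scaleR_sum_left scaleR_scaleR)
  also have "(\<Sum>j<CARD('n). t ^ (CARD('n) - Suc j) * esym (UNIV - {i}) j l) = (\<Prod>m\<in>UNIV - {i}. t + l m)"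
  proof -
    obtain m where m: "CARD('n) = Suc m" using N by blast
    show ?thesis unfolding prod_shift_esym[OF finite] c m
      by (simp add: lessThan_Suc_atMost mult.commute)
  qed
  finally have "((t *\<^sub>R mat 1 + A) ** (\<Sum>j<CARD('n). t ^ (CARD('n) - Suc j) *\<^sub>R newton_tensor (Suc j) A)) *v e i
     = ((t + l i) * (\<Prod>m\<in>UNIV - {i}. t + l m)) *\<^sub>R e i"
    by (simp add: matrix_vector_mul_assoc[symmetric] matrix_vector_mult_add_rdistrib
        matrix_vector_mult_scaleR eigen scaleR_matrix_vector_assoc[symmetric] scaleR_add_left
        scaleR_add_right algebra_simps del: newton_tensor.simps)
  also have "(t + l i) * (\<Prod>m\<in>UNIV - {i}. t + l m) = det (t *\<^sub>R mat 1 + A)"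
    unfolding det_shift by (simp add: prod.remove[of UNIV i])
  finally show "((t *\<^sub>R mat 1 + A) ** (\<Sum>j<CARD('n). t ^ (CARD('n) - Suc j) *\<^sub>R newton_tensor (Suc j) A)) *v e i
      = (det (t *\<^sub>R mat 1 + A) *\<^sub>R mat 1) *v e i"
    by (simp add: scaleR_matrix_vector_assoc[symmetric])
qed

end

lemma eigenbasis_exists:
  fixes A :: "real^'n^'n"
  assumes "transpose A = A"
  obtains e l where "eigenbasis A e l"
  using symmetric_matrix_eigenbasis[OF assms] unfolding eigenbasis_def by metis

lemma S_elem_symmetric:
  fixes A :: "real^'n^'n"
  assumes "transpose A = A" shows "S_elem j A = sigma j A"
  using eigenbasis_exists[OF assms] eigenbasis.S_elem_eq eigenbasis.sigma_eq by metis

lemma trace_newton_tensor_mult: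
  fixes A :: "real^'n^'n"
  assumes "transpose A = A" 
  shows "trace (newton_tensor j A ** A) = real j * sigma j A"
proof -
  obtain e l where "eigenbasis A e l" using eigenbasis_exists[OF assms] .
  then interpret eigenbasis A e l .
  have "trace (newton_tensor (Suc j) A) = real CARD('n) * sigma j A - trace (A ** newton_tensor j A)"
    by (simp add: trace_sub) (simp add: trace_def mat_def sum_distrib_left)
  then show ?thesis using trace_newton_tensor[of j] unfolding newton_tensor_commute by (simp add: algebra_simps)
qed

lemma symmetric_entries:
  assumes "transpose M = M" shows "M $ j $ i = M $ i $ j"
proof -
  have "transpose M $ i $ j = M $ j $ i" by (simp add: transpose_def)
  then show ?thesis unfolding assms by simp
qed

text \<open>Jacobi's formula for the derivative of the determinant at \<open>M\<close> in direction \<open>B\<close>, where \<open>W\<close> plays the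
  role of the adjugate of \<open>M\<close>; each summand on the left is, by Cramer's rule, a diagonal entry of \<open>B ** W\<close>.\<close>

lemma linear_det_coefficient:
  fixes M W B :: "real^'n^'n"
  assumes sM: "transpose M = M" and MW: "M ** W = d *\<^sub>R mat 1" and d: "d = det M" "d \<noteq> 0"
      and sW: "transpose W = W"
  shows "(\<Sum>k\<in>UNIV. det (\<chi> i. if i = k then B $ i else M $ i)) = trace (W ** B)"
proof -
  have "det (\<chi> i. if i = k then B $ i else M $ i) = (W *v (B $ k)) $ k" for k
  proof -
    define x where "x = inverse d *\<^sub>R (W *v (B $ k))"
    have "M *v (W *v (B $ k)) = d *\<^sub>R (B $ k)"
      by (simp add: matrix_vector_mul_assoc MW scaleR_matrix_vector_assoc[symmetric])
    then have Mx: "M *v x = B $ k" unfolding x_def using d(2) by (simp add: matrix_vector_mult_scaleR)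
    have sM': "M $ j $ i = M $ i $ j" for i j by (rule symmetric_entries[OF sM])
    define R where "R = (\<chi> i. if i = k then B $ i else M $ i)"
    have "transpose R = (\<chi> i j. if j = k then (M *v x) $ i else M $ i $ j)"
      unfolding Mx R_def transpose_def vec_eq_iff using sM' by simp
    then have "det (transpose R) = x $ k * det M" by (simp only: cramer_lemma)
    then have "det (\<chi> i. if i = k then B $ i else M $ i) = x $ k * det M"
      unfolding R_def[symmetric] by (simp only: det_transpose)
    then show ?thesis unfolding x_def using d by simp
  qed
  then have "(\<Sum>k\<in>UNIV. det (\<chi> i. if i = k then B $ i else M $ i)) = (\<Sum>k\<in>UNIV. \<Sum>j\<in>UNIV. W $ k $ j * B $ k $ j)"
    by (simp add: matrix_vector_mult_def)
  also have "\<dots> = (\<Sum>j\<in>UNIV. \<Sum>k\<in>UNIV. W $ j $ k * B $ k $ j)"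
    by (subst sum.swap) (intro sum.cong refl, subst symmetric_entries[OF sW], rule refl)
  finally show ?thesis by (simp add: trace_def matrix_matrix_mult_def)
qed

section \<open>Elementary symmetric functions as null Lagrangians\<close>

text \<open>The change of variables theorem for \<open>real^'n\<close> is stated for well-ordered index types. This copy of a
  finite type carries such an order, and coordinates can be transported to it.\<close>

typedef (overloaded) ('a::finite) position = "{..<CARD('a)}"
  morphisms rank_of Position
  by (rule exI[of _ 0]) simp

instantiation position :: (finite) wellorder
begin
definition "x \<le> y \<longleftrightarrow> rank_of x \<le> rank_of y"
definition "x < y \<longleftrightarrow> rank_of x < rank_of y"
instance
proof
  fix P :: "'a position \<Rightarrow> bool" and a :: "'a position"
  assume *: "\<And>x. (\<And>y. y < x \<Longrightarrow> P y) \<Longrightarrow> P x"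
  show "P a"
    by (induction "rank_of a" arbitrary: a rule: less_induct) (use * in \<open>auto simp: less_position_def\<close>)
qed (auto simp: less_eq_position_def less_position_def rank_of_inject)
end

instance position :: (finite) finite
proof
  have "finite (range (rank_of :: 'a position \<Rightarrow> nat))"
    by (rule finite_subset[of _ "{..<CARD('a)}"]) (use rank_of in auto)
  then show "finite (UNIV :: 'a position set)"
    by (rule finite_imageD) (simp add: inj_on_def rank_of_inject)
qed

lemma position_bij: obtains b :: "'a::finite position \<Rightarrow> 'a" where "bij b"
proof -
  have "bij_betw rank_of (UNIV :: 'a position set) {..<CARD('a)}"
    by (rule bij_betw_byWitness[where f' = Position])
        (use rank_of in \<open>auto simp: rank_of_inverse Position_inverse\<close>)
  then have "card (UNIV :: 'a position set) = card {..<CARD('a)}" by (rule bij_betw_same_card)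
  then have "card (UNIV :: 'a position set) = card (UNIV :: 'a set)" by simp
  then show ?thesis using that finite_same_card_bij[of "UNIV :: 'a position set" "UNIV :: 'a set"] by auto
qed

lemma det_reindex:
  fixes M :: "real^'n^'n" and b :: "'m::finite \<Rightarrow> 'n"
  assumes b: "bij b"
  shows "det (\<chi> i j. M $ b i $ b j) = det M"
proof -
  have bb: "bij_betw b UNIV UNIV" "bij_betw (inv b) UNIV UNIV" using b bij_betw_inv_into by auto
  have ib: "inv b (b x) = x" "b (inv b y) = y" for x y using b
      by (simp_all add: bij_is_inj bij_is_surj surj_f_inv_f)
  have "det (\<chi> i j. M $ b i $ b j) = (\<Sum>p | p permutes UNIV. of_int (sign p) * (\<Prod>i\<in>UNIV. M $ b i $ b (p i)))"
    unfolding det_def by simp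
  also have "\<dots> = (\<Sum>p | p permutes UNIV. of_int (sign p) * (\<Prod>i\<in>UNIV. M $ i $ p i))"
  proof (rule sum.reindex_bij_witness[where i = "map_permutation UNIV (inv b)"
      and j = "map_permutation UNIV b"])
    fix p :: "'m \<Rightarrow> 'm" assume p: "p \<in> {p. p permutes UNIV}"
    show "map_permutation UNIV (inv b) (map_permutation UNIV b p) = p"
      by (rule map_permutation_compose_inv[OF bb(1)]) (use p ib in auto)
    show "map_permutation UNIV b p \<in> {p. p permutes UNIV}"
      using map_permutation_permutes[OF bb(1)] p by auto
    have "sign (map_permutation UNIV b p) = sign p"
      by (rule sign_map_permutation) (use bb p bij_is_inj[OF b] in auto)
    moreover have "(\<Prod>i\<in>UNIV. M $ i $ map_permutation UNIV b p i)
        = (\<Prod>i\<in>UNIV. M $ b i $ map_permutation UNIV b p (b i))"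
      by (rule prod.reindex_bij_betw[OF bb(1), symmetric])
    moreover have "map_permutation UNIV b p (b i) = b (p i)" for i
      by (rule map_permutation_apply) (use bij_is_inj[OF b] in auto)
    ultimately show "real_of_int (sign (map_permutation UNIV b p))
        * (\<Prod>i\<in>UNIV. M $ i $ map_permutation UNIV b p i) =
         real_of_int (sign p) * (\<Prod>i\<in>UNIV. M $ b i $ b (p i))" by simp
  next
    fix p :: "'n \<Rightarrow> 'n" assume p: "p \<in> {p. p permutes UNIV}"
    show "map_permutation UNIV b (map_permutation UNIV (inv b) p) = p"
      by (rule map_permutation_compose_inv[OF bb(2)]) (use p ib in auto)
    show "map_permutation UNIV (inv b) p \<in> {p. p permutes UNIV}"
      using map_permutation_permutes[OF bb(2)] p by auto
  qed
  finally show ?thesis unfolding det_def by simp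
qed

text \<open>Along the segment from \<open>tI\<close> to \<open>tI + M\<close> the matrix stays injective, so its determinant keeps its
  sign.\<close>

lemma det_shift_pos:
  fixes M :: "real^'n^'n"
  assumes M: "\<And>v. norm (M *v v) \<le> L * norm v" and L: "0 \<le> L" "L < t"
  shows "det (t *\<^sub>R mat 1 + M) > 0"
proof (rule ccontr)
  assume neg: "\<not> det (t *\<^sub>R mat 1 + M) > 0"
  define f where "f s = det (t *\<^sub>R mat 1 + s *\<^sub>R M)" for s
  have "continuous_on {0..1} f" unfolding f_def by (intro continuous_intros)
  moreover have "f 0 = t ^ CARD('n)" unfolding f_def by (simp add: det_scaleR)
  ultimately obtain s where s: "0 \<le> s" "s \<le> 1" "f s = 0"
    using IVT2'[of f 1 0 0] neg L f_def by auto
  then obtain v where v: "v \<noteq> 0" "(t *\<^sub>R mat 1 + s *\<^sub>R M) *v v = 0"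
    unfolding f_def by (metis det_identical_columns matrix_left_invertible_ker invertible_left_inverse
        invertible_det_nz)
  then have "t *\<^sub>R v = - (s *\<^sub>R (M *v v))"
    by (simp add: matrix_vector_mult_add_rdistrib scaleR_matrix_vector_assoc[symmetric] add_eq_0_iff2)
  then have "norm (t *\<^sub>R v) = norm (s *\<^sub>R (M *v v))" by simp
  then have "t * norm v = s * norm (M *v v)" using s L by simp
  also have "\<dots> \<le> 1 * (L * norm v)" using s M[of v] by (intro mult_mono) auto
  finally show False using L v(1) by simp
qed

text \<open>For \<open>t\<close> above the Lipschitz constant the map is injective, and it is surjective by Banach's fixed
  point theorem. Outside \<open>S\<close> it is multiplication by \<open>t\<close>, so \<open>S\<close> must be mapped onto \<open>t S\<close> as well.\<close>

lemma shifted_image_eq: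
  fixes X :: "'a::euclidean_space \<Rightarrow> 'a"
  assumes lip: "\<And>x y. norm (X x - X y) \<le> L * norm (x - y)" and L: "0 \<le> L" "L < t"
    and supp: "\<And>x. x \<notin> S \<Longrightarrow> X x = 0"
  shows "inj (\<lambda>x. t *\<^sub>R x + X x)" and "(\<lambda>x. t *\<^sub>R x + X x) ` S = (\<lambda>x. t *\<^sub>R x) ` S"
proof -
  define F where "F x = t *\<^sub>R x + X x" for x
  have t: "t > 0" using L by simp
  show inj: "inj (\<lambda>x. t *\<^sub>R x + X x)"
  proof (rule injI)
    fix x y assume "t *\<^sub>R x + X x = t *\<^sub>R y + X y"
    then have "t *\<^sub>R (x - y) = X y - X x" by (simp add: algebra_simps)
    then have "t * norm (x - y) \<le> L * norm (x - y)"
      using lip[of x y] t by (metis norm_minus_commute norm_scaleR abs_of_pos)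
    then show "x = y" using L by (metis mult_le_cancel_right norm_ge_zero not_le zero_less_norm_iff
        eq_iff_diff_eq_0)
  qed
  have surj: "\<exists>x. F x = y" for y
  proof -
    have "\<exists>!x. (inverse t *\<^sub>R (y - X x)) = x"
    proof (rule banach_fix_type[where c = "L / t"])
      show "0 \<le> L / t" "L / t < 1" using L by simp_all
      show "\<forall>x z. dist (inverse t *\<^sub>R (y - X x)) (inverse t *\<^sub>R (y - X z)) \<le> L / t * dist x z"
      proof (intro allI)
        fix x z
        have "dist (inverse t *\<^sub>R (y - X x)) (inverse t *\<^sub>R (y - X z)) = inverse t * norm (X x - X z)"
          using t unfolding dist_norm scaleR_diff_right[symmetric] by (simp add: norm_minus_commute)
        also have "\<dots> \<le> inverse t * (L * norm (x - z))" using lip t by (intro mult_left_mono) auto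
        finally show "dist (inverse t *\<^sub>R (y - X x)) (inverse t *\<^sub>R (y - X z)) \<le> L / t * dist x z"
          by (simp add: dist_norm divide_inverse mult_ac)
      qed
    qed
    then obtain x where x: "inverse t *\<^sub>R (y - X x) = x" by blast
    have "t *\<^sub>R (inverse t *\<^sub>R (y - X x)) = y - X x" using t by simp
    then have "F x = y" unfolding F_def x by simp
    then show ?thesis by blast
  qed
  have "F ` S = (\<lambda>x. t *\<^sub>R x) ` S"
  proof (intro set_eqI iffI)
    fix y assume "y \<in> F ` S"
    then obtain x where x: "x \<in> S" "y = F x" by blast
    define z where "z = inverse t *\<^sub>R y"
    have y: "y = t *\<^sub>R z" unfolding z_def using t by simp
    have "z \<in> S"
    proof (rule ccontr)
      assume z: "z \<notin> S"
      then have "F z = F x" using y x supp unfolding F_def by simp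
      then show False using inj x z unfolding F_def by (auto dest: injD)
    qed
    then show "y \<in> (\<lambda>x. t *\<^sub>R x) ` S" using y by blast
  next
    fix y assume "y \<in> (\<lambda>x. t *\<^sub>R x) ` S"
    then obtain z where z: "z \<in> S" "y = t *\<^sub>R z" by blast
    obtain x where x: "F x = y" using surj by blast
    have "x \<in> S"
    proof (rule ccontr)
      assume n: "x \<notin> S"
      then have "t *\<^sub>R x = t *\<^sub>R z" using x z supp unfolding F_def by simp
      then show False using t n z by simp
    qed
    then show "y \<in> F ` S" using x by blast
  qed
  then show "(\<lambda>x. t *\<^sub>R x + X x) ` S = (\<lambda>x. t *\<^sub>R x) ` S" unfolding F_def .
qed

text \<open>The integral is the volume of the image of the box, which does not depend on the perturbation \<open>X\<close>.\<close>

lemma det_shift_has_integral_wellorder: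
  fixes X :: "real^'n::{finite,wellorder} \<Rightarrow> real^'n::_" and X' :: "real^'n::_ \<Rightarrow> real^'n::_^'n::_"
  assumes der: "\<And>x. (X has_derivative (*v) (X' x)) (at x)"
    and bound: "\<And>x v. norm (X' x *v v) \<le> L * norm v" and L: "0 \<le> L" "L < t"
    and supp: "\<And>x. x \<notin> cbox a b \<Longrightarrow> X x = 0"
  shows "((\<lambda>x. det (t *\<^sub>R mat 1 + X' x)) has_integral t ^ CARD('n) * measure lborel (cbox a b)) (cbox a b)"
proof -
  have lip: "norm (X x - X y) \<le> L * norm (x - y)" for x y
  proof (rule differentiable_bound[of UNIV X "\<lambda>x. (*v) (X' x)" L])
    show "onorm ((*v) (X' x)) \<le> L" for x using bound L by (intro onorm_le) auto
  qed (use der in auto)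
  have t: "t > 0" using L by simp
  define F where "F x = t *\<^sub>R x + X x" for x
  define S where "S = cbox a b"
  have mS: "S \<in> sets lebesgue" unfolding S_def by simp
  have dF: "(F has_derivative (*v) (t *\<^sub>R mat 1 + X' x)) (at x within S)" for x
  proof -
    have "(*v) (t *\<^sub>R mat 1 + X' x) = (\<lambda>h. t *\<^sub>R h + X' x *v h)"
      by (rule ext) (simp only: matrix_vector_mult_add_rdistrib scaleR_matrix_vector_assoc[symmetric]
          matrix_vector_mul_lid)
    then show ?thesis unfolding F_def
      by (simp only: has_derivative_add[OF bounded_linear_imp_has_derivative[OF
          bounded_linear_scaleR_right] has_derivative_at_withinI[OF der]])
  qed
  have dG: "((\<lambda>x. t *\<^sub>R x) has_derivative (*v) (t *\<^sub>R mat 1)) (at x within S)" for x :: "real^'n::_"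
  proof -
    have "(*v) (t *\<^sub>R mat 1 :: real^'n::_^'n::_) = (\<lambda>h. t *\<^sub>R h)"
      by (rule ext) (simp only: scaleR_matrix_vector_assoc[symmetric] matrix_vector_mul_lid)
    then show ?thesis by (simp only: bounded_linear_imp_has_derivative[OF bounded_linear_scaleR_right])
  qed
  have G: "((\<lambda>x::real^'n::_. \<bar>det (matrix ((*v)
      (t *\<^sub>R mat 1 :: real^'n::_^'n::_)))\<bar>) has_integral t ^ CARD('n) * measure lborel (cbox a b)) S"
  proof -
    have "\<bar>det (matrix ((*v) (t *\<^sub>R mat 1 :: real^'n::_^'n::_)))\<bar> = t ^ CARD('n)" using t
        by (simp add: det_scaleR)
    then show ?thesis using has_integral_const[of "t ^ CARD('n)" a b] unfolding S_def
      by (simp only: real_scaleR_def mult.commute)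
  qed
  have "(\<lambda>x. t *\<^sub>R x) ` S \<in> lmeasurable \<and> measure lebesgue ((\<lambda>x. t *\<^sub>R x) ` S)
      = t ^ CARD('n) * measure lborel (cbox a b)"
    using has_measure_differentiable_image[OF mS dG, of "t ^ CARD('n) * measure lborel (cbox a b)"] G t
        by (auto simp: inj_on_def)
  then have "F ` S \<in> lmeasurable \<and> measure lebesgue (F ` S) = t ^ CARD('n) * measure lborel (cbox a b)"
    using shifted_image_eq(2)[OF lip L supp] unfolding S_def F_def by simp
  then have "((\<lambda>x. \<bar>det (matrix ((*v) (t *\<^sub>R mat 1 + X' x)))\<bar>) has_integral t ^ CARD('n)
      * measure lborel (cbox a b)) S"
    using has_measure_differentiable_image[OF mS dF, of "t ^ CARD('n) * measure lborel (cbox a b)"]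
      inj_on_subset[OF shifted_image_eq(1)[OF lip L supp]] unfolding F_def by auto
  then show ?thesis unfolding S_def using det_shift_pos[OF bound L] by (simp add: abs_of_pos)
qed

lemma det_shift_has_integral:
  fixes X :: "real^'n \<Rightarrow> real^'n" and X' :: "real^'n \<Rightarrow> real^'n^'n"
  assumes der: "\<And>x. (X has_derivative (*v) (X' x)) (at x)"
    and bound: "\<And>x v. norm (X' x *v v) \<le> L * norm v" and L: "0 \<le> L" "L < t"
    and supp: "\<And>x. x \<notin> cbox a b \<Longrightarrow> X x = 0"
  shows "((\<lambda>x. det (t *\<^sub>R mat 1 + X' x)) has_integral t ^ CARD('n) * measure lborel (cbox a b)) (cbox a b)"
proof -
  obtain \<beta> :: "'n position \<Rightarrow> 'n" where \<beta>: "bij \<beta>" using position_bij .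
  have ib [simp]: "inv \<beta> (\<beta> x) = x" "\<beta> (inv \<beta> y) = y" for x y
    using \<beta> by (simp_all add: bij_is_inj bij_is_surj surj_f_inv_f)
  \<comment> \<open>Relabelling of coordinates, which preserves norms, boxes, volumes and determinants.\<close>
  define \<rho> where "\<rho> x = (\<chi> i. x $ \<beta> i)" for x :: "real^'n"
  define \<rho>' where "\<rho>' y = (\<chi> j. y $ inv \<beta> j)" for y :: "real^'n position"
  have [simp]: "\<rho>' (\<rho> x) = x" "\<rho> (\<rho>' y) = y" for x y by (simp_all add: \<rho>_def \<rho>'_def vec_eq_iff)
  have lin: "linear \<rho>" "linear \<rho>'" unfolding \<rho>_def \<rho>'_def by (auto intro!: linearI simp: vec_eq_iff)
  have nrm: "norm (\<rho> x) = norm x" for x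
    unfolding norm_vec_def L2_set_def \<rho>_def using sum.reindex_bij_betw[OF \<beta>, of "\<lambda>i. (norm (x $ i))\<^sup>2"] by simp
  have nrm': "norm (\<rho>' y) = norm y" for y using nrm[of "\<rho>' y"] by simp
  define Y where "Y y = \<rho> (X (\<rho>' y))" for y
  define Y' where "Y' y = (\<chi> i j. X' (\<rho>' y) $ \<beta> i $ \<beta> j)" for y
  have Y'v: "Y' y *v v = \<rho> (X' (\<rho>' y) *v \<rho>' v)" for y v
    unfolding Y'_def \<rho>_def \<rho>'_def matrix_vector_mult_def vec_eq_iff
    using sum.reindex_bij_betw[OF \<beta>, of "\<lambda>j. X' (\<chi> j. y $ inv \<beta> j) $ \<beta> i $ j * v $ inv \<beta> j" for i] by simp
  have bl: "bounded_linear \<rho>" "bounded_linear \<rho>'" using lin by (auto simp: linear_conv_bounded_linear)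
  have derY: "(Y has_derivative (*v) (Y' y)) (at y)" for y
  proof -
    have "((\<lambda>y. X (\<rho>' y)) has_derivative (\<lambda>v. X' (\<rho>' y) *v \<rho>' v)) (at y)"
      by (rule has_derivative_compose[OF bounded_linear_imp_has_derivative[OF bl(2)] der])
    then have "((\<lambda>y. \<rho> (X (\<rho>' y))) has_derivative (\<lambda>v. \<rho> (X' (\<rho>' y) *v \<rho>' v))) (at y)"
      by (rule bounded_linear.has_derivative[OF bl(1)])
    then show ?thesis unfolding Y_def Y'v[symmetric] by simp
  qed
  have cb: "\<rho> ` cbox a' b' = cbox (\<rho> a') (\<rho> b')" for a' b'
  proof (intro set_eqI iffI)
    fix y assume "y \<in> \<rho> ` cbox a' b'"
    then show "y \<in> cbox (\<rho> a') (\<rho> b')" by (auto simp: \<rho>_def mem_box_cart)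
  next
    fix y assume y: "y \<in> cbox (\<rho> a') (\<rho> b')"
    have "\<rho>' y \<in> cbox a' b'" unfolding mem_box_cart
    proof
      fix j
      show "a' $ j \<le> \<rho>' y $ j \<and> \<rho>' y $ j \<le> b' $ j" 
        using y[unfolded mem_box_cart, rule_format, of "inv \<beta> j"] by (simp add: \<rho>_def \<rho>'_def)
    qed
    then have "\<rho> (\<rho>' y) \<in> \<rho> ` cbox a' b'" by (rule imageI)
    then show "y \<in> \<rho> ` cbox a' b'" by simp
  qed
  have ct: "measure lborel (\<rho> ` cbox a' b') = measure lborel (cbox a' b')" for a' b'
  proof (cases "cbox a' b' = {}")
    case False
    then have "cbox (\<rho> a') (\<rho> b') \<noteq> {}" using cb by (metis image_is_empty)
    then show ?thesis unfolding cb using False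
      by (simp add: content_cbox_cart) (simp add: \<rho>_def prod.reindex_bij_betw[OF \<beta>, of "\<lambda>i. b' $ i - a' $ i"])
  qed simp
  have cb': "\<rho>' ` cbox u v = cbox (\<rho>' u) (\<rho>' v)" for u v
  proof -
    have "\<rho> ` cbox (\<rho>' u) (\<rho>' v) = cbox u v" unfolding cb by simp
    then have "\<rho>' ` cbox u v = \<rho>' ` \<rho> ` cbox (\<rho>' u) (\<rho>' v)" by simp
    then show ?thesis unfolding image_image by simp
  qed
  have cardeq: "CARD('n position) = CARD('n)" using \<beta> by (metis bij_betw_same_card)
  have "((\<lambda>y. det (t *\<^sub>R mat 1 + Y' y)) has_integral t ^ CARD('n position)
      * measure lborel (cbox (\<rho> a) (\<rho> b))) (cbox (\<rho> a) (\<rho> b))"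
  proof (rule det_shift_has_integral_wellorder[OF derY _ L])
    show "norm (Y' x *v v) \<le> L * norm v" for x v unfolding Y'v nrm using bound[of "\<rho>' x" "\<rho>' v"]
        by (simp add: nrm')
    fix y assume "y \<notin> cbox (\<rho> a) (\<rho> b)"
    then have "\<rho>' y \<notin> cbox a b" unfolding cb[symmetric] by (metis \<open>\<And>y. \<rho> (\<rho>' y) = y\<close> imageI)
    then show "Y y = 0" unfolding Y_def using supp lin(1) by (simp add: linear_0)
  qed
  then have "((\<lambda>x. det (t *\<^sub>R mat 1 + Y' (\<rho> x))) has_integral (1 / 1) *\<^sub>R (t ^ CARD('n position)
      * measure lborel (cbox (\<rho> a) (\<rho> b)))) (\<rho>' ` cbox (\<rho> a) (\<rho> b))"
    by (intro has_integral_twiddle) (use cb cb' ct in \<open>auto intro!: linear_continuous_at bl\<close>)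
  moreover have "\<rho>' ` cbox (\<rho> a) (\<rho> b) = cbox a b" unfolding cb' by simp
  moreover have "det (t *\<^sub>R mat 1 + Y' (\<rho> x)) = det (t *\<^sub>R mat 1 + X' x)" for x
  proof -
    have "t *\<^sub>R mat 1 + Y' (\<rho> x) = (\<chi> i j. (t *\<^sub>R mat 1 + X' x) $ \<beta> i $ \<beta> j)"
      unfolding Y'_def using bij_is_inj[OF \<beta>] by (auto simp: vec_eq_iff mat_def dest: injD)
    then show ?thesis by (simp only: det_reindex[OF \<beta>])
  qed
  moreover have "measure lborel (cbox (\<rho> a) (\<rho> b)) = measure lborel (cbox a b)" using ct[of a b] cb by simp
  ultimately show ?thesis using cardeq by simp
qed

lemma continuous_matrix_compact_support_bound:
  fixes X' :: "'a::euclidean_space \<Rightarrow> real^'n^'n"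
  assumes cont: "continuous_on UNIV X'" and supp: "\<And>x. x \<notin> cbox a b \<Longrightarrow> X' x = 0"
  obtains L where "L \<ge> 0" "\<And>x v. norm (X' x *v v) \<le> L * norm v"
proof -
  have "compact (X' ` cbox a b)"
    by (rule compact_continuous_image[OF continuous_on_subset[OF cont]]) auto
  then obtain K where K: "\<And>x. x \<in> cbox a b \<Longrightarrow> norm (X' x) \<le> K"
    using compact_imp_bounded bounded_iff by (metis imageI)
  have bilin: "bounded_bilinear (\<lambda>(A::real^'n^'n) v. A *v v)"
    unfolding bilinear_conv_bounded_bilinear[symmetric] bilinear_def
    by (auto intro!: linearI simp: matrix_vector_right_distrib matrix_vector_mult_scaleR
        matrix_vector_mult_add_rdistrib scaleR_matrix_vector_assoc)
  then obtain C where C: "\<And>(A::real^'n^'n) v. norm (A *v v) \<le> norm A * norm v * C" "C > 0"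
    using bounded_bilinear.pos_bounded by blast
  show ?thesis
  proof
    show "max K 0 * C \<ge> 0" using C by simp
    show "norm (X' x *v v) \<le> max K 0 * C * norm v" for x v
    proof -
      have "norm (X' x) \<le> max K 0" using K[of x] supp[of x]
          by (cases "x \<in> cbox a b") (auto intro: le_max_iff_disj[THEN iffD2])
      then have "norm (X' x) * norm v * C \<le> max K 0 * norm v * C" using C by (intro mult_right_mono) auto
      then show ?thesis using C(1)[of "X' x" v] by (simp add: mult_ac)
    qed
  qed
qed

text \<open>For the field \<open>X + sY\<close> the integral of \<open>det(tI + DX + sDY)\<close> is a polynomial in \<open>s\<close> that is constant
  for small \<open>s\<close>, so its linear coefficient vanishes.\<close>

lemma integral_linear_det_coefficient_zero:
  fixes X Y :: "real^'n \<Rightarrow> real^'n" and X' Y' :: "real^'n \<Rightarrow> real^'n^'n"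
  assumes derX: "\<And>x. (X has_derivative (*v) (X' x)) (at x)"
      and derY: "\<And>x. (Y has_derivative (*v) (Y' x)) (at x)"
    and contX: "continuous_on UNIV X'" and contY: "continuous_on UNIV Y'"
    and bX: "\<And>x v. norm (X' x *v v) \<le> L * norm v" and bY: "\<And>x v. norm (Y' x *v v) \<le> L * norm v"
    and L: "0 \<le> L" "2 * L < t"
    and suppX: "\<And>x. x \<notin> cbox a b \<Longrightarrow> X x = 0" and suppY: "\<And>x. x \<notin> cbox a b \<Longrightarrow> Y x = 0"
  shows "integral (cbox a b) (\<lambda>x. \<Sum>k\<in>UNIV. det (\<chi> i. if i = k then Y' x $ i else (t *\<^sub>R mat 1 + X' x) $ i)) = 0"
proof -
  define m where "m I x = det (\<chi> i. if i \<in> I then Y' x $ i else (t *\<^sub>R mat 1 + X' x) $ i)" for I x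
  have cm: "continuous_on (cbox a b) (m I)" for I
  proof -
    have "continuous_on UNIV (\<lambda>x. \<chi> i. if i \<in> I then Y' x $ i else (t *\<^sub>R mat 1 + X' x) $ i)"
    proof (rule continuous_on_vec_lambda)
      fix i
      show "continuous_on UNIV (\<lambda>x. if i \<in> I then Y' x $ i else (t *\<^sub>R mat 1 + X' x) $ i)"
        using contX contY by (cases "i \<in> I") (auto intro!: continuous_intros)
    qed
    then have "continuous_on UNIV (m I)" unfolding m_def by (rule continuous_on_det)
    then show ?thesis by (rule continuous_on_subset) simp
  qed
  then have im: "m I integrable_on cbox a b" for I by (rule integrable_continuous)
  define V where "V = t ^ CARD('n) * measure lborel (cbox a b)"
  define c where "c j = (\<Sum>I | card I = j. integral (cbox a b) (m I)) - (if j = 0 then V else 0)" for j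
  have zero: "(\<Sum>j\<le>CARD('n). c j * s ^ j) = 0" if s: "s \<in> {0<..<1}" for s
  proof -
    have "((\<lambda>x. det (t *\<^sub>R mat 1 + (X' x + s *\<^sub>R Y' x))) has_integral V) (cbox a b)"
      unfolding V_def
    proof (rule det_shift_has_integral[where X = "\<lambda>x. X x + s *\<^sub>R Y x" and L = "2 * L"])
      show "((\<lambda>x. X x + s *\<^sub>R Y x) has_derivative (*v) (X' x + s *\<^sub>R Y' x)) (at x)" for x
        using derX[of x] derY[of x]
        by (auto intro!: derivative_eq_intros simp: matrix_vector_mult_add_rdistrib
            scaleR_matrix_vector_assoc[symmetric])
      show "norm ((X' x + s *\<^sub>R Y' x) *v v) \<le> 2 * L * norm v" for x v
      proof -
        have "norm ((X' x + s *\<^sub>R Y' x) *v v) \<le> norm (X' x *v v) + s * norm (Y' x *v v)"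
          unfolding matrix_vector_mult_add_rdistrib scaleR_matrix_vector_assoc[symmetric]
          using norm_triangle_ineq[of "X' x *v v" "s *\<^sub>R (Y' x *v v)"] s by simp
        also have "s * norm (Y' x *v v) \<le> 1 * (L * norm v)" using s bY by (intro mult_mono) auto
        finally show ?thesis using bX[of x v] by simp
      qed
    qed (use L suppX suppY in auto)
    then have "integral (cbox a b) (\<lambda>x. det ((t *\<^sub>R mat 1 + X' x) + s *\<^sub>R Y' x)) = V"
      by (simp add: integral_unique add.assoc)
    then have "V = integral (cbox a b) (\<lambda>x. \<Sum>I\<in>UNIV. s ^ card I * m I x)"
      unfolding det_add_scaled_rows m_def by simp
    also have "\<dots> = (\<Sum>I\<in>UNIV. s ^ card I * integral (cbox a b) (m I))"
      using im by (subst integral_sum) (auto intro!: integrable_on_mult_right)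
    also have "\<dots> = (\<Sum>j\<le>CARD('n). (\<Sum>I | card I = j. integral (cbox a b) (m I)) * s ^ j)"
      by (rule sum_over_subsets_by_card)
    finally have "V = (\<Sum>j\<le>CARD('n). (\<Sum>I | card I = j. integral (cbox a b) (m I)) * s ^ j)" .
    moreover have "(\<Sum>j\<le>CARD('n). (if j = 0 then V else 0) * s ^ j) = V"
      by (subst sum.mono_neutral_right[of _ "{0}"]) auto
    ultimately show ?thesis unfolding c_def by (simp only: left_diff_distrib sum_subtractf)
  qed
  have "c 1 = 0"
    by (rule polyfun_zero_if_zero_on_infinite[of "{0<..<1::real}", OF _ zero]) (auto simp: infinite_Ioo Suc_leI)
  then have "(\<Sum>I | card I = 1. integral (cbox a b) (m I)) = 0" unfolding c_def by simp
  moreover have "{I::'n set. card I = 1} = range (\<lambda>k. {k})" by (auto simp: card_1_singleton_iff)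
  ultimately have "(\<Sum>k\<in>UNIV. integral (cbox a b) (m {k})) = 0"
    by (simp add: sum.reindex inj_def)
  moreover have "integral (cbox a b) (\<lambda>x. \<Sum>k\<in>UNIV. m {k} x) = (\<Sum>k\<in>UNIV. integral (cbox a b) (m {k}))"
    using im by (intro integral_sum) auto
  ultimately show ?thesis unfolding m_def by simp
qed

text \<open>The weak form of the statement that the Newton tensors of a Hessian \<open>DX\<close> are divergence free, for
  \<open>X\<close> only once differentiable. Symmetry is required only where the test field \<open>Y\<close> is active, since \<open>X\<close> will be
  a gradient multiplied by a cutoff function.\<close>

theorem integral_newton_tensor_zero:
  fixes X Y :: "real^'n \<Rightarrow> real^'n" and X' Y' :: "real^'n \<Rightarrow> real^'n^'n"
  assumes derX: "\<And>x. (X has_derivative (*v) (X' x)) (at x)"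
      and derY: "\<And>x. (Y has_derivative (*v) (Y' x)) (at x)"
    and contX: "continuous_on UNIV X'" and contY: "continuous_on UNIV Y'"
    and suppX: "\<And>x. x \<notin> cbox a b \<Longrightarrow> X x = 0 \<and> X' x = 0" and suppY: "\<And>x. x \<notin> cbox a b \<Longrightarrow> Y x = 0 \<and> Y' x = 0"
    and sym: "\<And>x. Y' x \<noteq> 0 \<Longrightarrow> transpose (X' x) = X' x"
    and j: "j \<le> CARD('n)"
  shows "integral (cbox a b) (\<lambda>x. trace (newton_tensor j (X' x) ** Y' x)) = 0"
proof (cases j)
  case 0
  then show ?thesis by (simp add: matrix_matrix_mult_def trace_def)
next
  case (Suc m)
  obtain L1 where L1: "L1 \<ge> 0" "\<And>x v. norm (X' x *v v) \<le> L1 * norm v"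
    using continuous_matrix_compact_support_bound[OF contX, of a b] suppX by blast
  obtain L2 where L2: "L2 \<ge> 0" "\<And>x v. norm (Y' x *v v) \<le> L2 * norm v"
    using continuous_matrix_compact_support_bound[OF contY, of a b] suppY by blast
  define L where "L = L1 + L2"
  have bX: "norm (X' x *v v) \<le> L * norm v" for x v
    using L1(2)[of x v] mult_right_mono[of L1 L "norm v"] L2(1) unfolding L_def by simp
  have bY: "norm (Y' x *v v) \<le> L * norm v" for x v
    using L2(2)[of x v] L1 unfolding L_def by (simp add: distrib_right add_increasing)
  have L0: "0 \<le> L" using L1 L2 unfolding L_def by simp
  define N where "N = CARD('n) - 1"
  have N: "CARD('n) = Suc N" unfolding N_def by (simp add: Suc_leI)
  define f where "f i x = trace (newton_tensor (Suc i) (X' x) ** Y' x)" for i x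
  have cf: "f i integrable_on cbox a b" for i
    unfolding f_def by (intro integrable_continuous continuous_intros continuous_on_subset[OF contX]
        continuous_on_subset[OF contY]) auto
  have tr: "(\<Sum>k\<in>UNIV. det (\<chi> i. if i = k then Y' x $ i else (t *\<^sub>R mat 1 + X' x) $ i))
      = (\<Sum>i\<le>N. f i x * t ^ (N - i))" if t: "2 * L < t" for t x
  proof (cases "Y' x = 0")
    case True
    have "det (\<chi> i. if i = k then Y' x $ i else (t *\<^sub>R mat 1 + X' x) $ i) = 0" for k
      by (rule det_zero_row(1)[of k]) (simp add: True row_def vec_eq_iff)
    then show ?thesis using True by (simp add: f_def matrix_matrix_mult_def trace_def)
  next
    case False
    have sX: "transpose (X' x) = X' x" by (rule sym[OF False])
    obtain e l where "eigenbasis (X' x) e l" using eigenbasis_exists[OF sX] .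
    then interpret eigenbasis "X' x" e l .
    define M where "M = t *\<^sub>R mat 1 + X' x"
    define W where "W = (\<Sum>i<CARD('n). t ^ (CARD('n) - Suc i) *\<^sub>R newton_tensor (Suc i) (X' x))"
    have dM: "det M > 0" unfolding M_def by (rule det_shift_pos[OF bX]) (use L0 t in auto)
    have sM: "transpose M = M" unfolding M_def using symmetric_entries[OF sX]
      by (simp add: transpose_def vec_eq_iff mat_def)
    have ts: "transpose (\<Sum>i\<in>S. c i *\<^sub>R R i) = (\<Sum>i\<in>S. c i *\<^sub>R transpose (R i))" for S :: "nat set" and c
        and R :: "nat \<Rightarrow> real^'n^'n"
      by (simp add: transpose_def vec_eq_iff)
    have sW: "transpose W = W" unfolding W_def ts transpose_newton_tensor[OF sX] ..
    have MW: "M ** W = det M *\<^sub>R mat 1" unfolding M_def W_def by (rule resolvent)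
    have "(\<Sum>k\<in>UNIV. det (\<chi> i. if i = k then Y' x $ i else M $ i)) = trace (W ** Y' x)"
      by (rule linear_det_coefficient[OF sM MW refl _ sW]) (use dM in simp)
    also have "W ** Y' x = (\<Sum>i<CARD('n). t ^ (CARD('n) - Suc i) *\<^sub>R (newton_tensor (Suc i) (X' x) ** Y' x))"
      unfolding W_def by (simp add: matrix_matrix_mult_def vec_eq_iff sum_distrib_left sum_distrib_right
          mult_ac del: newton_tensor.simps) (subst sum.swap, simp)
    also have "trace \<dots> = (\<Sum>i<CARD('n). t ^ (CARD('n) - Suc i) * f i x)"
      unfolding f_def trace_def by (simp add: sum_distrib_left del: newton_tensor.simps) (subst sum.swap, simp)
    also have "\<dots> = (\<Sum>i\<le>N. f i x * t ^ (N - i))" unfolding N by (simp add: lessThan_Suc_atMost mult.commute)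
    finally show ?thesis unfolding M_def .
  qed
  define c where "c i = integral (cbox a b) (f i)" for i
  have "(\<Sum>i\<le>N. c (N - i) * t ^ i) = 0" if t: "t \<in> {2 * L<..}" for t
  proof -
    have "0 = integral (cbox a b) (\<lambda>x. \<Sum>i\<le>N. f i x * t ^ (N - i))"
      using integral_linear_det_coefficient_zero[OF derX derY contX contY bX bY L0, of t] suppX suppY t
          tr[of t] by simp
    also have "\<dots> = (\<Sum>i\<le>N. c i * t ^ (N - i))"
      unfolding c_def using cf by (subst integral_sum) (auto intro!: integrable_on_mult_left)
    finally show ?thesis unfolding sum_reverse_power by simp
  qed
  then have "c (N - (N - m)) = 0"
    by (intro polyfun_zero_if_zero_on_infinite[of "{2 * L<..}" "\<lambda>i. c (N - i)" N]) (auto simp: infinite_Ioi)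
  then show ?thesis using Suc j N unfolding c_def f_def by simp
qed

section \<open>Gradients and symmetric Hessians\<close>

lemma grad_eqI:
  fixes f :: "'a::euclidean_space \<Rightarrow> real"
  assumes "(f has_derivative (\<lambda>h. D \<bullet> h)) (at x)" shows "grad f x = D"
  unfolding grad_def gderiv_def
proof (rule the_equality)
  show "(f has_derivative (\<lambda>h. h \<bullet> D)) (at x)" using assms by (simp add: inner_commute)
  fix D' assume "(f has_derivative (\<lambda>h. h \<bullet> D')) (at x)"
  then have "(\<lambda>h. h \<bullet> D') = (\<lambda>h. D \<bullet> h)" using assms has_derivative_unique by blast
  then have "h \<bullet> D' = h \<bullet> D" for h by (metis inner_commute)
  then show "D' = D" using vector_eq_ldot by blast
qed

lemma has_derivative_grad:
  fixes f :: "'a::euclidean_space \<Rightarrow> real"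
  assumes "f differentiable (at x)" shows "(f has_derivative (\<lambda>h. grad f x \<bullet> h)) (at x)"
proof -
  obtain f' where f': "(f has_derivative f') (at x)" using assms unfolding differentiable_def by blast
  then have lin: "linear f'" using has_derivative_linear by blast
  define D where "D = (\<Sum>b\<in>Basis. f' b *\<^sub>R b)"
  have "f' h = D \<bullet> h" for h
  proof -
    have "f' h = f' (\<Sum>b\<in>Basis. (h \<bullet> b) *\<^sub>R b)" by (simp add: euclidean_representation)
    also have "\<dots> = (\<Sum>b\<in>Basis. (h \<bullet> b) * f' b)" by (simp add: linear_sum[OF lin] linear_scale[OF lin])
    also have "\<dots> = D \<bullet> h" unfolding D_def by (simp add: inner_sum_right inner_commute[of _ h] mult.commute)
    finally show ?thesis .
  qed
  then have "(f has_derivative (\<lambda>h. D \<bullet> h)) (at x)" using f' by (metis (no_types, lifting) ext)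
  then show ?thesis using grad_eqI by metis
qed

lemma has_derivative_hessian:
  assumes "grad f differentiable (at x)" shows "(grad f has_derivative (*v) (hessian f x)) (at x)"
proof -
  have *: "(grad f has_derivative frechet_derivative (grad f) (at x)) (at x)"
      using assms frechet_derivative_works by blast
  then have "linear (frechet_derivative (grad f) (at x))" using has_derivative_linear by blast
  then have "(*v) (matrix (frechet_derivative (grad f) (at x))) = frechet_derivative (grad f) (at x)"
    by (intro ext) (simp add: matrix_works linear_matrix_vector_mul_eq)
  then show ?thesis unfolding hessian_def using * by simp
qed

lemma hessian_eqI:
  assumes "(grad f has_derivative (*v) M) (at x)" shows "hessian f x = M"
  unfolding hessian_def unfolding frechet_derivative_at[OF assms, symmetric] by simp

lemma line_mvt:
  fixes f :: "'a::euclidean_space \<Rightarrow> real"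
  assumes t: "t > 0" and der: "\<And>s. 0 < s \<Longrightarrow> s < t
      \<Longrightarrow> (f has_derivative (\<lambda>h. G (y + s *\<^sub>R d) \<bullet> h)) (at (y + s *\<^sub>R d))"
    and cont: "continuous_on {0..t} (\<lambda>s. f (y + s *\<^sub>R d))"
  obtains s where "0 < s" "s < t" "f (y + t *\<^sub>R d) - f y = t * (G (y + s *\<^sub>R d) \<bullet> d)"
proof -
  have 1: "((\<lambda>s. f (y + s *\<^sub>R d)) has_derivative (\<lambda>r. G (y + s *\<^sub>R d) \<bullet> (r *\<^sub>R d))) (at s)"
      if "0 < s" "s < t" for s
  proof -
    have "((\<lambda>s. y + s *\<^sub>R d) has_derivative (\<lambda>r. r *\<^sub>R d)) (at s)" by (auto intro!: derivative_eq_intros)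
    from has_derivative_compose[OF this der[OF that]] show ?thesis .
  qed
  obtain s where "0 < s" "s < t" "f (y + t *\<^sub>R d) - f (y + 0 *\<^sub>R d) = G (y + s *\<^sub>R d) \<bullet> ((t - 0) *\<^sub>R d)"
    by (rule mvt[OF t cont 1])
  then show ?thesis using that by auto
qed

text \<open>The second difference of \<open>u\<close> over a small parallelogram is symmetric in its two sides. Two
  applications of the mean value theorem, in either order, express it by values of the second derivative near
  \<open>x\<close>.\<close>

lemma hessian_symmetric_bilinear:
  fixes u :: "'a::euclidean_space \<Rightarrow> real" and g :: "'a \<Rightarrow> 'a" and B :: "'a \<Rightarrow> 'a \<Rightarrow> 'a"
  assumes op: "open S" and x: "x \<in> S"
    and du: "\<And>y. y \<in> S \<Longrightarrow> (u has_derivative (\<lambda>h. g y \<bullet> h)) (at y)"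
    and dg: "\<And>y. y \<in> S \<Longrightarrow> (g has_derivative B y) (at y)"
    and cont: "\<And>v. continuous_on S (\<lambda>y. B y v)"
  shows "B x v \<bullet> w = B x w \<bullet> v"
proof (rule ccontr)
  assume ne: "B x v \<bullet> w \<noteq> B x w \<bullet> v"
  define \<epsilon> where "\<epsilon> = \<bar>B x v \<bullet> w - B x w \<bullet> v\<bar> / 2"
  have \<epsilon>: "\<epsilon> > 0" unfolding \<epsilon>_def using ne by simp
  have c1: "continuous_on S (\<lambda>y. B y v \<bullet> w)" "continuous_on S (\<lambda>y. B y w \<bullet> v)"
    by (intro continuous_intros cont)+
  obtain d1 where d1: "d1 > 0" "\<And>y. y \<in> S \<Longrightarrow> dist y x < d1 \<Longrightarrow> \<bar>B y v \<bullet> w - B x v \<bullet> w\<bar> < \<epsilon>"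
    using c1(1) x \<epsilon> unfolding continuous_on_iff dist_real_def by metis
  obtain d2 where d2: "d2 > 0" "\<And>y. y \<in> S \<Longrightarrow> dist y x < d2 \<Longrightarrow> \<bar>B y w \<bullet> v - B x w \<bullet> v\<bar> < \<epsilon>"
    using c1(2) x \<epsilon> unfolding continuous_on_iff dist_real_def by metis
  obtain r where r: "r > 0" "ball x r \<subseteq> S" using op x open_contains_ball by blast
  define \<delta> where "\<delta> = min r (min d1 d2)"
  define t where "t = \<delta> / (2 * (norm v + norm w + 1))"
  have \<delta>: "\<delta> > 0" unfolding \<delta>_def using r d1 d2 by simp
  have t: "t > 0" unfolding t_def using \<delta> by (intro divide_pos_pos) (auto intro: add_nonneg_pos)
  have near: "x + a *\<^sub>R v + b *\<^sub>R w \<in> ball x \<delta>" if "0 \<le> a" "a \<le> t" "0 \<le> b" "b \<le> t" for a b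
  proof -
    have "norm (a *\<^sub>R v + b *\<^sub>R w) \<le> a * norm v + b * norm w"
      using norm_triangle_ineq[of "a *\<^sub>R v" "b *\<^sub>R w"] that by simp
    also have "\<dots> \<le> t * norm v + t * norm w" using that by (intro add_mono mult_right_mono) auto
    also have "\<dots> < t * (2 * (norm v + norm w + 1))" using t
        by (simp add: algebra_simps add_pos_nonneg add_nonneg_pos)
    also have "\<dots> = \<delta>" unfolding t_def by (simp add: add_nonneg_eq_0_iff)
    finally have "dist (x + (a *\<^sub>R v + b *\<^sub>R w)) x < \<delta>" by (simp add: dist_norm)
    then show ?thesis by (simp add: dist_commute add.assoc)
  qed
  have key: "\<exists>a b. 0 \<le> a \<and> a \<le> t \<and> 0 \<le> b \<and> b \<le> t \<and>
      u (x + t *\<^sub>R v + t *\<^sub>R w) - u (x + t *\<^sub>R v) - u (x + t *\<^sub>R w) + u x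
          = t * (t * (B (x + a *\<^sub>R v + b *\<^sub>R w) w \<bullet> v))"
    if near: "\<And>a b. 0 \<le> a \<Longrightarrow> a \<le> t \<Longrightarrow> 0 \<le> b \<Longrightarrow> b \<le> t \<Longrightarrow> x + a *\<^sub>R v + b *\<^sub>R w \<in> S" for v w
  proof -
    define f where "f y = u (y + t *\<^sub>R w) - u y" for y
    have S1: "x + s *\<^sub>R v \<in> S" "x + s *\<^sub>R v + t *\<^sub>R w \<in> S" if "0 \<le> s" "s \<le> t" for s
      using near[of s 0] near[of s t] that t by auto
    have df: "(f has_derivative (\<lambda>h. (g (x + s *\<^sub>R v + t *\<^sub>R w) - g (x + s *\<^sub>R v)) \<bullet> h)) (at (x
        + s *\<^sub>R v))" if "0 \<le> s" "s \<le> t" for s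
    proof -
      have "((\<lambda>y. y + t *\<^sub>R w) has_derivative (\<lambda>h. h)) (at (x + s *\<^sub>R v))"
          by (auto intro!: derivative_eq_intros)
      from has_derivative_diff[OF has_derivative_compose[OF this du[OF S1(2)[OF that]]] du[OF S1(1)[OF that]]]
      show ?thesis unfolding f_def[abs_def] by (simp add: inner_diff_left)
    qed
    have cf: "continuous_on {0..t} (\<lambda>s. f (x + s *\<^sub>R v))"
    proof (intro continuous_at_imp_continuous_on ballI)
      fix s assume "s \<in> {0..t}"
      then have "(f has_derivative (\<lambda>h. (g (x + s *\<^sub>R v + t *\<^sub>R w) - g (x + s *\<^sub>R v)) \<bullet> h)) (at (x + s *\<^sub>R v))"
        by (intro df) auto
      then have c: "isCont f (x + s *\<^sub>R v)" by (rule has_derivative_continuous)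
      have "isCont (\<lambda>s. x + s *\<^sub>R v) s" by (intro continuous_intros)
      from isCont_o2[OF this c] show "isCont (\<lambda>s. f (x + s *\<^sub>R v)) s" .
    qed
    obtain a where a: "0 < a" "a < t" "f (x + t *\<^sub>R v) - f x
        = t * ((g (x + a *\<^sub>R v + t *\<^sub>R w) - g (x + a *\<^sub>R v)) \<bullet> v)"
      using line_mvt[of t f "\<lambda>y. g (y + t *\<^sub>R w) - g y" x v, OF t df cf] by auto
    define h where "h y = g y \<bullet> v" for y
    have S2: "x + a *\<^sub>R v + s *\<^sub>R w \<in> S" if "0 \<le> s" "s \<le> t" for s using near[of a s] that a by auto
    have dh: "(h has_derivative (\<lambda>k. B (x + a *\<^sub>R v + s *\<^sub>R w) k \<bullet> v)) (at (x + a *\<^sub>R v + s *\<^sub>R w))"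
        if "0 \<le> s" "s \<le> t" for s
      unfolding h_def[abs_def] using dg[OF S2[OF that]] by (auto intro!: derivative_eq_intros)
    have *: "((\<lambda>s. h (x + a *\<^sub>R v + s *\<^sub>R w)) has_derivative (\<lambda>r. B (x + a *\<^sub>R v
        + s *\<^sub>R w) (r *\<^sub>R w) \<bullet> v)) (at s)" if "0 \<le> s" "s \<le> t" for s
    proof -
      have "((\<lambda>s. x + a *\<^sub>R v + s *\<^sub>R w) has_derivative (\<lambda>r. r *\<^sub>R w)) (at s)"
          by (auto intro!: derivative_eq_intros)
      from has_derivative_compose[OF this dh[OF that]] show ?thesis .
    qed
    have ch: "continuous_on {0..t} (\<lambda>s. h (x + a *\<^sub>R v + s *\<^sub>R w))"
      by (intro continuous_at_imp_continuous_on ballI has_derivative_continuous[OF *]) auto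
    obtain b where b0: "0 < b" "b < t" "h (x + a *\<^sub>R v + t *\<^sub>R w) - h (x + a *\<^sub>R v + 0 *\<^sub>R w)
        = B (x + a *\<^sub>R v + b *\<^sub>R w) ((t - 0) *\<^sub>R w) \<bullet> v"
      by (rule mvt[OF t ch *]) auto
    then have b: "0 < b" "b < t" "h (x + a *\<^sub>R v + t *\<^sub>R w) - h (x + a *\<^sub>R v)
        = B (x + a *\<^sub>R v + b *\<^sub>R w) (t *\<^sub>R w) \<bullet> v"
      by simp_all
    have lin: "linear (B (x + a *\<^sub>R v + b *\<^sub>R w))" using dg[OF S2[of b]] b has_derivative_linear by auto
    have "u (x + t *\<^sub>R v + t *\<^sub>R w) - u (x + t *\<^sub>R v) - u (x + t *\<^sub>R w) + u x = f (x + t *\<^sub>R v) - f x"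
        by (simp add: f_def)
    also have "\<dots> = t * (h (x + a *\<^sub>R v + t *\<^sub>R w) - h (x + a *\<^sub>R v))" unfolding a(3) h_def
        by (simp add: inner_diff_left)
    also have "\<dots> = t * (t * (B (x + a *\<^sub>R v + b *\<^sub>R w) w \<bullet> v))" unfolding b(3)
        by (simp add: linear_scale[OF lin])
    finally show ?thesis using a b by (intro exI[of _ a] exI[of _ b]) auto
  qed
  have nS: "x + a *\<^sub>R v + b *\<^sub>R w \<in> S \<and> dist (x + a *\<^sub>R v + b *\<^sub>R w) x
      < d1 \<and> dist (x + a *\<^sub>R v + b *\<^sub>R w) x < d2"
    if "0 \<le> a" "a \<le> t" "0 \<le> b" "b \<le> t" for a b
  proof -
    have "dist x (x + a *\<^sub>R v + b *\<^sub>R w) < \<delta>" using near[OF that] by simp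
    then have "dist x (x + a *\<^sub>R v + b *\<^sub>R w) < r" "dist (x + a *\<^sub>R v + b *\<^sub>R w) x
        < d1" "dist (x + a *\<^sub>R v + b *\<^sub>R w) x < d2"
      unfolding \<delta>_def by (simp_all add: dist_commute)
    then show ?thesis using r(2) by (auto simp: subset_iff)
  qed
  obtain a b where ab: "0 \<le> a" "a \<le> t" "0 \<le> b" "b \<le> t"
    "u (x + t *\<^sub>R v + t *\<^sub>R w) - u (x + t *\<^sub>R v) - u (x + t *\<^sub>R w) + u x
        = t * (t * (B (x + a *\<^sub>R v + b *\<^sub>R w) w \<bullet> v))"
    using key[of v w] nS by blast
  have swap: "x + a *\<^sub>R w + b *\<^sub>R v = x + b *\<^sub>R v + a *\<^sub>R w" for a b by simp
  obtain a' b' where ab': "0 \<le> a'" "a' \<le> t" "0 \<le> b'" "b' \<le> t"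
    "u (x + t *\<^sub>R w + t *\<^sub>R v) - u (x + t *\<^sub>R w) - u (x + t *\<^sub>R v) + u x
        = t * (t * (B (x + a' *\<^sub>R w + b' *\<^sub>R v) v \<bullet> w))"
    using key[of w v] nS unfolding swap by blast
  have "t * (t * (B (x + a *\<^sub>R v + b *\<^sub>R w) w \<bullet> v)) = t * (t * (B (x + b' *\<^sub>R v + a' *\<^sub>R w) v \<bullet> w))"
    using ab(5) ab'(5) unfolding swap by linarith
  then have "B (x + a *\<^sub>R v + b *\<^sub>R w) w \<bullet> v = B (x + b' *\<^sub>R v + a' *\<^sub>R w) v \<bullet> w" using t by simp
  moreover have "\<bar>B (x + a *\<^sub>R v + b *\<^sub>R w) w \<bullet> v - B x w \<bullet> v\<bar> < \<epsilon>" using d2(2) nS[OF ab(1-4)] by blast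
  moreover have "\<bar>B (x + b' *\<^sub>R v + a' *\<^sub>R w) v \<bullet> w - B x v \<bullet> w\<bar> < \<epsilon>" using d1(2) nS[OF ab'(3,4,1,2)] by blast
  ultimately show False unfolding \<epsilon>_def by (simp add: abs_if split: if_splits)
qed

lemma hessian_symmetric:
  fixes u :: "real^'n \<Rightarrow> real" and A :: "real^'n \<Rightarrow> real^'n^'n"
  assumes op: "open S" and x: "x \<in> S"
    and du: "\<And>y. y \<in> S \<Longrightarrow> (u has_derivative (\<lambda>h. g y \<bullet> h)) (at y)"
    and dg: "\<And>y. y \<in> S \<Longrightarrow> (g has_derivative (*v) (A y)) (at y)"
    and cont: "continuous_on S A"
  shows "transpose (A x) = A x"
proof -
  have "(A x *v v) \<bullet> w = (A x *v w) \<bullet> v" for v w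
    by (rule hessian_symmetric_bilinear[OF op x du dg]) (auto intro!: continuous_intros cont)
  from this[of "axis j 1" "axis i 1" for i j] have "A x $ i $ j = A x $ j $ i" for i j
    by (simp add: matrix_vector_mul_component inner_axis matrix_vector_mult_basis column_def)
  then show ?thesis by (simp add: transpose_def vec_eq_iff)
qed

section \<open>Weakly divergence-free Newton tensors\<close>

text \<open>A \<open>C\<^sup>1\<close> transition from \<open>0\<close> on the negative axis to \<open>1\<close> beyond \<open>1\<close>, built from the \<open>C\<^sup>1\<close> function
  \<open>(max 0 x)\<^sup>2\<close>.\<close>

definition smooth_step :: "real \<Rightarrow> real" where
  "smooth_step x = (max 0 (1 - (max 0 (1 - x))\<^sup>2))\<^sup>2"

definition smooth_step' :: "real \<Rightarrow> real" where
  "smooth_step' x = 4 * max 0 (1 - (max 0 (1 - x))\<^sup>2) * max 0 (1 - x)"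

lemma DERIV_max_square: "((\<lambda>x::real. (max 0 x)\<^sup>2) has_real_derivative 2 * max 0 x) (at x)"
proof -
  consider "x < 0" | "x = 0" | "x > 0" by linarith
  then show ?thesis
  proof cases
    case 1
    have "((\<lambda>x::real. 0) has_real_derivative 0) (at x)" by simp
    then have "((\<lambda>x::real. (max 0 x)\<^sup>2) has_real_derivative 0) (at x)"
      by (rule has_field_derivative_transform_within_open[of _ _ _ "{..<0}"]) (use 1 in auto)
    then show ?thesis using 1 by simp
  next
    case 3
    have "((\<lambda>x::real. x\<^sup>2) has_real_derivative 2 * x) (at x)" by (auto intro!: derivative_eq_intros)
    then have "((\<lambda>x::real. (max 0 x)\<^sup>2) has_real_derivative 2 * x) (at x)"
      by (rule has_field_derivative_transform_within_open[of _ _ _ "{0<..}"]) (use 3 in auto)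
    then show ?thesis using 3 by simp
  next
    case 2
    have "(\<lambda>h::real. (max 0 h)\<^sup>2 / h) \<midarrow>0\<rightarrow> 0"
    proof (rule Lim_null_comparison)
      show "\<forall>\<^sub>F h in at (0::real). norm ((max 0 h)\<^sup>2 / h) \<le> norm h"
        by (rule always_eventually) (auto simp: max_def power2_eq_square abs_mult)
    qed (auto intro!: tendsto_eq_intros)
    then show ?thesis using 2 by (simp add: DERIV_def)
  qed
qed

lemma DERIV_smooth_step: "(smooth_step has_real_derivative smooth_step' x) (at x)"
proof -
  have 1: "((\<lambda>x. 1 - (max 0 (1 - x))\<^sup>2) has_real_derivative - (2 * max 0 (1 - x) * (- 1))) (at x)" for x :: real
  proof -
    have "((\<lambda>x. (max 0 (1 - x))\<^sup>2) has_real_derivative 2 * max 0 (1 - x) * (- 1)) (at x)"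
      by (rule DERIV_chain2[OF DERIV_max_square]) (auto intro!: derivative_eq_intros)
    from DERIV_diff[OF DERIV_const[of 1] this] show ?thesis by simp
  qed
  show ?thesis unfolding smooth_step_def[abs_def] smooth_step'_def
    using DERIV_chain2[OF DERIV_max_square 1[of x]] by (simp add: mult_ac)
qed

lemma continuous_on_smooth_step' [continuous_intros]:
  "continuous_on S f \<Longrightarrow> continuous_on S (\<lambda>x. smooth_step' (f x))"
  unfolding smooth_step'_def by (intro continuous_intros)

lemma smooth_step_props:
  "x \<le> 0 \<Longrightarrow> smooth_step x = 0" "x \<le> 0 \<Longrightarrow> smooth_step' x = 0"
  "x \<ge> 1 \<Longrightarrow> smooth_step x = 1" "x \<ge> 1 \<Longrightarrow> smooth_step' x = 0"
  "0 \<le> smooth_step x" "smooth_step x \<le> 1" "0 \<le> smooth_step' x"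
proof -
  have "1 \<le> (1 - x)\<^sup>2" if "x \<le> 0" using that by (simp add: one_le_power)
  then show "x \<le> 0 \<Longrightarrow> smooth_step x = 0" "x \<le> 0 \<Longrightarrow> smooth_step' x = 0"
    unfolding smooth_step_def smooth_step'_def by simp_all
  show "x \<ge> 1 \<Longrightarrow> smooth_step x = 1" "x \<ge> 1 \<Longrightarrow> smooth_step' x = 0"
    unfolding smooth_step_def smooth_step'_def by simp_all
  show "0 \<le> smooth_step x" "0 \<le> smooth_step' x" unfolding smooth_step_def smooth_step'_def by simp_all
  have "0 \<le> max 0 (1 - (max 0 (1 - x))\<^sup>2)" "max 0 (1 - (max 0 (1 - x))\<^sup>2) \<le> 1" by auto
  then show "smooth_step x \<le> 1" unfolding smooth_step_def by (simp add: power_le_one)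
qed

text \<open>Applied to a function \<open>u\<close> that is negative inside and zero on the boundary of a domain, this vanishes where
  \<open>u \<ge> - \<epsilon>\<close> and equals \<open>1\<close> where \<open>u \<le> - 2 \<epsilon>\<close>. Level sets of \<open>u\<close> replace the distance to the boundary.\<close>

definition cutoff :: "real \<Rightarrow> real \<Rightarrow> real" where "cutoff \<epsilon> y = smooth_step (- y / \<epsilon> - 1)"
definition cutoff' :: "real \<Rightarrow> real \<Rightarrow> real" where "cutoff' \<epsilon> y = - smooth_step' (- y / \<epsilon> - 1) / \<epsilon>"

lemma DERIV_cutoff: "(cutoff \<epsilon> has_real_derivative cutoff' \<epsilon> y) (at y)"
proof -
  have "((\<lambda>y. - y / \<epsilon> - 1) has_real_derivative - 1 / \<epsilon>) (at y)"
    unfolding divide_inverse by (auto intro!: derivative_eq_intros)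
  from DERIV_chain2[OF DERIV_smooth_step this] show ?thesis
    unfolding cutoff_def[abs_def] cutoff'_def by simp
qed

lemma continuous_on_cutoff [continuous_intros]:
  assumes "continuous_on S f" shows "continuous_on S (\<lambda>x. cutoff \<epsilon> (f x))"
proof -
  have "continuous_on UNIV (cutoff \<epsilon>)" using DERIV_cutoff
      by (meson DERIV_continuous_on has_field_derivative_at_within)
  then show ?thesis using assms by (rule continuous_on_compose2) auto
qed

lemma continuous_on_cutoff' [continuous_intros]:
  assumes "continuous_on S f" shows "continuous_on S (\<lambda>x. cutoff' \<epsilon> (f x))"
  unfolding cutoff'_def divide_inverse by (intro continuous_intros assms)

lemma cutoff_props:
  assumes "\<epsilon> > 0"
  shows "y \<ge> - \<epsilon> \<Longrightarrow> cutoff \<epsilon> y = 0" "y \<ge> - \<epsilon> \<Longrightarrow> cutoff' \<epsilon> y = 0"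
    "y \<le> - 2 * \<epsilon> \<Longrightarrow> cutoff \<epsilon> y = 1" "y \<le> - 2 * \<epsilon> \<Longrightarrow> cutoff' \<epsilon> y = 0"
    "0 \<le> cutoff \<epsilon> y" "cutoff \<epsilon> y \<le> 1" "cutoff' \<epsilon> y \<le> 0"
proof -
  have 1: "- y / \<epsilon> - 1 \<le> 0 \<longleftrightarrow> y \<ge> - \<epsilon>" "- y / \<epsilon> - 1 \<ge> 1 \<longleftrightarrow> y \<le> - 2 * \<epsilon>" using assms by (auto simp: field_simps)
  show "y \<ge> - \<epsilon> \<Longrightarrow> cutoff \<epsilon> y = 0" "y \<ge> - \<epsilon> \<Longrightarrow> cutoff' \<epsilon> y = 0"
    "y \<le> - 2 * \<epsilon> \<Longrightarrow> cutoff \<epsilon> y = 1" "y \<le> - 2 * \<epsilon> \<Longrightarrow> cutoff' \<epsilon> y = 0"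
    "0 \<le> cutoff \<epsilon> y" "cutoff \<epsilon> y \<le> 1" "cutoff' \<epsilon> y \<le> 0"
    unfolding cutoff_def cutoff'_def using 1 smooth_step_props[of "- y / \<epsilon> - 1"] assms by auto
qed

definition outer_prod :: "real^'n \<Rightarrow> real^'n \<Rightarrow> real^'n^'n" where
  "outer_prod v w = (\<chi> i j. v $ i * w $ j)"

lemma outer_prod_mult: "outer_prod v w *v h = (w \<bullet> h) *\<^sub>R v"
  by (simp add: outer_prod_def matrix_vector_mult_def vec_eq_iff inner_vec_def sum_distrib_left
      sum_distrib_right mult_ac)

lemma trace_mult_outer_prod: "trace (T ** outer_prod v w) = w \<bullet> (T *v v)"
  by (simp add: outer_prod_def trace_def matrix_matrix_mult_def matrix_vector_mult_def inner_vec_def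
      sum_distrib_left mult_ac)

lemma continuous_on_outer_prod [continuous_intros]:
  assumes "continuous_on S f" "continuous_on S g"
  shows "continuous_on S (\<lambda>x. outer_prod (f x) (g x))"
  unfolding outer_prod_def by (intro continuous_on_vec_lambda continuous_intros assms)

lemma has_derivative_scaled_field:
  fixes f :: "real^'n \<Rightarrow> real" and V :: "real^'n \<Rightarrow> real^'n"
  assumes "(f has_derivative (\<lambda>h. w \<bullet> h)) (at x)" "(V has_derivative (*v) B) (at x)"
  shows "((\<lambda>x. f x *\<^sub>R V x) has_derivative (*v) (outer_prod (V x) w + f x *\<^sub>R B)) (at x)"
proof -
  have "(*v) (outer_prod (V x) w + f x *\<^sub>R B) = (\<lambda>h. f x *\<^sub>R (B *v h) + (w \<bullet> h) *\<^sub>R V x)"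
    by (rule ext) (simp add: matrix_vector_mult_add_rdistrib outer_prod_mult
        scaleR_matrix_vector_assoc[symmetric])
  then show ?thesis using has_derivative_scaleR[OF assms] by simp
qed

text \<open>The functions \<open>g\<close> and \<open>A\<close> are the gradient and the Hessian of \<open>u\<close> inside the domain and their
  continuous extensions on its boundary.\<close>

locale c2_dirichlet =
  fixes \<Omega> :: "(real^'n) set" and u :: "real^'n \<Rightarrow> real" and g :: "real^'n \<Rightarrow> real^'n"
      and A :: "real^'n \<Rightarrow> real^'n^'n"
  assumes open_\<Omega>: "open \<Omega>" and bounded_\<Omega>: "bounded \<Omega>" and nonempty: "\<Omega> \<noteq> {}"
    and der_u: "\<And>x. x \<in> \<Omega> \<Longrightarrow> (u has_derivative (\<lambda>h. g x \<bullet> h)) (at x)"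
    and der_g: "\<And>x. x \<in> \<Omega> \<Longrightarrow> (g has_derivative (*v) (A x)) (at x)"
    and cont_u: "continuous_on (closure \<Omega>) u" and cont_g: "continuous_on (closure \<Omega>) g"
        and cont_A: "continuous_on (closure \<Omega>) A"
    and u_frontier: "\<And>x. x \<in> frontier \<Omega> \<Longrightarrow> u x = 0"
begin

lemma compact_closure: "compact (closure \<Omega>)" using bounded_\<Omega> by (simp add: compact_closure)

lemma closure_cases: "x \<in> closure \<Omega> \<Longrightarrow> x \<in> \<Omega> \<or> x \<in> frontier \<Omega>"
  using open_\<Omega> by (auto simp: frontier_def interior_open)

lemma symmetric_A: "x \<in> \<Omega> \<Longrightarrow> transpose (A x) = A x"
  by (rule hessian_symmetric[OF open_\<Omega> _ der_u der_g continuous_on_subset[OF cont_A closure_subset]])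

lemma symmetric_A_closure: "x \<in> closure \<Omega> \<Longrightarrow> transpose (A x) = A x"
proof -
  assume x: "x \<in> closure \<Omega>"
  have "continuous_on (closure \<Omega>) (\<lambda>x. transpose (A x) - A x)"
    unfolding transpose_def by (intro continuous_intros continuous_on_vec_lambda cont_A)
  from continuous_constant_on_closure[OF this _ x, of 0] symmetric_A show ?thesis by simp
qed

end

locale c2_negative = c2_dirichlet \<Omega> u g A
  for \<Omega> :: "(real^'n) set" and u g A +
  fixes c :: real
  assumes u_neg: "\<And>x. x \<in> \<Omega> \<Longrightarrow> u x < 0"
    and norm_g: "\<And>x. x \<in> frontier \<Omega> \<Longrightarrow> norm (g x) = c" and c_pos: "c > 0"
begin

text \<open>A bound on the boundary extends to a strip between the boundary and a level set of \<open>u\<close>: where it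
  fails, \<open>u\<close> is bounded away from \<open>0\<close> by compactness.\<close>

lemma near_frontier:
  assumes "continuous_on (closure \<Omega>) \<phi>" "\<And>x. x \<in> frontier \<Omega> \<Longrightarrow> \<phi> x < (\<delta> :: real)"
  obtains \<eta> where "\<eta> > 0" "\<And>x. x \<in> \<Omega> \<Longrightarrow> u x > - \<eta> \<Longrightarrow> \<phi> x < \<delta>"
proof -
  define S where "S = {x \<in> closure \<Omega>. \<phi> x \<ge> \<delta>}"
  have "closed S" unfolding S_def using continuous_closed_preimage[OF assms(1) closed_closure
      closed_atLeast[of \<delta>]]
    by (simp add: vimage_def Int_def)
  moreover have "S \<subseteq> closure \<Omega>" unfolding S_def by auto
  ultimately have cS: "compact S" using compact_closure by (metis closed_Int_compact inf.absorb_iff1)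
  have SO: "S \<subseteq> \<Omega>" unfolding S_def using closure_cases assms(2) by force
  show ?thesis
  proof (cases "S = {}")
    case True
    then have "\<phi> x < \<delta>" if "x \<in> \<Omega>" for x
      using that closure_subset[of \<Omega>] unfolding S_def by force
    then show ?thesis using that[of 1] by simp
  next
    case False
    obtain y where y: "y \<in> S" "\<And>x. x \<in> S \<Longrightarrow> u x \<le> u y"
      using continuous_attains_sup[OF cS False continuous_on_subset[OF cont_u]] unfolding S_def by blast
    show ?thesis
    proof (rule that[of "- u y"])
      show "- u y > 0" using u_neg y SO by force
      show "\<phi> x < \<delta>" if "x \<in> \<Omega>" "u x > - (- u y)" for x
        using that y(2)[of x] closure_subset[of \<Omega>] unfolding S_def by force
    qed
  qed
qed

lemma integrable_continuous_closure:
  fixes f :: "real^'n \<Rightarrow> real"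
  assumes "continuous_on (closure \<Omega>) f" shows "f integrable_on \<Omega>"
proof -
  have m: "\<Omega> \<in> lmeasurable" using open_\<Omega> bounded_\<Omega> by (simp add: lmeasurable_open)
  then have s: "\<Omega> \<in> sets lebesgue" by (rule fmeasurableD)
  obtain K where K: "\<And>x. x \<in> closure \<Omega> \<Longrightarrow> norm (f x) \<le> K"
    using compact_imp_bounded[OF compact_continuous_image[OF assms compact_closure]] unfolding bounded_iff
        by auto
  show ?thesis
  proof (rule measurable_bounded_by_integrable_imp_integrable[OF
      continuous_imp_measurable_on_sets_lebesgue[OF _ s] _ _ s])
    show "continuous_on \<Omega> f" using assms closure_subset by (rule continuous_on_subset)
    show "(\<lambda>x. K) integrable_on \<Omega>" using m by (rule integrable_on_const)
    show "norm (f x) \<le> K" if "x \<in> \<Omega>" for x using K that closure_subset by blast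
  qed
qed

text \<open>The cutoff vanishes outside the compact set \<open>{u \<le> - \<epsilon>} \<subseteq> \<Omega>\<close>, so extension by zero is \<open>C\<^sup>1\<close> on the
  whole space.\<close>

lemma cutoff_field:
  assumes \<epsilon>: "\<epsilon> > 0" and der: "\<And>x. x \<in> \<Omega> \<Longrightarrow> (\<psi> has_derivative (*v) (D x)) (at x)" and cD: "continuous_on \<Omega> D" 
  defines "\<Psi> \<equiv> \<lambda>x. if x \<in> \<Omega> then cutoff \<epsilon> (u x) *\<^sub>R \<psi> x else 0"
    and "\<Psi>' \<equiv> \<lambda>x. if x \<in> \<Omega> then cutoff' \<epsilon> (u x) *\<^sub>R outer_prod (\<psi> x) (g x) + cutoff \<epsilon> (u x) *\<^sub>R D x else 0"
  shows "(\<Psi> has_derivative (*v) (\<Psi>' x)) (at x)" and "continuous_on UNIV \<Psi>'"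
proof -
  define K where "K = {x \<in> closure \<Omega>. u x \<le> - \<epsilon>}"
  have cK: "closed K" unfolding K_def using continuous_closed_preimage[OF cont_u closed_closure
      closed_atMost[of "-\<epsilon>"]]
    by (simp add: vimage_def Int_def)
  have KO: "K \<subseteq> \<Omega>" unfolding K_def using closure_cases u_frontier \<epsilon> by force
  have z: "\<Psi> x = 0" "\<Psi>' x = 0" if "x \<in> - K" for x
    using that closure_subset[of \<Omega>] cutoff_props(1,2)[OF \<epsilon>, of "u x"] unfolding \<Psi>_def \<Psi>'_def K_def by auto
  show "(\<Psi> has_derivative (*v) (\<Psi>' x)) (at x)"
  proof (cases "x \<in> \<Omega>")
    case True
    have "((\<lambda>x. cutoff \<epsilon> (u x)) has_derivative (\<lambda>h. (cutoff' \<epsilon> (u x) *\<^sub>R g x) \<bullet> h)) (at x)"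
      using has_derivative_compose[OF der_u[OF True] DERIV_cutoff[unfolded has_field_derivative_def]] by simp
    from has_derivative_scaled_field[OF this der[OF True]]
    have "((\<lambda>x. cutoff \<epsilon> (u x) *\<^sub>R \<psi> x) has_derivative (*v) (\<Psi>' x)) (at x)"
      using True unfolding \<Psi>'_def by (simp add: outer_prod_def vec_eq_iff)
          (auto simp: outer_prod_def vec_eq_iff mult_ac elim!: back_subst[of "\<lambda>M. (_ has_derivative (*v) M) _"])
    then show ?thesis
      by (rule has_derivative_transform_within_open[OF _ open_\<Omega> True]) (simp add: \<Psi>_def)
  next
    case False
    then have x: "x \<in> - K" using KO by auto
    have "((\<lambda>x. 0) has_derivative (*v) (\<Psi>' x)) (at x)" unfolding z(2)[OF x] matrix_vector_mult_0 by simp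
    then show ?thesis
      by (rule has_derivative_transform_within_open[OF _ _ x]) (use cK z in \<open>auto simp: open_Compl\<close>)
  qed
  have "continuous_on \<Omega> (\<lambda>x. \<psi> x)"
    using der by (meson continuous_at_imp_continuous_on has_derivative_continuous)
  then have "continuous_on \<Omega> (\<lambda>x. cutoff' \<epsilon> (u x) *\<^sub>R outer_prod (\<psi> x) (g x) + cutoff \<epsilon> (u x) *\<^sub>R D x)"
    by (intro continuous_intros cD continuous_on_subset[OF cont_u closure_subset] continuous_on_subset[OF
        cont_g closure_subset])
  then have "continuous_on \<Omega> \<Psi>'" by (rule continuous_on_eq) (simp add: \<Psi>'_def)
  moreover have "continuous_on (- K) \<Psi>'" by (rule continuous_on_eq[of _ "\<lambda>x. 0"]) (use z in auto)
  ultimately have "continuous_on (\<Omega> \<union> - K) \<Psi>'" using open_\<Omega> cK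
      by (intro continuous_on_open_Un) (auto simp: open_Compl)
  then show "continuous_on UNIV \<Psi>'" by (rule continuous_on_subset) (use KO in auto)
qed

lemma cutoff_identity:
  assumes \<epsilon>: "\<epsilon> > 0" and der: "\<And>x. x \<in> \<Omega> \<Longrightarrow> (\<psi> has_derivative (*v) (D x)) (at x)"
      and cD: "continuous_on \<Omega> D" and j: "j \<le> CARD('n)"
  shows "integral \<Omega> (\<lambda>x. cutoff \<epsilon> (u x) * trace (newton_tensor j (A x) ** D x) + cutoff' \<epsilon> (u x)
      * (g x \<bullet> (newton_tensor j (A x) *v \<psi> x))) = 0"
proof -
  obtain a b where ab: "\<Omega> \<subseteq> cbox a b" using bounded_\<Omega> bounded_subset_cbox_symmetric by metis
  have e2: "\<epsilon> / 2 > 0" using \<epsilon> by simp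
  have cAO: "continuous_on \<Omega> A" using cont_A closure_subset by (rule continuous_on_subset)
  \<comment> \<open>With half the level the cutoff of the gradient equals \<open>1\<close> wherever the cutoff of \<open>\<psi>\<close> is active.\<close>
  define X where "X = (\<lambda>x. if x \<in> \<Omega> then cutoff (\<epsilon> / 2) (u x) *\<^sub>R g x else 0)"
  define X' where "X' = (\<lambda>x. if x \<in> \<Omega> then cutoff' (\<epsilon> / 2) (u x) *\<^sub>R outer_prod (g x) (g x)
      + cutoff (\<epsilon> / 2) (u x) *\<^sub>R A x else 0)"
  define Y where "Y = (\<lambda>x. if x \<in> \<Omega> then cutoff \<epsilon> (u x) *\<^sub>R \<psi> x else 0)"
  define Y' where "Y' = (\<lambda>x. if x \<in> \<Omega> then cutoff' \<epsilon> (u x) *\<^sub>R outer_prod (\<psi> x) (g x)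
      + cutoff \<epsilon> (u x) *\<^sub>R D x else 0)"
  have X: "(X has_derivative (*v) (X' x)) (at x)" "continuous_on UNIV X'" for x
    unfolding X_def X'_def using cutoff_field[OF e2 der_g cAO] by blast+
  have Y: "(Y has_derivative (*v) (Y' x)) (at x)" "continuous_on UNIV Y'" for x
    unfolding Y_def Y'_def using cutoff_field[OF \<epsilon> der cD] by blast+
  have XA: "x \<in> \<Omega> \<and> X' x = A x" if "Y' x \<noteq> 0" for x
  proof -
    have x: "x \<in> \<Omega>" using that unfolding Y'_def by (auto split: if_splits)
    have "\<not> u x \<ge> - \<epsilon>"
    proof
      assume "u x \<ge> - \<epsilon>"
      then have "Y' x = 0" using cutoff_props(1,2)[OF \<epsilon>, of "u x"] by (simp add: Y'_def)
      then show False using that by simp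
    qed
    then show ?thesis using x cutoff_props(3,4)[OF e2, of "u x"] unfolding X'_def by simp
  qed
  have "integral (cbox a b) (\<lambda>x. trace (newton_tensor j (X' x) ** Y' x)) = 0"
  proof (rule integral_newton_tensor_zero[OF X(1) Y(1) X(2) Y(2)])
    fix x assume "x \<notin> cbox a b"
    then have "x \<notin> \<Omega>" using ab by blast
    then show "X x = 0 \<and> X' x = 0" "Y x = 0 \<and> Y' x = 0" by (simp_all add: X_def X'_def Y_def Y'_def)
  next
    show "transpose (X' x) = X' x" if "Y' x \<noteq> 0" for x using XA[OF that] symmetric_A by simp
  qed (rule j)
  moreover have "trace (newton_tensor j (X' x) ** Y' x)
      = (if x \<in> \<Omega> then cutoff \<epsilon> (u x) * trace (newton_tensor j (A x) ** D x) + cutoff' \<epsilon> (u x)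
      * (g x \<bullet> (newton_tensor j (A x) *v \<psi> x)) else 0)" for x
  proof -
    have *: "trace (newton_tensor j (A x) ** Y' x)
        = (if x \<in> \<Omega> then cutoff \<epsilon> (u x) * trace (newton_tensor j (A x) ** D x) + cutoff' \<epsilon> (u x)
        * (g x \<bullet> (newton_tensor j (A x) *v \<psi> x)) else 0)"
      unfolding Y'_def by (simp add: matrix_mult_add_right matrix_mult_scaleR_right trace_add trace_scaleR
          trace_mult_outer_prod)
        (simp add: matrix_matrix_mult_def trace_def)
    have "trace (newton_tensor j (X' x) ** Y' x) = trace (newton_tensor j (A x) ** Y' x)"
      using XA[of x] by (cases "Y' x = 0") (auto simp: matrix_matrix_mult_def trace_def)
    with * show ?thesis by simp
  qed
  ultimately show ?thesis using ab by (simp add: integral_restrict_Int Int_absorb2)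
qed

text \<open>The derivative of the cutoff is of size \<open>1/\<epsilon>\<close> on a strip whose measure is not controlled. The cutoff
  identity for the gradient field itself bounds \<open>\<integral>-cutoff'(u) |\<nabla>u|\<^sup>2\<close> by \<open>\<integral>|\<Delta>u|\<close>, and \<open>|\<nabla>u|\<close> is bounded below near the boundary.\<close>

lemma cutoff'_bound:
  obtains \<eta> K where "\<eta> > 0" "K \<ge> 0" "\<And>\<epsilon>. 0 < \<epsilon> \<Longrightarrow> 2 * \<epsilon> < \<eta> \<Longrightarrow> integral \<Omega> (\<lambda>x. - cutoff' \<epsilon> (u x)) \<le> K"
proof -
  have "continuous_on (closure \<Omega>) (\<lambda>x. - norm (g x))" by (intro continuous_intros cont_g)
  then obtain \<eta> where \<eta>: "\<eta> > 0" "\<And>x. x \<in> \<Omega> \<Longrightarrow> u x > - \<eta> \<Longrightarrow> - norm (g x) < - (c / 2)"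
    using near_frontier[of "\<lambda>x. - norm (g x)" "- (c/2)"] norm_g c_pos by auto
  define K where "K = integral \<Omega> (\<lambda>x. \<bar>trace (A x)\<bar>)"
  have cA: "continuous_on (closure \<Omega>) (\<lambda>x. \<bar>trace (A x)\<bar>)" by (intro continuous_intros cont_A)
  have K0: "K \<ge> 0" unfolding K_def by (rule integral_nonneg[OF integrable_continuous_closure[OF cA]]) auto
  show ?thesis
  proof (rule that[of \<eta> "4 / c\<^sup>2 * K"])
    show "4 / c\<^sup>2 * K \<ge> 0" using K0 by simp
    fix \<epsilon> assume \<epsilon>: "0 < \<epsilon>" "2 * \<epsilon> < \<eta>"
    have cAO: "continuous_on \<Omega> A" using cont_A closure_subset by (rule continuous_on_subset)
    have i1: "(\<lambda>x. cutoff \<epsilon> (u x) * trace (A x)) integrable_on \<Omega>" "(\<lambda>x. cutoff' \<epsilon> (u x)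
        * (g x \<bullet> g x)) integrable_on \<Omega>" "(\<lambda>x. - cutoff' \<epsilon> (u x)) integrable_on \<Omega>"
      by (intro integrable_continuous_closure continuous_intros cont_u cont_g cont_A)+
    have "integral \<Omega> (\<lambda>x. cutoff \<epsilon> (u x) * trace (A x) + cutoff' \<epsilon> (u x) * (g x \<bullet> g x)) = 0"
    proof -
      \<comment> \<open>The tensor of order \<open>1\<close> is the identity, so the flux of the gradient field is \<open>|\<nabla>u|\<^sup>2\<close>.\<close>
      have "newton_tensor 1 (A x) = mat 1" for x by (simp add: sigma_0 matrix_mult_zero_right)
      then show ?thesis using cutoff_identity[OF \<epsilon>(1) der_g cAO, of 1] by (simp add: Suc_leI)
    qed
    then have "integral \<Omega> (\<lambda>x. cutoff \<epsilon> (u x) * trace (A x)) + integral \<Omega> (\<lambda>x. cutoff' \<epsilon> (u x)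
        * (g x \<bullet> g x)) = 0"
      using integral_add[OF i1(1,2)] by simp
    moreover have "integral \<Omega> (\<lambda>x. cutoff \<epsilon> (u x) * trace (A x)) \<le> K" unfolding K_def
    proof (rule integral_le[OF i1(1) integrable_continuous_closure[OF cA]])
      fix x
      have "cutoff \<epsilon> (u x) * trace (A x) \<le> cutoff \<epsilon> (u x) * \<bar>trace (A x)\<bar>" using cutoff_props[OF \<epsilon>(1)]
          by (intro mult_left_mono) auto
      also have "\<dots> \<le> 1 * \<bar>trace (A x)\<bar>" using cutoff_props[OF \<epsilon>(1)] by (intro mult_right_mono) auto
      finally show "cutoff \<epsilon> (u x) * trace (A x) \<le> \<bar>trace (A x)\<bar>" by simp
    qed
    ultimately have "- integral \<Omega> (\<lambda>x. cutoff' \<epsilon> (u x) * (g x \<bullet> g x)) \<le> K" by linarith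
    moreover have "integral \<Omega> (\<lambda>x. - cutoff' \<epsilon> (u x))
        \<le> integral \<Omega> (\<lambda>x. - (4 / c\<^sup>2) * (cutoff' \<epsilon> (u x) * (g x \<bullet> g x)))"
    proof (rule integral_le[OF i1(3) integrable_on_mult_right[OF i1(2)]])
      fix x assume x: "x \<in> \<Omega>"
      show "- cutoff' \<epsilon> (u x) \<le> - (4 / c\<^sup>2) * (cutoff' \<epsilon> (u x) * (g x \<bullet> g x))"
      proof (cases "u x \<le> - 2 * \<epsilon>")
        case True
        then show ?thesis using cutoff_props(4)[OF \<epsilon>(1)] by simp
      next
        case False
        then have "c / 2 \<le> norm (g x)" using \<eta>(2)[OF x] \<epsilon> by simp
        then have "(c / 2)\<^sup>2 \<le> (norm (g x))\<^sup>2" using c_pos by (intro power_mono) auto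
        then have "1 \<le> 4 / c\<^sup>2 * (g x \<bullet> g x)" using c_pos
            by (simp add: dot_square_norm field_simps power_divide)
        then have "- cutoff' \<epsilon> (u x) * 1 \<le> - cutoff' \<epsilon> (u x) * (4 / c\<^sup>2 * (g x \<bullet> g x))"
          using cutoff_props(7)[OF \<epsilon>(1)] by (intro mult_left_mono) auto
        then show ?thesis by (simp add: mult_ac)
      qed
    qed
    ultimately show "integral \<Omega> (\<lambda>x. - cutoff' \<epsilon> (u x)) \<le> 4 / c\<^sup>2 * K"
    proof -
      assume 1: "- integral \<Omega> (\<lambda>x. cutoff' \<epsilon> (u x) * (g x \<bullet> g x)) \<le> K"
        and 2: "integral \<Omega> (\<lambda>x. - cutoff' \<epsilon> (u x))
            \<le> integral \<Omega> (\<lambda>x. - (4 / c\<^sup>2) * (cutoff' \<epsilon> (u x) * (g x \<bullet> g x)))"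
      have "4 / c\<^sup>2 * - integral \<Omega> (\<lambda>x. cutoff' \<epsilon> (u x) * (g x \<bullet> g x)) \<le> 4 / c\<^sup>2 * K"
        using 1 by (rule mult_left_mono) simp
      then show ?thesis using 2 by (simp only: integral_mult_right)
    qed
  qed (rule \<eta>)
qed

text \<open>In the cutoff identity the first term converges to the desired integral. The second one is bounded by
  the supremum of the flux over a shrinking boundary strip times the uniformly bounded total mass of the
  derivative of the cutoff.\<close>

lemma weakly_divergence_free:
  assumes der: "\<And>x. x \<in> \<Omega> \<Longrightarrow> (\<psi> has_derivative (*v) (D x)) (at x)"
    and c\<psi>: "continuous_on (closure \<Omega>) \<psi>" and cD: "continuous_on (closure \<Omega>) D" and j: "j \<le> CARD('n)"
    and bdry: "\<And>x. x \<in> frontier \<Omega> \<Longrightarrow> g x \<bullet> (newton_tensor j (A x) *v \<psi> x) = 0"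
  shows "integral \<Omega> (\<lambda>x. trace (newton_tensor j (A x) ** D x)) = 0"
proof -
  define a where "a x = trace (newton_tensor j (A x) ** D x)" for x
  define b where "b x = g x \<bullet> (newton_tensor j (A x) *v \<psi> x)" for x
  have ca: "continuous_on (closure \<Omega>) a" unfolding a_def by (intro continuous_intros cont_A cD)
  have cb: "continuous_on (closure \<Omega>) b" unfolding b_def by (intro continuous_intros cont_A c\<psi> cont_g)
  define e where "e n = 1 / real (Suc n)" for n
  have e: "e n > 0" for n unfolding e_def by simp
  have e0: "e \<longlonglongrightarrow> 0" unfolding e_def using LIMSEQ_Suc[OF lim_1_over_n] by simp
  have ia: "(\<lambda>x. cutoff \<epsilon> (u x) * a x) integrable_on \<Omega>" for \<epsilon>
    by (intro integrable_continuous_closure continuous_intros ca cont_u)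
  have ib: "(\<lambda>x. cutoff' \<epsilon> (u x) * b x) integrable_on \<Omega>" for \<epsilon>
    by (intro integrable_continuous_closure continuous_intros cb cont_u)
  have id: "integral \<Omega> (\<lambda>x. cutoff \<epsilon> (u x) * a x) = - integral \<Omega> (\<lambda>x. cutoff' \<epsilon> (u x) * b x)" if "\<epsilon> > 0" for \<epsilon>
    using cutoff_identity[OF that der continuous_on_subset[OF cD closure_subset] j] integral_add[OF ia ib,
        of \<epsilon> \<epsilon>]
    unfolding a_def b_def by simp
  have lim1: "(\<lambda>n. integral \<Omega> (\<lambda>x. cutoff (e n) (u x) * a x)) \<longlonglongrightarrow> integral \<Omega> a"
  proof (rule dominated_convergence(2)[where h = "\<lambda>x. \<bar>a x\<bar>"])
    show "(\<lambda>x. \<bar>a x\<bar>) integrable_on \<Omega>" by (intro integrable_continuous_closure continuous_intros ca)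
    show "norm (cutoff (e n) (u x) * a x) \<le> \<bar>a x\<bar>" for n x
      using cutoff_props(5,6)[OF e, of n "u x"] by (simp add: abs_mult mult_left_le_one_le)
    show "(\<lambda>n. cutoff (e n) (u x) * a x) \<longlonglongrightarrow> a x" if x: "x \<in> \<Omega>" for x
    proof (rule tendsto_eventually)
      have "\<forall>\<^sub>F n in sequentially. e n < - u x / 2" using order_tendstoD(2)[OF e0] u_neg[OF x] by simp
      then show "\<forall>\<^sub>F n in sequentially. cutoff (e n) (u x) * a x = a x"
        by eventually_elim (use cutoff_props(3)[OF e] in auto)
    qed
  qed (rule ia)
  obtain \<eta> K where \<eta>: "\<eta> > 0" "K \<ge> 0" "\<And>\<epsilon>. 0 < \<epsilon> \<Longrightarrow> 2 * \<epsilon> < \<eta> \<Longrightarrow> integral \<Omega> (\<lambda>x. - cutoff' \<epsilon> (u x)) \<le> K"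
    using cutoff'_bound by blast
  have lim2: "(\<lambda>n. integral \<Omega> (\<lambda>x. cutoff (e n) (u x) * a x)) \<longlonglongrightarrow> 0"
  proof (rule LIMSEQ_I)
    fix r :: real assume r: "r > 0"
    define \<delta> where "\<delta> = r / (K + 1)"
    have \<delta>: "\<delta> > 0" unfolding \<delta>_def using r \<eta>(2) by simp
    have "continuous_on (closure \<Omega>) (\<lambda>x. \<bar>b x\<bar>)" by (intro continuous_intros cb)
    then obtain \<eta>' where \<eta>': "\<eta>' > 0" "\<And>x. x \<in> \<Omega> \<Longrightarrow> u x > - \<eta>' \<Longrightarrow> \<bar>b x\<bar> < \<delta>"
      using near_frontier[of "\<lambda>x. \<bar>b x\<bar>" \<delta>] bdry \<delta> unfolding b_def by auto
    have "\<forall>\<^sub>F n in sequentially. e n < min \<eta> \<eta>' / 2" by (rule order_tendstoD(2)[OF e0]) (use \<eta>' \<eta> in simp)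
    then obtain n0 where n0: "\<And>n. n \<ge> n0 \<Longrightarrow> e n < min \<eta> \<eta>' / 2" unfolding eventually_sequentially by blast
    have "norm (integral \<Omega> (\<lambda>x. cutoff (e n) (u x) * a x) - 0) < r" if n: "n \<ge> n0" for n
    proof -
      have en: "2 * e n < \<eta>" "2 * e n < \<eta>'" using n0[OF n] by auto
      have ic: "(\<lambda>x. - cutoff' (e n) (u x)) integrable_on \<Omega>"
        by (intro integrable_continuous_closure continuous_intros cont_u)
      have "norm (integral \<Omega> (\<lambda>x. cutoff' (e n) (u x) * b x)) \<le> integral \<Omega> (\<lambda>x. \<delta> * - cutoff' (e n) (u x))"
      proof (rule integral_norm_bound_integral[OF ib integrable_on_mult_right[OF ic]])
        fix x assume x: "x \<in> \<Omega>"
        show "norm (cutoff' (e n) (u x) * b x) \<le> \<delta> * - cutoff' (e n) (u x)"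
        proof (cases "u x \<le> - 2 * e n")
          case True
          then show ?thesis using cutoff_props(4)[OF e] by simp
        next
          case False
          then have "\<bar>b x\<bar> \<le> \<delta>" using \<eta>'(2)[OF x] en by simp
          then have "\<bar>b x\<bar> * - cutoff' (e n) (u x) \<le> \<delta> * - cutoff' (e n) (u x)"
            using cutoff_props(7)[OF e, of n "u x"] by (intro mult_right_mono) auto
          then show ?thesis using cutoff_props(7)[OF e, of n "u x"]
            by (simp add: abs_mult abs_of_nonpos mult.commute)
        qed
      qed
      also have "\<dots> = \<delta> * integral \<Omega> (\<lambda>x. - cutoff' (e n) (u x))" by (rule integral_mult_right)
      also have "\<dots> \<le> \<delta> * K" using \<eta>(3)[OF e en(1)] \<delta> by (intro mult_left_mono) auto
      also have "\<dots> < \<delta> * (K + 1)" using \<delta> by simp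
      also have "\<dots> = r" unfolding \<delta>_def using \<eta>(2) by simp
      finally show ?thesis using id[OF e[of n]] by simp
    qed
    then show "\<exists>no. \<forall>n\<ge>no. norm (integral \<Omega> (\<lambda>x. cutoff (e n) (u x) * a x) - 0) < r" by blast
  qed
  show ?thesis using LIMSEQ_unique[OF lim1 lim2] unfolding a_def .
qed

end

section \<open>Integral identities and rigidity\<close>

lemma trace_square_zero_symmetric:
  fixes B :: "real^'n^'n"
  assumes "transpose B = B" "trace (B ** B) = 0"
  shows "B = 0"
proof -
  have "trace (B ** B) = (\<Sum>i\<in>UNIV. \<Sum>j\<in>UNIV. (B $ i $ j)\<^sup>2)"
    by (simp add: trace_def matrix_matrix_mult_def power2_eq_square symmetric_entries[OF assms(1)])
  then have "(\<Sum>i\<in>UNIV. \<Sum>j\<in>UNIV. (B $ i $ j)\<^sup>2) = 0" using assms(2) by simp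
  then have "\<And>i j. (B $ i $ j)\<^sup>2 = 0"
    by (simp add: sum_nonneg_eq_0_iff sum_nonneg)
  then show ?thesis by (simp add: vec_eq_iff)
qed

lemma trace_eq_sigma_1:
  fixes B :: "real^'n^'n"
  assumes "transpose B = B"
  shows "trace B = sigma 1 B"
  using trace_newton_tensor_mult[OF assms, of 1] by (simp add: sigma_0 matrix_mult_zero_right)

lemma trace_square:
  fixes B :: "real^'n^'n"
  assumes "transpose B = B"
  shows "trace (B ** B) = (sigma 1 B)\<^sup>2 - 2 * sigma 2 B"
proof -
  have "newton_tensor 2 B = sigma 1 B *\<^sub>R mat 1 - B"
      by (simp add: numeral_2_eq_2 sigma_0 matrix_mult_zero_right)
  then have "trace ((sigma 1 B *\<^sub>R mat 1 - B) ** B) = 2 * sigma 2 B"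
    using trace_newton_tensor_mult[OF assms, of 2] by simp
  then show ?thesis
    by (simp add: matrix_mult_diff_left matrix_mult_scaleR_left trace_sub trace_scaleR trace_eq_sigma_1[OF
        assms] power2_eq_square)
qed

lemma binomial_absorb_real:
  "real (k + 1) * real (n choose (k + 1)) = (real n - real k) * real (n choose k)"
proof (cases "k \<le> n")
  case True
  have "(k + 1) * (n choose (k + 1)) = (n - k) * (n choose k)"
    using binomial_absorb_comp[of n k] binomial_absorption[of k n] by (simp add: mult.commute)
  then show ?thesis using True by (metis of_nat_diff of_nat_mult)
qed (simp add: binomial_eq_0)

lemma maclaurin_sigma:
  fixes B :: "real^'n^'n"
  assumes sB: "transpose B = B" and k: "1 \<le> k" "k \<le> CARD('n)"
    and pos: "\<And>j. j \<le> k \<Longrightarrow> sigma j B > 0" and Ck: "sigma k B = real (CARD('n) choose k)"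
  shows "j \<le> k \<Longrightarrow> sigma j B \<ge> real (CARD('n) choose j)"
    and "sigma (k + 1) B \<le> real (CARD('n) choose (k + 1))"
proof -
  obtain e l where "eigenbasis B e l" using eigenbasis_exists[OF sB] .
  then interpret eigenbasis B e l .
  show "j \<le> k \<Longrightarrow> sigma j B \<ge> real (CARD('n) choose j)" "sigma (k + 1) B \<le> real (CARD('n) choose (k + 1))"
    using maclaurin_esym(1)[of UNIV k l j] maclaurin_esym(2)[of UNIV k l] k pos Ck unfolding sigma_eq by auto
qed

text \<open>The bound \<open>S\<^sub>2 \<ge> (N choose 2)\<close> is Maclaurin's inequality if \<open>k \<ge> 2\<close> and the assumption on the order
  \<open>k + 1\<close> if \<open>k = 1\<close>. Together with \<open>S\<^sub>1 = N\<close> it gives \<open>trace((B - I)\<^sup>2) = S\<^sub>1\<^sup>2 - 2 S\<^sub>2 - 2 S\<^sub>1 + N \<le> 0\<close>.\<close>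

lemma identity_matrix_if_extremal:
  fixes B :: "real^'n^'n"
  assumes sB: "transpose B = B" and k: "1 \<le> k" "k \<le> CARD('n)"
    and pos: "\<And>j. j \<le> k \<Longrightarrow> sigma j B > 0" and Ck: "sigma k B = real (CARD('n) choose k)"
    and s1: "sigma 1 B = CARD('n)" and sk: "sigma (k + 1) B = real (CARD('n) choose (k + 1))"
  shows "B = mat 1"
proof -
  have s2: "sigma 2 B \<ge> real (CARD('n) choose 2)"
  proof (cases "k = 1")
    case True
    then show ?thesis using sk by (simp add: numeral_2_eq_2)
  next
    case False
    then show ?thesis using maclaurin_sigma(1)[OF sB k pos Ck, of 2] k by simp
  qed
  have n2: "2 * real (CARD('n) choose 2) = (real CARD('n) - 1) * real CARD('n)"
    using binomial_absorb_real[of 1 "CARD('n)"] by (simp add: numeral_2_eq_2)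
  define D where "D = B - mat 1"
  have sD: "transpose D = D" unfolding D_def using symmetric_entries[OF sB]
      by (simp add: transpose_def vec_eq_iff mat_def)
  have "trace (D ** D) = trace (B ** B) - 2 * trace B + CARD('n)"
  proof -
    have "D ** D = (B ** B - B) - (B - mat 1)"
      unfolding D_def by (simp only: matrix_mult_diff_left matrix_mult_diff_right matrix_mul_lid matrix_mul_rid)
    then show ?thesis by (simp only: trace_sub trace_I)
  qed
  also have "\<dots> \<le> 0" unfolding trace_square[OF sB] trace_eq_sigma_1[OF sB] s1
    using s2 n2 by (simp add: power2_eq_square algebra_simps)
  finally have "trace (D ** D) \<le> 0" .
  moreover have "trace (D ** D) \<ge> 0"
    by (simp add: trace_def matrix_matrix_mult_def symmetric_entries[OF sD] sum_nonneg)
  ultimately have "D = 0" using trace_square_zero_symmetric[OF sD] by simp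
  then show ?thesis unfolding D_def by simp
qed

text \<open>The normalized situation: the right-hand side is \<open>N choose k\<close>, and the Hessian takes values in
  the cone \<open>S\<^sub>1 > 0, \<dots>, S\<^sub>k > 0\<close>. The assumption \<open>tangential\<close> says that the
  tangential derivative of \<open>|\<nabla>u|\<^sup>2\<close> along the boundary is zero.\<close>

locale overdetermined = c2_negative \<Omega> u g A c
  for \<Omega> :: "(real^'n) set" and u g A c +
  fixes k :: nat
  assumes k: "1 \<le> k" "k \<le> CARD('n)"
    and tangential: "\<And>x. x \<in> frontier \<Omega> \<Longrightarrow> \<exists>\<mu>. A x *v g x = \<mu> *\<^sub>R g x"
    and sigma_k: "\<And>x. x \<in> \<Omega> \<Longrightarrow> sigma k (A x) = real (CARD('n) choose k)"
    and sigma_pos: "\<And>x j. x \<in> \<Omega> \<Longrightarrow> j \<le> k \<Longrightarrow> sigma j (A x) > 0"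
begin

definition C where "C = real (CARD('n) choose k)"

lemma C_pos: "C > 0" unfolding C_def using k by simp

lemma newton_tensor_frontier:
  assumes "x \<in> frontier \<Omega>" shows "\<exists>\<mu>. newton_tensor j (A x) *v g x = \<mu> *\<^sub>R g x"
proof (induction j)
  case 0
  then show ?case by (intro exI[of _ 0]) simp
next
  case (Suc j)
  then obtain \<mu> where \<mu>: "newton_tensor j (A x) *v g x = \<mu> *\<^sub>R g x" by blast
  obtain \<tau> where \<tau>: "A x *v g x = \<tau> *\<^sub>R g x" using tangential[OF assms] by blast
  have "newton_tensor (Suc j) (A x) *v g x = (sigma j (A x) - \<mu> * \<tau>) *\<^sub>R g x"
    by (simp add: matrix_vector_mult_diff_rdistrib scaleR_matrix_vector_assoc[symmetric]
        matrix_vector_mul_assoc[symmetric]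
        \<mu> \<tau> matrix_vector_mult_scaleR scaleR_diff_left)
  then show ?case by blast
qed

text \<open>At the order \<open>N + 1\<close> the tensor itself is zero. Including this order lets the tensor of order
  \<open>k + 1\<close> be treated alike for \<open>k < N\<close> and \<open>k = N\<close>.\<close>

lemma weakly_divergence_free':
  assumes der: "\<And>x. x \<in> \<Omega> \<Longrightarrow> (\<psi> has_derivative (*v) (D x)) (at x)"
    and c\<psi>: "continuous_on (closure \<Omega>) \<psi>" and cD: "continuous_on (closure \<Omega>) D" and j: "j \<le> CARD('n) + 1"
    and bdry: "\<And>x. x \<in> frontier \<Omega> \<Longrightarrow> g x \<bullet> (newton_tensor j (A x) *v \<psi> x) = 0"
  shows "integral \<Omega> (\<lambda>x. trace (newton_tensor j (A x) ** D x)) = 0"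
proof (cases "j \<le> CARD('n)")
  case True
  then show ?thesis using weakly_divergence_free[OF der c\<psi> cD True bdry] by blast
next
  case False
  then have j: "j = Suc CARD('n)" using j by simp
  have "trace (newton_tensor j (A x) ** D x) = 0" if x: "x \<in> \<Omega>" for x
  proof -
    obtain e l where "eigenbasis (A x) e l" using eigenbasis_exists[OF symmetric_A[OF x]] .
    then show ?thesis using eigenbasis.newton_tensor_top[of "A x" e l] unfolding j
      by (simp add: matrix_matrix_mult_def trace_def del: newton_tensor.simps)
  qed
  then have "integral \<Omega> (\<lambda>x. trace (newton_tensor j (A x) ** D x)) = integral \<Omega> (\<lambda>x. 0)"
    by (rule integral_cong)
  then show ?thesis by simp
qed

lemmas int = integrable_continuous_closure
lemmas cts = continuous_intros cont_u cont_g cont_A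

lemma trace_T:
  assumes "x \<in> \<Omega>" "1 \<le> j" "j \<le> CARD('n) + 1"
  shows "trace (newton_tensor j (A x)) = (real CARD('n) - real j + 1) * sigma (j - 1) (A x)"
proof -
  obtain m where m: "j = Suc m" using assms by (cases j) auto
  obtain e l where "eigenbasis (A x) e l" using eigenbasis_exists[OF symmetric_A[OF assms(1)]] .
  then show ?thesis using eigenbasis.trace_newton_tensor[of "A x" e l m] m by simp
qed

text \<open>Test field \<open>u \<nabla>u\<close>, which vanishes on the boundary.\<close>

lemma energy_identity:
  assumes j: "j \<le> CARD('n) + 1"
  shows "integral \<Omega> (\<lambda>x. g x \<bullet> (newton_tensor j (A x) *v g x))
      = - real j * integral \<Omega> (\<lambda>x. u x * sigma j (A x))"
proof -
  have "integral \<Omega> (\<lambda>x. trace (newton_tensor j (A x) ** (outer_prod (g x) (g x) + u x *\<^sub>R A x))) = 0"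
  proof (rule weakly_divergence_free'[OF has_derivative_scaled_field[OF der_u der_g] _ _ j])
    show "continuous_on (closure \<Omega>) (\<lambda>x. u x *\<^sub>R g x)" "continuous_on (closure \<Omega>) (\<lambda>x. outer_prod (g x)
        (g x) + u x *\<^sub>R A x)"
      by (intro cts)+
  qed (auto simp: u_frontier)
  moreover have "integral \<Omega> (\<lambda>x. trace (newton_tensor j (A x) ** (outer_prod (g x) (g x) + u x *\<^sub>R A x)))
    = integral \<Omega> (\<lambda>x. g x \<bullet> (newton_tensor j (A x) *v g x) + real j * (u x * sigma j (A x)))"
    by (rule integral_cong)
      (simp add: matrix_mult_add_right trace_add trace_mult_outer_prod matrix_mult_scaleR_right
          trace_scaleR trace_newton_tensor_mult[OF symmetric_A])
  moreover have "\<dots> = integral \<Omega> (\<lambda>x. g x \<bullet> (newton_tensor j (A x) *v g x)) + real j * integral \<Omega> (\<lambda>x. u x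
      * sigma j (A x))"
    by (subst integral_add) (auto intro!: int cts integrable_on_mult_right)
  ultimately show ?thesis by simp
qed

text \<open>Test field \<open>u x\<close>, which vanishes on the boundary.\<close>

lemma position_identity:
  assumes j: "1 \<le> j" "j \<le> CARD('n) + 1"
  shows "integral \<Omega> (\<lambda>x. g x \<bullet> (newton_tensor j (A x) *v x))
    = - (real CARD('n) - real j + 1) * integral \<Omega> (\<lambda>x. u x * sigma (j - 1) (A x))"
proof -
  have id: "((\<lambda>x. x) has_derivative (*v) (mat 1)) (at x)" for x :: "real^'n"
  proof -
    have "(*v) (mat 1) = (\<lambda>h::real^'n. h)" by (rule ext) simp
    then show ?thesis by (simp only: has_derivative_ident)
  qed
  have "integral \<Omega> (\<lambda>x. trace (newton_tensor j (A x) ** (outer_prod x (g x) + u x *\<^sub>R mat 1))) = 0"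
  proof (rule weakly_divergence_free'[OF has_derivative_scaled_field[OF der_u id] _ _ j(2)])
    show "continuous_on (closure \<Omega>) (\<lambda>x. u x *\<^sub>R x)" "continuous_on (closure \<Omega>) (\<lambda>x. outer_prod x (g x)
        + u x *\<^sub>R mat 1)"
      by (intro cts)+
  qed (auto simp: u_frontier)
  moreover have "integral \<Omega> (\<lambda>x. trace (newton_tensor j (A x) ** (outer_prod x (g x) + u x *\<^sub>R mat 1)))
    = integral \<Omega> (\<lambda>x. g x \<bullet> (newton_tensor j (A x) *v x) + (real CARD('n) - real j + 1) * (u x * sigma (j
        - 1) (A x)))"
    by (rule integral_cong)
      (simp add: matrix_mult_add_right trace_add trace_mult_outer_prod matrix_mult_scaleR_right
          trace_scaleR trace_T[OF _ j])
  moreover have "\<dots> = integral \<Omega> (\<lambda>x. g x \<bullet> (newton_tensor j (A x) *v x)) + (real CARD('n) - real j + 1)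
      * integral \<Omega> (\<lambda>x. u x * sigma (j - 1) (A x))"
    by (subst integral_add) (auto intro!: int cts integrable_on_mult_right)
  ultimately show ?thesis by (simp add: algebra_simps)
qed

abbreviation "T \<equiv> \<lambda>x. newton_tensor k (A x)"
abbreviation "T1 \<equiv> \<lambda>x. newton_tensor (Suc k) (A x)"

lemma A_T: "x \<in> \<Omega> \<Longrightarrow> (A x *v v) \<bullet> (T x *v w) = C * (v \<bullet> w) - v \<bullet> (T1 x *v w)"
proof -
  assume x: "x \<in> \<Omega>"
  have "(A x *v v) \<bullet> (T x *v w) = v \<bullet> ((A x ** T x) *v w)"
    unfolding symmetric_matrix_inner[OF symmetric_A[OF x]] by (simp add: matrix_vector_mul_assoc)
  also have "A x ** T x = C *\<^sub>R mat 1 - T1 x" using sigma_k[OF x] unfolding C_def by simp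
  finally show ?thesis by (simp add: matrix_vector_mult_diff_rdistrib
      scaleR_matrix_vector_assoc[symmetric] inner_diff_right)
qed

lemma T_sym: "x \<in> closure \<Omega> \<Longrightarrow> v \<bullet> (newton_tensor j (A x) *v w) = w \<bullet> (newton_tensor j (A x) *v v)"
  using symmetric_matrix_inner[OF transpose_newton_tensor[OF symmetric_A_closure], of x j v w]
      by (simp add: inner_commute)

lemma int_u_const: "integral \<Omega> (\<lambda>x. u x * sigma k (A x)) = C * integral \<Omega> u"
proof -
  have "integral \<Omega> (\<lambda>x. u x * sigma k (A x)) = integral \<Omega> (\<lambda>x. C * u x)"
    by (rule integral_cong) (simp add: sigma_k C_def)
  then show ?thesis by simp
qed

definition P where "P x = g x \<bullet> g x - 2 * u x - c\<^sup>2"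

text \<open>Test field \<open>P \<nabla>u\<close> with the tensor \<open>T\<^sub>k\<close>. The product \<open>T\<^sub>k D\<^sup>2u = S\<^sub>k I - T\<^sub>k\<^sub>+\<^sub>1\<close> turns the term with
  \<open>\<nabla>P = 2 D\<^sup>2u \<nabla>u - 2 \<nabla>u\<close> into energies of the tensors of orders \<open>1\<close>, \<open>k\<close> and \<open>k + 1\<close>.\<close>

lemma P_identity:
  "real k * C * integral \<Omega> P = 2 * integral \<Omega> (\<lambda>x. u x * (C * sigma 1 (A x) - real (k + 1) * sigma (k
      + 1) (A x) - real k * C))"
proof -
  have dP: "(P has_derivative (\<lambda>h. (2 *\<^sub>R (A x *v g x) - 2 *\<^sub>R g x) \<bullet> h)) (at x)" if x: "x \<in> \<Omega>" for x
  proof -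
    have "((\<lambda>x. g x \<bullet> g x - 2 * u x - c\<^sup>2) has_derivative (\<lambda>h. g x \<bullet> (A x *v h) + (A x *v h) \<bullet> g x - 2
        * (g x \<bullet> h))) (at x)"
      by (auto intro!: derivative_eq_intros der_u[OF x] der_g[OF x])
    moreover have "(A x *v h) \<bullet> g x = (A x *v g x) \<bullet> h" for h
      using symmetric_matrix_inner[OF symmetric_A[OF x], of h "g x"] by (simp add: inner_commute)
    ultimately show ?thesis unfolding P_def[abs_def]
        by (simp add: inner_diff_left inner_diff_right inner_commute)
  qed
  have cP: "continuous_on (closure \<Omega>) P" unfolding P_def[abs_def] by (intro cts)
  have "integral \<Omega> (\<lambda>x. trace (T x ** (outer_prod (g x) (2 *\<^sub>R (A x *v g x) - 2 *\<^sub>R g x) + P x *\<^sub>R A x))) = 0"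
  proof (rule weakly_divergence_free'[OF has_derivative_scaled_field[OF dP der_g]])
    show "continuous_on (closure \<Omega>) (\<lambda>x. P x *\<^sub>R g x)"
      "continuous_on (closure \<Omega>) (\<lambda>x. outer_prod (g x) (2 *\<^sub>R (A x *v g x) - 2 *\<^sub>R g x) + P x *\<^sub>R A x)"
      by (intro cts cP)+
    show "g x \<bullet> (T x *v (P x *\<^sub>R g x)) = 0" if "x \<in> frontier \<Omega>" for x
      using norm_g[OF that] u_frontier[OF that] by (simp add: P_def dot_square_norm)
  qed (use k in auto)
  moreover have "integral \<Omega> (\<lambda>x. trace (T x ** (outer_prod (g x) (2 *\<^sub>R (A x *v g x) - 2 *\<^sub>R g x)
      + P x *\<^sub>R A x)))
    = integral \<Omega> (\<lambda>x. (real k * C) * P x + (2 * C * (g x \<bullet> (newton_tensor 1 (A x) *v g x)) - 2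
        * (g x \<bullet> (T1 x *v g x)) - 2 * (g x \<bullet> (T x *v g x))))"
  proof (rule integral_cong)
    fix x assume x: "x \<in> \<Omega>"
    show "trace (T x ** (outer_prod (g x) (2 *\<^sub>R (A x *v g x) - 2 *\<^sub>R g x) + P x *\<^sub>R A x))
      = (real k * C) * P x + (2 * C * (g x \<bullet> (newton_tensor 1 (A x) *v g x)) - 2 * (g x \<bullet> (T1 x *v g x))
          - 2 * (g x \<bullet> (T x *v g x)))"
      using A_T[OF x, of "g x" "g x"] trace_newton_tensor_mult[OF symmetric_A[OF x], of k] sigma_k[OF x]
      by (simp add: matrix_mult_add_right trace_add trace_mult_outer_prod matrix_mult_scaleR_right
          trace_scaleR inner_diff_left sigma_0 matrix_mult_zero_right C_def mult_ac del:
          newton_tensor.simps(2)[of k])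
  qed
  moreover have "\<dots> = (real k * C) * integral \<Omega> P + (2 * C
      * integral \<Omega> (\<lambda>x. g x \<bullet> (newton_tensor 1 (A x) *v g x)) - 2 * integral \<Omega> (\<lambda>x. g x \<bullet> (T1 x *v g x))
      - 2 * integral \<Omega> (\<lambda>x. g x \<bullet> (T x *v g x)))"
    by (subst integral_add integral_diff integral_mult_right | intro int cts cP)+ (rule refl)
  ultimately have 1: "(real k * C) * integral \<Omega> P
      = - 2 * C * integral \<Omega> (\<lambda>x. g x \<bullet> (newton_tensor 1 (A x) *v g x)) + 2
      * integral \<Omega> (\<lambda>x. g x \<bullet> (T1 x *v g x)) + 2 * integral \<Omega> (\<lambda>x. g x \<bullet> (T x *v g x))"
    by linarith
  have 2: "integral \<Omega> (\<lambda>x. u x * (C * sigma 1 (A x) - real (k + 1) * sigma (k + 1) (A x) - real k * C))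
     = C * integral \<Omega> (\<lambda>x. u x * sigma 1 (A x)) - real (k + 1) * integral \<Omega> (\<lambda>x. u x * sigma (k
         + 1) (A x)) - real k * C * integral \<Omega> u"
  proof -
    have "integral \<Omega> (\<lambda>x. u x * (C * sigma 1 (A x) - real (k + 1) * sigma (k + 1) (A x) - real k * C))
      = integral \<Omega> (\<lambda>x. C * (u x * sigma 1 (A x)) - real (k + 1) * (u x * sigma (k + 1) (A x)) - (real k
          * C) * u x)"
      by (rule integral_cong) (simp add: algebra_simps)
    also have "\<dots> = C * integral \<Omega> (\<lambda>x. u x * sigma 1 (A x)) - real (k + 1) * integral \<Omega> (\<lambda>x. u x
        * sigma (k + 1) (A x)) - (real k * C) * integral \<Omega> u"
      by (subst integral_diff integral_mult_right | intro int cts)+ (rule refl)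
    finally show ?thesis .
  qed
  have e: "integral \<Omega> (\<lambda>x. g x \<bullet> (newton_tensor 1 (A x) *v g x)) = - integral \<Omega> (\<lambda>x. u x * sigma 1 (A x))"
    "integral \<Omega> (\<lambda>x. g x \<bullet> (T1 x *v g x)) = - real (k + 1) * integral \<Omega> (\<lambda>x. u x * sigma (k + 1) (A x))"
    "integral \<Omega> (\<lambda>x. g x \<bullet> (T x *v g x)) = - real k * (C * integral \<Omega> u)"
    using energy_identity[of 1] energy_identity[of "Suc k"] energy_identity[of k] k unfolding int_u_const
        by simp_all
  show ?thesis using 1 unfolding 2 e by (simp add: algebra_simps)
qed

text \<open>Test field \<open>(x \<bullet> \<nabla>u) \<nabla>u - c\<^sup>2 x\<close>. On the boundary it is \<open>- c\<^sup>2\<close> times the tangential part of \<open>x\<close>; as \<open>\<nabla>u\<close> is an eigenvector of \<open>T\<^sub>k\<close> there, the flux vanishes.\<close>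

lemma pohozaev_identity:
  "c\<^sup>2 * integral \<Omega> (\<lambda>x. trace (T x)) = - (real k * C * (real CARD('n) + 2)) * integral \<Omega> u"
proof -
  have dq: "((\<lambda>x. x \<bullet> g x) has_derivative (\<lambda>h. (g x + A x *v x) \<bullet> h)) (at x)" if x: "x \<in> \<Omega>" for x
  proof -
    have "((\<lambda>x. x \<bullet> g x) has_derivative (\<lambda>h. x \<bullet> (A x *v h) + h \<bullet> g x)) (at x)"
      by (auto intro!: derivative_eq_intros der_g[OF x])
    moreover have "x \<bullet> (A x *v h) = (A x *v x) \<bullet> h" for h
      using symmetric_matrix_inner[OF symmetric_A[OF x], of x h] by simp
    ultimately show ?thesis by (simp add: inner_add_left inner_add_right inner_commute add.commute)
  qed
  define D where "D x = (outer_prod (g x) (g x + A x *v x) + (x \<bullet> g x) *\<^sub>R A x) - c\<^sup>2 *\<^sub>R mat 1" for x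
  have d\<psi>: "((\<lambda>x. (x \<bullet> g x) *\<^sub>R g x - c\<^sup>2 *\<^sub>R x) has_derivative (*v) (D x)) (at x)" if x: "x \<in> \<Omega>" for x
  proof -
    have "(*v) (D x) = (\<lambda>h. (outer_prod (g x) (g x + A x *v x) + (x \<bullet> g x) *\<^sub>R A x) *v h - c\<^sup>2 *\<^sub>R h)"
      unfolding D_def by (rule ext) (simp only: matrix_vector_mult_diff_rdistrib
          scaleR_matrix_vector_assoc[symmetric] matrix_vector_mul_lid)
    then show ?thesis
      using has_derivative_diff[OF has_derivative_scaled_field[OF dq[OF x] der_g[OF x]]
          has_derivative_scaleR_right[OF has_derivative_ident]] by simp
  qed
  have "integral \<Omega> (\<lambda>x. trace (T x ** D x)) = 0"
  proof (rule weakly_divergence_free'[OF d\<psi>])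
    show "continuous_on (closure \<Omega>) (\<lambda>x. (x \<bullet> g x) *\<^sub>R g x - c\<^sup>2 *\<^sub>R x)" "continuous_on (closure \<Omega>) D"
      unfolding D_def by (intro cts)+
    show "g x \<bullet> (T x *v ((x \<bullet> g x) *\<^sub>R g x - c\<^sup>2 *\<^sub>R x)) = 0" if fx: "x \<in> frontier \<Omega>" for x
    proof -
      obtain \<mu> where \<mu>: "T x *v g x = \<mu> *\<^sub>R g x" using newton_tensor_frontier[OF fx] by blast
      have xc: "x \<in> closure \<Omega>" using fx by (simp add: frontier_def)
      have "g x \<bullet> (T x *v ((x \<bullet> g x) *\<^sub>R g x - c\<^sup>2 *\<^sub>R x))
          = (x \<bullet> g x) * (g x \<bullet> (T x *v g x)) - c\<^sup>2 * (g x \<bullet> (T x *v x))"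
        by (simp add: matrix_vector_mult_diff_distrib matrix_vector_mult_scaleR inner_diff_right)
      also have "g x \<bullet> (T x *v x) = x \<bullet> (T x *v g x)" by (rule T_sym[OF xc])
      finally show ?thesis using norm_g[OF fx] by (simp add: \<mu> dot_square_norm)
    qed
  qed (use k in auto)
  moreover have "integral \<Omega> (\<lambda>x. trace (T x ** D x))
    = integral \<Omega> (\<lambda>x. g x \<bullet> (T x *v g x) + C * (real k + 1) * (g x \<bullet> (newton_tensor 1 (A x) *v x))
        - g x \<bullet> (T1 x *v x) - c\<^sup>2 * trace (T x))"
  proof (rule integral_cong)
    fix x assume x: "x \<in> \<Omega>"
    have "x \<bullet> (T1 x *v g x) = g x \<bullet> (T1 x *v x)" using T_sym[of x x "Suc k" "g x"] x closure_subset by blast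
    then show "trace (T x ** D x) = g x \<bullet> (T x *v g x) + C * (real k + 1)
        * (g x \<bullet> (newton_tensor 1 (A x) *v x)) - g x \<bullet> (T1 x *v x) - c\<^sup>2 * trace (T x)"
      using A_T[OF x, of x "g x"] trace_newton_tensor_mult[OF symmetric_A[OF x], of k] sigma_k[OF x]
          unfolding D_def
      by (simp add: matrix_mult_add_right matrix_mult_diff_right trace_add trace_sub trace_mult_outer_prod
          matrix_mult_scaleR_right trace_scaleR
          inner_add_left sigma_0 matrix_mult_zero_right C_def algebra_simps inner_commute del:
              newton_tensor.simps(2)[of k])
  qed
  moreover have "\<dots> = integral \<Omega> (\<lambda>x. g x \<bullet> (T x *v g x)) + C * (real k + 1)
      * integral \<Omega> (\<lambda>x. g x \<bullet> (newton_tensor 1 (A x) *v x)) - integral \<Omega> (\<lambda>x. g x \<bullet> (T1 x *v x)) - c\<^sup>2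
      * integral \<Omega> (\<lambda>x. trace (T x))"
    by (subst integral_add integral_diff integral_mult_right | intro int cts)+ (rule refl)
  ultimately have 1: "c\<^sup>2 * integral \<Omega> (\<lambda>x. trace (T x))
      = integral \<Omega> (\<lambda>x. g x \<bullet> (T x *v g x)) + C * (real k + 1)
      * integral \<Omega> (\<lambda>x. g x \<bullet> (newton_tensor 1 (A x) *v x)) - integral \<Omega> (\<lambda>x. g x \<bullet> (T1 x *v x))"
    by linarith
  have e: "integral \<Omega> (\<lambda>x. g x \<bullet> (T x *v g x)) = - real k * (C * integral \<Omega> u)"
    "integral \<Omega> (\<lambda>x. g x \<bullet> (newton_tensor 1 (A x) *v x)) = - real CARD('n) * integral \<Omega> u"
    "integral \<Omega> (\<lambda>x. g x \<bullet> (T1 x *v x)) = - (real CARD('n) - real k) * (C * integral \<Omega> u)"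
    using energy_identity[of k] position_identity[of 1] position_identity[of "Suc k"] k
        unfolding int_u_const by (simp_all add: sigma_0 int_u_const)
  show ?thesis unfolding 1 e by (simp add: algebra_simps)
qed

lemma integral_zero_imp_zero:
  assumes cf: "continuous_on (closure \<Omega>) f" and nonneg: "\<And>x. x \<in> \<Omega> \<Longrightarrow> f x \<ge> 0" and z: "integral \<Omega> f \<le> 0"
      and x: "x \<in> \<Omega>"
  shows "f x = (0::real)"
proof -
  obtain a b where ab: "cbox a b \<subseteq> \<Omega>" "x \<in> box a b" using open_contains_cbox[OF open_\<Omega> x] by metis
  have cab: "continuous_on (cbox a b) f" using cf ab(1) closure_subset
      by (meson continuous_on_subset order_trans)
  then have iab: "f integrable_on cbox a b" by (rule integrable_continuous)
  have "integral (cbox a b) f \<le> integral \<Omega> f"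
    by (rule integral_subset_le[OF ab(1) iab int[OF cf]]) (use nonneg in auto)
  moreover have "integral (cbox a b) f \<ge> 0" by (rule integral_nonneg[OF iab]) (use nonneg ab in auto)
  ultimately have "(f has_integral 0) (cbox a b)" using iab z
      by (metis antisym order_trans has_integral_integral)
  then show ?thesis
    by (rule has_integral_0_cbox_imp_0[OF cab, rotated]) (use nonneg ab box_subset_cbox[of a b] in blast)+
qed

text \<open>With \<open>U = \<integral>u\<close> and \<open>V\<close> the volume of the domain, Maclaurin's inequality \<open>trace T\<^sub>k \<ge> k (N choose k)\<close> and
  the Pohozaev identity give \<open>c\<^sup>2 V \<le> - (N + 2) U\<close>, hence \<open>\<integral>P \<ge> \<integral>f1\<close>, whereas the identity for \<open>P\<close> says that
  \<open>\<integral>P\<close> is a negative multiple of \<open>\<integral>f2\<close>. Both \<open>f1\<close> and \<open>f2\<close> are nonnegative, so they vanish.\<close>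

theorem hessian_identity: "x \<in> \<Omega> \<Longrightarrow> A x = mat 1"
proof -
  define N where "N = real CARD('n)"
  have m: "\<Omega> \<in> lmeasurable" using open_\<Omega> bounded_\<Omega> by (simp add: lmeasurable_open)
  define f1 where "f1 x = - u x * (sigma 1 (A x) - N)" for x
  define f2 where "f2 x = - u x * (C * sigma 1 (A x) - real (k + 1) * sigma (k + 1) (A x) - real k * C)" for x
  have c1: "continuous_on (closure \<Omega>) f1" unfolding f1_def by (intro cts)
  have c2: "continuous_on (closure \<Omega>) f2" unfolding f2_def by (intro cts)
  have m1: "sigma 1 (A x) \<ge> N" if "x \<in> \<Omega>" for x
    using maclaurin_sigma(1)[OF symmetric_A[OF that] k sigma_pos[OF that] sigma_k[OF that], of 1] k
        unfolding N_def by simp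
  have m2: "sigma (k - 1) (A x) \<ge> real (CARD('n) choose (k - 1))" if "x \<in> \<Omega>" for x
    using maclaurin_sigma(1)[OF symmetric_A[OF that] k sigma_pos[OF that] sigma_k[OF that], of "k - 1"] by simp
  have m3: "real (k + 1) * sigma (k + 1) (A x) \<le> (N - real k) * C" if "x \<in> \<Omega>" for x
  proof -
    have "real (k + 1) * sigma (k + 1) (A x) \<le> real (k + 1) * real (CARD('n) choose (k + 1))"
      by (rule mult_left_mono[OF maclaurin_sigma(2)[OF symmetric_A[OF that] k sigma_pos[OF that]
          sigma_k[OF that]]]) auto
    then show ?thesis unfolding C_def N_def binomial_absorb_real .
  qed
  have m4: "C * sigma 1 (A x) - real (k + 1) * sigma (k + 1) (A x) - real k * C \<ge> C * (sigma 1 (A x) - N)"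
      if "x \<in> \<Omega>" for x
    using m3[OF that] by (simp add: algebra_simps)
  have n1: "f1 x \<ge> 0" if "x \<in> \<Omega>" for x
    unfolding f1_def using u_neg[OF that] m1[OF that] by (simp add: mult_nonpos_nonneg)
  have m5: "C * (sigma 1 (A x) - N) \<ge> 0" if "x \<in> \<Omega>" for x using m1[OF that] C_pos by simp
  have n2: "f2 x \<ge> 0" if "x \<in> \<Omega>" for x
    unfolding f2_def using u_neg[OF that] m4[OF that] m5[OF that] by (intro mult_nonneg_nonneg) linarith+
  have trT: "trace (T x) \<ge> real k * C" if "x \<in> \<Omega>" for x
  proof -
    have "(N - real k + 1) * real (CARD('n) choose (k - 1)) = real k * C"
      using binomial_absorb_real[of "k - 1" "CARD('n)"] k unfolding N_def C_def
          by (simp add: algebra_simps of_nat_diff)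
    moreover have "(N - real k + 1) * real (CARD('n) choose (k - 1)) \<le> (N - real k + 1) * sigma (k - 1) (A x)"
      using m2[OF that] k unfolding N_def by (intro mult_left_mono) auto
    ultimately show ?thesis using trace_T[OF that, of k] k unfolding N_def by simp
  qed
  have iT: "(\<lambda>x. trace (T x)) integrable_on \<Omega>" by (intro int cts)
  have ic: "(\<lambda>x. 1::real) integrable_on \<Omega>" using m by (rule integrable_on_const)
  define V where "V = integral \<Omega> (\<lambda>x. 1::real)"
  define U where "U = integral \<Omega> u"
  have "real k * C * V \<le> integral \<Omega> (\<lambda>x. trace (T x))"
  proof -
    have "integral \<Omega> (\<lambda>x. real k * C * 1) \<le> integral \<Omega> (\<lambda>x. trace (T x))"
      by (rule integral_le[OF integrable_on_mult_right[OF ic] iT]) (use trT in simp)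
    then show ?thesis unfolding V_def by (simp only: integral_mult_right)
  qed
  then have "c\<^sup>2 * (real k * C * V) \<le> c\<^sup>2 * integral \<Omega> (\<lambda>x. trace (T x))" by (rule mult_left_mono) simp
  then have "(real k * C) * (c\<^sup>2 * V) \<le> (real k * C) * (- (N + 2) * U)"
    unfolding pohozaev_identity N_def[symmetric] U_def[symmetric] by (simp add: algebra_simps)
  moreover have kC: "real k * C > 0" using k C_pos by simp
  ultimately have V: "c\<^sup>2 * V \<le> - (N + 2) * U" by (simp only: mult_le_cancel_left_pos)
  \<comment> \<open>From \<open>\<integral>|\<nabla>u|\<^sup>2 = - \<integral>u \<Delta>u\<close>, which is the energy identity of order \<open>1\<close>.\<close>
  have iP: "integral \<Omega> P = integral \<Omega> f1 - N * U - 2 * U - c\<^sup>2 * V"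
  proof -
    have "integral \<Omega> P = integral \<Omega> (\<lambda>x. g x \<bullet> (newton_tensor 1 (A x) *v g x) - 2 * u x - c\<^sup>2 * 1)"
      by (rule integral_cong) (simp add: P_def sigma_0 matrix_mult_zero_right)
    also have "\<dots> = integral \<Omega> (\<lambda>x. g x \<bullet> (newton_tensor 1 (A x) *v g x)) - 2 * U - c\<^sup>2 * V"
      unfolding U_def V_def by (subst integral_diff integral_mult_right | intro int cts)+ (rule refl)
    also have "integral \<Omega> (\<lambda>x. g x \<bullet> (newton_tensor 1 (A x) *v g x)) = - integral \<Omega> (\<lambda>x. u x * sigma 1 (A x))"
      using energy_identity[of 1] by simp
    also have "integral \<Omega> (\<lambda>x. u x * sigma 1 (A x)) = N * U - integral \<Omega> f1"
    proof -
      have "integral \<Omega> (\<lambda>x. u x * sigma 1 (A x)) = integral \<Omega> (\<lambda>x. N * u x - f1 x)"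
        by (rule integral_cong) (simp add: f1_def algebra_simps)
      also have "\<dots> = N * U - integral \<Omega> f1"
        unfolding U_def by (subst integral_diff integral_mult_right | intro int cts c1)+ (rule refl)
      finally show ?thesis .
    qed
    finally show ?thesis by simp
  qed
  have i2: "real k * C * integral \<Omega> P = - 2 * integral \<Omega> f2"
  proof -
    have "integral \<Omega> (\<lambda>x. u x * (C * sigma 1 (A x) - real (k + 1) * sigma (k + 1) (A x) - real k * C))
        = integral \<Omega> (\<lambda>x. - f2 x)"
      by (rule integral_cong) (simp add: f2_def)
    then show ?thesis unfolding P_identity by simp
  qed
  have I1: "integral \<Omega> f1 \<ge> 0" by (rule integral_nonneg[OF int[OF c1]]) (use n1 in auto)
  have I2: "integral \<Omega> f2 \<ge> 0" by (rule integral_nonneg[OF int[OF c2]]) (use n2 in auto)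
  have "integral \<Omega> P \<ge> integral \<Omega> f1" using iP V by (simp add: algebra_simps)
  moreover have "integral \<Omega> P \<le> 0"
  proof -
    have "real k * C * integral \<Omega> P \<le> 0" unfolding i2 using I2 by simp
    then show ?thesis using mult_pos_pos[OF kC, of "integral \<Omega> P"] by linarith
  qed
  ultimately have z: "integral \<Omega> f1 \<le> 0" "integral \<Omega> f2 \<le> 0"
  proof -
    assume a: "integral \<Omega> f1 \<le> integral \<Omega> P" "integral \<Omega> P \<le> 0"
    then have "integral \<Omega> P = 0" using I1 by linarith
    then have "2 * integral \<Omega> f2 = 0" using i2 by simp
    then show "integral \<Omega> f1 \<le> 0" "integral \<Omega> f2 \<le> 0" using a by simp_all
  qed
  fix x assume x: "x \<in> \<Omega>"
  have "f1 x = 0" by (rule integral_zero_imp_zero[OF c1 n1 z(1) x])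
  then have s1: "sigma 1 (A x) = N" using u_neg[OF x] unfolding f1_def by simp
  have "f2 x = 0" by (rule integral_zero_imp_zero[OF c2 n2 z(2) x])
  then have "C * sigma 1 (A x) - real (k + 1) * sigma (k + 1) (A x) - real k * C = 0" using u_neg[OF x]
      unfolding f2_def by (simp del: of_nat_add)
  then have "real (k + 1) * sigma (k + 1) (A x) = (N - real k) * C" unfolding s1 by (simp add: algebra_simps)
  then have "real (k + 1) * sigma (k + 1) (A x) = real (k + 1) * real (CARD('n) choose (k + 1))"
    using binomial_absorb_real[of k "CARD('n)"] unfolding C_def N_def by simp
  then have sk: "sigma (k + 1) (A x) = real (CARD('n) choose (k + 1))" by (simp only: mult_cancel_left) simp
  show "A x = mat 1"
    by (rule identity_matrix_if_extremal[OF symmetric_A[OF x] k sigma_pos[OF x] sigma_k[OF x] _ sk])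
        (use s1 in \<open>simp_all add: N_def\<close>)
qed

end

section \<open>Boundary gradients and the outer normal\<close>

lemma local_defining_functionD:
  assumes "local_defining_function \<Omega> x V \<phi>"
  shows "open V" "x \<in> V" "grad \<phi> x \<noteq> 0" "\<And>y. y \<in> V \<Longrightarrow> y \<in> \<Omega> \<longleftrightarrow> \<phi> y < 0"
    "(\<phi> has_derivative (\<lambda>h. grad \<phi> x \<bullet> h)) (at x)"
  using assms has_derivative_grad unfolding local_defining_function_def C2_on_def by auto

lemma defining_function_zero:
  assumes "open \<Omega>" "x \<in> frontier \<Omega>" "local_defining_function \<Omega> x V \<phi>"
  shows "\<phi> x = 0"
proof -
  note D = local_defining_functionD[OF assms(3)]
  have "x \<notin> \<Omega>" using assms by (auto simp: frontier_def interior_open)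
  then have "\<phi> x \<ge> 0" using D(2,4) by auto
  moreover have "\<not> \<phi> x > 0"
  proof
    assume "\<phi> x > 0"
    moreover have "isCont \<phi> x" using D(5) has_derivative_continuous by blast
    ultimately have "\<forall>\<^sub>F y in nhds x. \<phi> y > 0"
        by (simp add: continuous_within order_tendstoD(1) eventually_nhds_conv_at isCont_def)
    moreover have "\<forall>\<^sub>F y in nhds x. y \<in> V" using D(1,2) eventually_nhds by blast
    ultimately have "\<forall>\<^sub>F y in nhds x. y \<notin> \<Omega>" by eventually_elim (use D(4) in auto)
    then obtain T where "open T" "x \<in> T" "T \<inter> \<Omega> = {}" unfolding eventually_nhds by blast
    then show False using assms(2) by (metis DiffD1 IntI empty_iff frontier_def open_Int_closure_eq_empty)
  qed
  ultimately show ?thesis by simp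
qed

text \<open>A line through a boundary point that is transversal to the tangent plane enters the domain on one side and
  leaves it on the other. First-order information about the defining function is all that the boundary
  arguments below use.\<close>

lemma line_eventually_inside:
  assumes "open \<Omega>" "x \<in> frontier \<Omega>" "local_defining_function \<Omega> x V \<phi>" "grad \<phi> x \<bullet> d < 0"
  shows "\<exists>s0>0. \<forall>s. 0 < s \<and> s < s0 \<longrightarrow> x + s *\<^sub>R d \<in> \<Omega>"
    and "\<exists>s0>0. \<forall>s. 0 < s \<and> s < s0 \<longrightarrow> x - s *\<^sub>R d \<in> V - \<Omega>"
proof -
  note D = local_defining_functionD[OF assms(3)]
  have der: "((\<lambda>s. \<phi> (x + s *\<^sub>R e)) has_real_derivative (grad \<phi> x \<bullet> e)) (at 0)" for e
  proof -
    have "((\<lambda>s. x + s *\<^sub>R e) has_derivative (\<lambda>r. r *\<^sub>R e)) (at 0)" by (auto intro!: derivative_eq_intros)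
    moreover have "(\<phi> has_derivative (\<lambda>h. grad \<phi> x \<bullet> h)) (at (x + 0 *\<^sub>R e))" using D(5) by simp
    ultimately have "((\<lambda>s. \<phi> (x + s *\<^sub>R e)) has_derivative (\<lambda>r. grad \<phi> x \<bullet> (r *\<^sub>R e))) (at 0)"
      by (rule has_derivative_compose)
    then show ?thesis unfolding has_field_derivative_def by (simp add: mult.commute[of _ "grad \<phi> x \<bullet> e"] )
  qed
  have inV: "\<exists>s0>0. \<forall>s. 0 < s \<and> s < s0 \<longrightarrow> x + s *\<^sub>R e \<in> V" for e
  proof -
    obtain r where r: "r > 0" "ball x r \<subseteq> V" using D(1,2) open_contains_ball by blast
    have "x + s *\<^sub>R e \<in> V" if "0 < s" "s < r / (norm e + 1)" for s
    proof -
      have "s * norm e < s * (norm e + 1)" using that by simp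
      also have "\<dots> < r" using that by (simp add: pos_less_divide_eq add_nonneg_pos)
      finally show ?thesis using r(2) that by (auto simp: dist_norm subset_iff)
    qed
    then show ?thesis using r by (intro exI[of _ "r / (norm e
        + 1)"]) (auto intro!: divide_pos_pos add_nonneg_pos)
  qed
  have z: "\<phi> x = 0" by (rule defining_function_zero[OF assms(1-3)])
  obtain s1 where s1: "s1 > 0" "\<And>s. 0 < s \<Longrightarrow> s < s1 \<Longrightarrow> x + s *\<^sub>R d \<in> V" using inV by blast
  obtain s2 where s2: "s2 > 0" "\<And>s. 0 < s \<Longrightarrow> s < s2 \<Longrightarrow> \<phi> (x + s *\<^sub>R d) < 0"
    using DERIV_neg_dec_right[OF der assms(4)] z by auto
  show "\<exists>s0>0. \<forall>s. 0 < s \<and> s < s0 \<longrightarrow> x + s *\<^sub>R d \<in> \<Omega>"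
    using s1 s2 D(4) by (intro exI[of _ "min s1 s2"]) auto
  obtain s3 where s3: "s3 > 0" "\<And>s. 0 < s \<Longrightarrow> s < s3 \<Longrightarrow> x + s *\<^sub>R (- d) \<in> V" using inV by blast
  have "grad \<phi> x \<bullet> (- d) > 0" using assms(4) by simp
  then obtain s4 where s4: "s4 > 0" "\<And>s. 0 < s \<Longrightarrow> s < s4 \<Longrightarrow> \<phi> (x + s *\<^sub>R (- d)) > 0"
    using DERIV_pos_inc_right[OF der, of "-d"] z by auto
  show "\<exists>s0>0. \<forall>s. 0 < s \<and> s < s0 \<longrightarrow> x - s *\<^sub>R d \<in> V - \<Omega>"
    using s3 s4 D(4) by (intro exI[of _ "min s3 s4"]) (auto, metis less_asym)
qed

text \<open>If two defining functions had gradients of different directions \<open>p\<close> and \<open>q\<close>, the line in direction \<open>q - p\<close>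
  would enter the domain according to one of them and leave it according to the other.\<close>

lemma outer_normal_eq:
  assumes \<Omega>: "open \<Omega>" "x \<in> frontier \<Omega>" and L: "local_defining_function \<Omega> x V \<phi>"
  shows "outer_normal \<Omega> x = sgn (grad \<phi> x)"
  unfolding outer_normal_def
proof (rule the_equality)
  show "\<exists>V \<phi>'. local_defining_function \<Omega> x V \<phi>' \<and> sgn (grad \<phi> x) = sgn (grad \<phi>' x)" using L by blast
  fix \<nu> assume "\<exists>V \<phi>. local_defining_function \<Omega> x V \<phi> \<and> \<nu> = sgn (grad \<phi> x)"
  then obtain W \<psi> where \<psi>: "local_defining_function \<Omega> x W \<psi>" "\<nu> = sgn (grad \<psi> x)" by blast
  define a b where "a = grad \<phi> x" and "b = grad \<psi> x"
  have ab: "a \<noteq> 0" "b \<noteq> 0" using local_defining_functionD(3)[OF L] local_defining_functionD(3)[OF \<psi>(1)]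
      unfolding a_def b_def by auto
  have imp: "b \<bullet> d \<le> 0" if ad: "a \<bullet> d < 0" for d
  proof (rule ccontr)
    assume "\<not> b \<bullet> d \<le> 0"
    then have "b \<bullet> (- d) < 0" by simp
    then obtain s1 where s1: "s1 > 0" "\<And>s. 0 < s \<and> s < s1 \<Longrightarrow> x - s *\<^sub>R (- d) \<in> W - \<Omega>"
      using line_eventually_inside(2)[OF \<Omega> \<psi>(1)] unfolding b_def by blast
    obtain s2 where s2: "s2 > 0" "\<And>s. 0 < s \<and> s < s2 \<Longrightarrow> x + s *\<^sub>R d \<in> \<Omega>"
      using line_eventually_inside(1)[OF \<Omega> L ad[unfolded a_def]] by blast
    define s where "s = min s1 s2 / 2"
    have "0 < s \<and> s < s1" "0 < s \<and> s < s2" unfolding s_def using s1(1) s2(1) by auto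
    then show False using s1(2)[of s] s2(2)[of s] by auto
  qed
  define p q where "p = sgn a" and "q = sgn b"
  have pq: "norm p = 1" "norm q = 1" unfolding p_def q_def using ab by (simp_all add: norm_sgn)
  have ap: "a = norm a *\<^sub>R p" "b = norm b *\<^sub>R q" unfolding p_def q_def by (simp_all add: sgn_div_norm ab)
  show "\<nu> = sgn (grad \<phi> x)"
  proof (rule ccontr)
    assume "\<nu> \<noteq> sgn (grad \<phi> x)"
    then have ne: "p \<noteq> q" using \<psi>(2) unfolding p_def q_def a_def b_def by simp
    have "(p - q) \<bullet> (p - q) > 0" using ne by simp
    moreover have "p \<bullet> p = 1" "q \<bullet> q = 1" using pq by (simp_all add: dot_square_norm)
    ultimately have lt: "p \<bullet> q < 1" by (simp add: inner_diff_left inner_diff_right inner_commute)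
    have "a \<bullet> (q - p) = norm a * (p \<bullet> q - 1)"
      by (subst ap(1)) (simp add: inner_diff_right \<open>p \<bullet> p = 1\<close> right_diff_distrib)
    then have "a \<bullet> (q - p) < 0" using lt ab by (simp add: mult_pos_neg)
    then have "b \<bullet> (q - p) \<le> 0" by (rule imp)
    moreover have "b \<bullet> (q - p) = norm b * (1 - p \<bullet> q)"
      by (subst ap(2)) (simp add: inner_diff_right \<open>q \<bullet> q = 1\<close> right_diff_distrib inner_commute)
    ultimately show False using lt ab by (simp add: mult_le_0_iff)
  qed
qed

text \<open>A function vanishing on the boundary has no tangential derivative there. For a tangential direction
  \<open>\<tau>\<close> and small \<open>\<epsilon>\<close>, the point \<open>y = x + t (\<tau> - \<epsilon> \<nu>)\<close> is inside and \<open>x + t (\<tau> + \<epsilon> \<nu>)\<close> is outside, so the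
  segment between them meets the boundary at a zero of \<open>f\<close>, at distance at most \<open>2 t \<epsilon>\<close> from \<open>y\<close>. The mean value theorem on
  the two segments gives \<open>t (G x \<bullet> \<tau>) = O(t \<epsilon>)\<close> up to \<open>o(t)\<close>, without parametrizing the boundary.\<close>

lemma gradient_parallel_normal:
  fixes f :: "real^'n \<Rightarrow> real"
  assumes \<Omega>: "open \<Omega>" and x: "x \<in> frontier \<Omega>" and L: "local_defining_function \<Omega> x V \<phi>"
    and cf: "continuous_on (closure \<Omega>) f" and cG: "continuous_on (closure \<Omega>) G"
    and df: "\<And>y. y \<in> \<Omega> \<Longrightarrow> (f has_derivative (\<lambda>h. G y \<bullet> h)) (at y)"
    and z: "\<And>y. y \<in> frontier \<Omega> \<Longrightarrow> f y = 0"
  shows "G x = (G x \<bullet> outer_normal \<Omega> x) *\<^sub>R outer_normal \<Omega> x"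
proof -
  define \<nu> where "\<nu> = outer_normal \<Omega> x"
  have a0: "grad \<phi> x \<noteq> 0" by (rule local_defining_functionD[OF L])
  have \<nu>: "\<nu> = sgn (grad \<phi> x)" unfolding \<nu>_def by (rule outer_normal_eq[OF \<Omega> x L])
  have n1: "\<nu> \<bullet> \<nu> = 1" unfolding \<nu> using a0 by (simp add: dot_square_norm norm_sgn)
  have a: "grad \<phi> x = norm (grad \<phi> x) *\<^sub>R \<nu>" unfolding \<nu> by (simp add: sgn_div_norm a0)
  have xc: "x \<in> closure \<Omega>" using x by (simp add: frontier_def)
  have orth: "G x \<bullet> \<tau> = 0" if \<tau>: "\<nu> \<bullet> \<tau> = 0" for \<tau>
  proof (rule ccontr)
    assume "G x \<bullet> \<tau> \<noteq> 0"
    define \<eta> where "\<eta> = \<bar>G x \<bullet> \<tau>\<bar>"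
    have \<eta>: "\<eta> > 0" unfolding \<eta>_def using \<open>G x \<bullet> \<tau> \<noteq> 0\<close> by simp
    define K where "K = norm (G x) + 1"
    have K: "K \<ge> 1" unfolding K_def by simp
    \<comment> \<open>Chosen so that the total error \<open>\<epsilon> (3 K + |\<tau>| + 1)\<close> is at most \<open>\<eta> / 2\<close>.\<close>
    define \<epsilon> where "\<epsilon> = min 1 (\<eta> / (2 * (3 * K + norm \<tau> + 1)))"
    have pos: "3 * K + norm \<tau> + 1 > 0" using K by (simp add: add_pos_nonneg)
    have \<epsilon>: "0 < \<epsilon>" "\<epsilon> \<le> 1" unfolding \<epsilon>_def using \<eta> pos by auto
    have \<epsilon>\<eta>: "\<epsilon> * (3 * K + norm \<tau> + 1) \<le> \<eta> / 2"
    proof -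
      have "\<epsilon> \<le> \<eta> / (2 * (3 * K + norm \<tau> + 1))" unfolding \<epsilon>_def by simp
      then show ?thesis using pos by (simp add: field_simps)
    qed
    obtain \<rho> where \<rho>: "\<rho> > 0" "\<And>y. y \<in> closure \<Omega> \<Longrightarrow> dist y x < \<rho> \<Longrightarrow> dist (G y) (G x) < \<epsilon>"
      using cG xc \<epsilon>(1) unfolding continuous_on_iff by metis
    have GK: "norm (G y) \<le> K" if "y \<in> closure \<Omega>" "dist y x < \<rho>" for y
      using norm_triangle_ineq[of "G x" "G y - G x"] \<rho>(2)[OF that] \<epsilon> unfolding K_def dist_norm by simp
    define d where "d = \<tau> - \<epsilon> *\<^sub>R \<nu>"
    have ad: "grad \<phi> x \<bullet> d < 0" unfolding d_def
      by (subst a) (use \<tau> n1 a0 \<epsilon> in \<open>simp add: inner_diff_right\<close>)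
    have ad': "grad \<phi> x \<bullet> (- \<tau> - \<epsilon> *\<^sub>R \<nu>) < 0"
      by (subst a) (use \<tau> n1 a0 \<epsilon> in \<open>simp add: inner_diff_right\<close>)
    obtain s1 where s1: "s1 > 0" "\<And>s. 0 < s \<Longrightarrow> s < s1 \<Longrightarrow> x + s *\<^sub>R d \<in> \<Omega>"
      using line_eventually_inside(1)[OF \<Omega> x L ad] by blast
    obtain s2 where s2: "s2 > 0" "\<And>s. 0 < s \<Longrightarrow> s < s2 \<Longrightarrow> x - s *\<^sub>R (- \<tau> - \<epsilon> *\<^sub>R \<nu>) \<in> V - \<Omega>"
      using line_eventually_inside(2)[OF \<Omega> x L ad'] by blast
    define m where "m = min (min s1 s2) (\<rho> / (norm \<tau> + 3))"
    define t where "t = m / 2"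
    have n3: "norm \<tau> + 3 > 0" by (simp add: add_nonneg_pos)
    have t: "t > 0" "t < s1" "t < s2" "t * (norm \<tau> + 3) < \<rho>"
    proof -
      have "m > 0" unfolding m_def using s1 s2 \<rho> n3 by simp
      then have tm: "t > 0" "t < m" unfolding t_def by simp_all
      then show "t > 0" "t < s1" "t < s2" unfolding m_def by auto
      have "t < \<rho> / (norm \<tau> + 3)" using tm unfolding m_def by simp
      then show "t * (norm \<tau> + 3) < \<rho>" using n3 by (simp add: pos_less_divide_eq)
    qed
    have n\<nu>: "norm \<nu> = 1" using n1 by (simp add: norm_eq_1)
    have nd: "norm d \<le> norm \<tau> + 1" unfolding d_def using norm_triangle_ineq4[of \<tau> "\<epsilon> *\<^sub>R \<nu>"] n\<nu> \<epsilon> by simp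
    have near: "dist (x + s *\<^sub>R d + r *\<^sub>R \<nu>) x < \<rho>" if "0 \<le> s" "s \<le> t" "0 \<le> r" "r \<le> 2 * t" for s r
    proof -
      have "norm (s *\<^sub>R d + r *\<^sub>R \<nu>) \<le> s * norm d + r"
          using norm_triangle_ineq[of "s *\<^sub>R d" "r *\<^sub>R \<nu>"] that n\<nu> by simp
      also have "\<dots> \<le> t * (norm \<tau> + 1) + 2 * t" using that nd by (intro add_mono mult_mono) auto
      also have "\<dots> = t * (norm \<tau> + 3)" by (simp add: algebra_simps)
      finally show ?thesis using t(4) by (simp add: dist_norm add.assoc)
    qed
    have inO: "x + s *\<^sub>R d \<in> \<Omega>" if "0 < s" "s \<le> t" for s using s1(2) that t by auto
    have "continuous_on {0..t} (\<lambda>s. f (x + s *\<^sub>R d))"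
    proof (rule continuous_on_compose2[OF cf])
      show "(\<lambda>s. x + s *\<^sub>R d) ` {0..t} \<subseteq> closure \<Omega>"
        using inO xc closure_subset[of \<Omega>] by (auto simp: subset_iff)
            (metis add.right_neutral less_eq_real_def scale_zero_left)
    qed (intro continuous_intros)
    then obtain \<xi> where \<xi>: "0 < \<xi>" "\<xi> < t" "f (x + t *\<^sub>R d) - f x = t * (G (x + \<xi> *\<^sub>R d) \<bullet> d)"
      using line_mvt[OF t(1), of f G x d] df inO by (metis less_imp_le)
    define y where "y = x + t *\<^sub>R d"
    have yO: "y \<in> \<Omega>" unfolding y_def using inO t by simp
    \<comment> \<open>The smallest element of \<open>Q\<close> is where the normal segment from \<open>y\<close> first leaves the domain.\<close>
    define Q where "Q = {r \<in> {0..2 * t * \<epsilon>}. y + r *\<^sub>R \<nu> \<notin> \<Omega>}"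
    have cQ: "closed Q"
    proof -
      have "closed ((\<lambda>r. y + r *\<^sub>R \<nu>) -` (- \<Omega>))"
        using \<Omega> by (intro closed_vimage continuous_intros) auto
      moreover have "Q = {0..2 * t * \<epsilon>} \<inter> (\<lambda>r. y + r *\<^sub>R \<nu>) -` (- \<Omega>)" unfolding Q_def by auto
      ultimately show ?thesis by (simp add: closed_Int)
    qed
    have "2 * t * \<epsilon> \<in> Q"
    proof -
      have "y + (2 * t * \<epsilon>) *\<^sub>R \<nu> = x - t *\<^sub>R (- \<tau> - \<epsilon> *\<^sub>R \<nu>)"
        unfolding y_def d_def by (simp add: algebra_simps scaleR_2[symmetric] vec_eq_iff)
      then show ?thesis unfolding Q_def using s2(2)[OF t(1,3)] t(1) \<epsilon> by simp
    qed
    then have Qne: "Q \<noteq> {}" by blast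
    have Qb: "bdd_below Q" unfolding Q_def by (auto intro: bdd_belowI[of _ 0])
    define r where "r = Inf Q"
    have rQ: "r \<in> Q" unfolding r_def by (rule closed_contains_Inf[OF Qne Qb cQ])
    have r0: "0 < r" "r \<le> 2 * t * \<epsilon>" using rQ yO unfolding Q_def by (auto simp: less_eq_real_def)
    have r2t: "r \<le> 2 * t" 
    proof -
      have "2 * t * \<epsilon> \<le> 2 * t * 1" using \<epsilon>(2) t(1) by (intro mult_left_mono) auto
      then show ?thesis using r0(2) by linarith
    qed
    have rin: "y + s *\<^sub>R \<nu> \<in> \<Omega>" if "0 \<le> s" "s < r" for s
    proof (rule ccontr)
      assume "y + s *\<^sub>R \<nu> \<notin> \<Omega>"
      then have "s \<in> Q" unfolding Q_def using that r0 by auto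
      then have "r \<le> s" unfolding r_def using Qb by (rule cInf_lower)
      then show False using that by simp
    qed
    have rcl: "y + r *\<^sub>R \<nu> \<in> closure \<Omega>"
    proof -
      have "(\<lambda>n. y + (r - r / real (Suc n)) *\<^sub>R \<nu>) \<longlonglongrightarrow> y + (r - 0) *\<^sub>R \<nu>"
        by (intro tendsto_intros) (use LIMSEQ_Suc[OF lim_const_over_n[of r]] in simp)
      moreover have "y + (r - r / real (Suc n)) *\<^sub>R \<nu> \<in> \<Omega>" for n
        by (rule rin) (use r0 in \<open>auto simp: field_simps\<close>)
      ultimately show ?thesis unfolding closure_sequential
          by (intro exI[of _ "\<lambda>n. y + (r - r / real (Suc n)) *\<^sub>R \<nu>"]) auto
    qed
    have rfr: "y + r *\<^sub>R \<nu> \<in> frontier \<Omega>" using rcl rQ \<Omega> unfolding Q_def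
        by (auto simp: frontier_def interior_open)
    have "continuous_on {0..r} (\<lambda>s. f (y + s *\<^sub>R \<nu>))"
    proof (rule continuous_on_compose2[OF cf])
      show "(\<lambda>s. y + s *\<^sub>R \<nu>) ` {0..r} \<subseteq> closure \<Omega>"
        using rin rcl closure_subset[of \<Omega>] by (auto simp: subset_iff) (metis less_eq_real_def)
    qed (intro continuous_intros)
    then obtain \<zeta> where \<zeta>: "0 < \<zeta>" "\<zeta> < r" "f (y + r *\<^sub>R \<nu>) - f y = r * (G (y + \<zeta> *\<^sub>R \<nu>) \<bullet> \<nu>)"
      using line_mvt[OF r0(1), of f G y \<nu>] df rin by (metis less_imp_le)
    have q1: "x + \<xi> *\<^sub>R d \<in> closure \<Omega>" "dist (x + \<xi> *\<^sub>R d) x < \<rho>"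
      using inO[of \<xi>] near[of \<xi> 0] \<xi> t closure_subset by auto
    have q2: "y + \<zeta> *\<^sub>R \<nu> \<in> closure \<Omega>" "dist (y + \<zeta> *\<^sub>R \<nu>) x < \<rho>"
      using rin[of \<zeta>] near[of t \<zeta>] \<zeta> r2t t closure_subset unfolding y_def by auto
    have "t * (G (x + \<xi> *\<^sub>R d) \<bullet> d) = - (r * (G (y + \<zeta> *\<^sub>R \<nu>) \<bullet> \<nu>))"
      using \<xi>(3) \<zeta>(3) z[OF x] z[OF rfr] unfolding y_def[symmetric] by simp
    then have "t * \<bar>G (x + \<xi> *\<^sub>R d) \<bullet> d\<bar> = r * \<bar>G (y + \<zeta> *\<^sub>R \<nu>) \<bullet> \<nu>\<bar>"
      using t r0 by (metis abs_minus_cancel abs_mult abs_of_pos)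
    also have "\<dots> \<le> (2 * t * \<epsilon>) * K"
      using r0 Cauchy_Schwarz_ineq2[of "G (y + \<zeta> *\<^sub>R \<nu>)" \<nu>] GK[OF q2] n\<nu> t \<epsilon> by (intro mult_mono) auto
    finally have b1: "\<bar>G (x + \<xi> *\<^sub>R d) \<bullet> d\<bar> \<le> 2 * \<epsilon> * K" using t by (simp add: mult_ac)
    have "\<bar>(G x - G (x + \<xi> *\<^sub>R d)) \<bullet> d\<bar> \<le> norm (G x - G (x + \<xi> *\<^sub>R d)) * norm d" by (rule Cauchy_Schwarz_ineq2)
    also have "\<dots> \<le> \<epsilon> * (norm \<tau> + 1)" using \<rho>(2)[OF q1] nd \<epsilon>
        by (intro mult_mono) (auto simp: dist_norm norm_minus_commute)
    finally have b2: "\<bar>G x \<bullet> d\<bar> \<le> 2 * \<epsilon> * K + \<epsilon> * (norm \<tau> + 1)" using b1 by (simp add: inner_diff_left)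
    have "\<bar>G x \<bullet> \<nu>\<bar> \<le> K" using Cauchy_Schwarz_ineq2[of "G x" \<nu>] n\<nu> unfolding K_def by simp
    then have b3: "\<epsilon> * \<bar>G x \<bullet> \<nu>\<bar> \<le> \<epsilon> * K" using \<epsilon> by (intro mult_left_mono) auto
    have "G x \<bullet> \<tau> = G x \<bullet> d + \<epsilon> * (G x \<bullet> \<nu>)" unfolding d_def by (simp add: inner_diff_right)
    then have "\<eta> \<le> \<bar>G x \<bullet> d\<bar> + \<epsilon> * \<bar>G x \<bullet> \<nu>\<bar>" unfolding \<eta>_def
        using \<epsilon> abs_triangle_ineq[of "G x \<bullet> d" "\<epsilon> * (G x \<bullet> \<nu>)"] by (simp add: abs_mult)
    also have "\<dots> \<le> \<epsilon> * (3 * K + norm \<tau> + 1)" using b2 b3 by (simp add: algebra_simps)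
    finally show False using \<epsilon>\<eta> \<eta> by simp
  qed
  define w where "w = G x - (G x \<bullet> \<nu>) *\<^sub>R \<nu>"
  have "\<nu> \<bullet> w = 0" unfolding w_def using n1 by (simp add: inner_diff_right inner_commute)
  then have "G x \<bullet> w = 0" by (rule orth)
  then have "w \<bullet> w = 0" using \<open>\<nu> \<bullet> w = 0\<close> unfolding w_def by (simp add: inner_diff_left)
  then show ?thesis unfolding w_def \<nu>_def by simp
qed

lemma outer_normal_unit:
  assumes "open \<Omega>" "x \<in> frontier \<Omega>" "local_defining_function \<Omega> x V \<phi>"
  shows "norm (outer_normal \<Omega> x) = 1"
  unfolding outer_normal_eq[OF assms] using local_defining_functionD(3)[OF assms(3)] by (simp add: norm_sgn)

lemma normal_derivative_eq:
  fixes u :: "real^'n \<Rightarrow> real"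
  assumes "open \<Omega>" "x \<in> frontier \<Omega>" and cG: "continuous_on (closure \<Omega>) G" and "\<And>y. y \<in> \<Omega> \<Longrightarrow> G y = grad u y"
  shows "normal_derivative \<Omega> u x = G x \<bullet> outer_normal \<Omega> x"
proof -
  have xc: "x \<in> closure \<Omega>" "x \<notin> \<Omega>" using assms by (auto simp: frontier_def interior_open)
  then have nt: "at x within \<Omega> \<noteq> bot" unfolding closure_def by (simp add: trivial_limit_within)
  have "(G \<longlongrightarrow> G x) (at x within closure \<Omega>)" using cG xc by (simp add: continuous_on_def)
  then have "(G \<longlongrightarrow> G x) (at x within \<Omega>)" by (rule tendsto_within_subset) (rule closure_subset)
  moreover have "\<forall>\<^sub>F y in at x within \<Omega>. G y = grad u y" using assms(4) by (simp add: eventually_at_filter)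
  ultimately have "(grad u \<longlongrightarrow> G x) (at x within \<Omega>)" using tendsto_cong[of G "grad u"] by blast
  then have "Lim (at x within \<Omega>) (grad u) = G x" using nt by (rule tendsto_Lim[rotated])
  then show ?thesis unfolding normal_derivative_def by simp
qed

section \<open>Symmetry of the overdetermined problem\<close>

lemma psd_at_interior_min:
  fixes u :: "'a::euclidean_space \<Rightarrow> real"
  assumes op: "open S" and x: "x \<in> S"
    and du: "\<And>y. y \<in> S \<Longrightarrow> (u has_derivative (\<lambda>h. g y \<bullet> h)) (at y)"
    and dg: "(g has_derivative B) (at x)"
    and mn: "\<And>y. y \<in> S \<Longrightarrow> u x \<le> u y"
  shows "B v \<bullet> v \<ge> 0"
proof (rule ccontr)
  assume "\<not> B v \<bullet> v \<ge> 0"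
  then have neg: "B v \<bullet> v < 0" by simp
  obtain r where r: "r > 0" "ball x r \<subseteq> S" using op x open_contains_ball by blast
  have inS: "x + s *\<^sub>R v \<in> S" if "\<bar>s\<bar> < r / (norm v + 1)" for s
  proof -
    have p: "norm v + 1 > 0" by (simp add: add_nonneg_pos)
    have "\<bar>s\<bar> * norm v \<le> \<bar>s\<bar> * (norm v + 1)" by (intro mult_left_mono) auto
    also have "\<dots> < r" using that p by (simp add: pos_less_divide_eq)
    finally show ?thesis using r(2) by (auto simp: dist_norm subset_iff)
  qed
  have g0: "g x \<bullet> h = 0" for h
  proof -
    have "(\<lambda>h. g x \<bullet> h) = (\<lambda>h. 0)"
      by (rule differential_zero_maxmin[OF x op du[OF x]]) (use mn in blast)
    then show ?thesis by metis
  qed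
  have lin: "linear B" using dg has_derivative_linear by blast
  have "((\<lambda>s. g (x + s *\<^sub>R v) \<bullet> v) has_real_derivative (B v \<bullet> v)) (at 0)"
  proof -
    have 1: "((\<lambda>s. x + s *\<^sub>R v) has_derivative (\<lambda>r. r *\<^sub>R v)) (at 0)" by (auto intro!: derivative_eq_intros)
    have "(g has_derivative B) (at (x + 0 *\<^sub>R v))" using dg by simp
    from has_derivative_inner_left[OF has_derivative_compose[OF 1 this]]
    have "((\<lambda>s. g (x + s *\<^sub>R v) \<bullet> v) has_derivative (\<lambda>r. B (r *\<^sub>R v) \<bullet> v)) (at 0)" .
    then show ?thesis unfolding has_field_derivative_def
        by (simp add: linear_scale[OF lin] mult.commute[of _ "B v \<bullet> v"])
  qed
  then obtain d where d: "d > 0" "\<And>h. 0 < h \<Longrightarrow> h < d \<Longrightarrow> g (x + h *\<^sub>R v) \<bullet> v < 0"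
    using DERIV_neg_dec_right[OF _ neg] g0 by force
  define m where "m = min d (r / (norm v + 1))"
  define t where "t = m / 2"
  have "r / (norm v + 1) > 0" using r by (simp add: add_nonneg_pos)
  then have "m > 0" unfolding m_def using d by simp
  then have t: "t > 0" "t < m" unfolding t_def by simp_all
  have S: "x + s *\<^sub>R v \<in> S" if "0 \<le> s" "s \<le> t" for s using inS[of s] that t unfolding m_def by simp
  have c: "continuous_on {0..t} (\<lambda>s. u (x + s *\<^sub>R v))"
  proof (rule continuous_on_compose2[of S u])
    show "continuous_on S u" using du by (meson continuous_at_imp_continuous_on has_derivative_continuous)
    show "(\<lambda>s. x + s *\<^sub>R v) ` {0..t} \<subseteq> S" using S by auto
  qed (intro continuous_intros)
  obtain s where s: "0 < s" "s < t" "u (x + t *\<^sub>R v) - u x = t * (g (x + s *\<^sub>R v) \<bullet> v)"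
    using line_mvt[OF t(1) _ c, of g] du S by (metis less_imp_le)
  have "g (x + s *\<^sub>R v) \<bullet> v < 0" using d(2)[of s] s t unfolding m_def by simp
  then have "u (x + t *\<^sub>R v) < u x" using s(3) t(1) mult_pos_neg by (metis diff_less_0_iff_less)
  then show False using mn[OF S[of t]] t by simp
qed

text \<open>Some product of \<open>k\<close> eigenvalues is positive; so is each of its subproducts of \<open>j\<close> factors.\<close>

lemma sigma_pos_if_psd:
  fixes B :: "real^'n^'n"
  assumes sB: "transpose B = B" and psd: "\<And>v. (B *v v) \<bullet> v \<ge> 0" and k: "sigma k B > 0" and j: "j \<le> k"
  shows "sigma j B > 0"
proof -
  obtain e l where "eigenbasis B e l" using eigenbasis_exists[OF sB] .
  then interpret eigenbasis B e l .
  have l0: "l i \<ge> 0" for i using psd[of "e i"] by (simp add: eigen orthonormal)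
  have fin: "finite {I. I \<subseteq> (UNIV::'n set) \<and> card I = m}" for m by simp
  have "\<exists>I. card I = k \<and> (\<Prod>i\<in>I. l i) \<noteq> 0"
  proof (rule ccontr)
    assume "\<not> ?thesis"
    then have "esym UNIV k l = 0" unfolding esym_def by (intro sum.neutral) auto
    then show False using k sigma_eq by simp
  qed
  then obtain I where I: "card I = k" "(\<Prod>i\<in>I. l i) \<noteq> 0" by blast
  then obtain J where J: "J \<subseteq> I" "card J = j" using j by (metis obtain_subset_with_card_n)
  have "\<And>i. i \<in> I \<Longrightarrow> l i \<noteq> 0" using I(2) by (auto simp: prod_zero_iff)
  then have "(\<Prod>i\<in>J. l i) > 0" using J l0 by (intro prod_pos) (metis less_eq_real_def subset_iff)
  also have "(\<Prod>i\<in>J. l i) \<le> esym UNIV j l" unfolding esym_def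
    by (rule member_le_sum[OF _ _ fin]) (use J l0 in \<open>auto intro: prod_nonneg\<close>)
  finally show ?thesis unfolding sigma_eq .
qed

text \<open>Maclaurin's inequality turns the open conditions \<open>S\<^sub>j > 0\<close> into the closed conditions
  \<open>S\<^sub>j \<ge> (N choose j)\<close>, so the set where they hold is open and closed in \<open>\<Omega>\<close>.\<close>

lemma garding_cone_connected:
  fixes A :: "real^'n \<Rightarrow> real^'n^'n"
  assumes \<Omega>: "open \<Omega>" "connected \<Omega>" and cA: "continuous_on \<Omega> A" and sA: "\<And>x. x \<in> \<Omega> \<Longrightarrow> transpose (A x) = A x"
    and k: "1 \<le> k" "k \<le> CARD('n)" and sk: "\<And>x. x \<in> \<Omega> \<Longrightarrow> sigma k (A x) = real (CARD('n) choose k)"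
    and x0: "x0 \<in> \<Omega>" "\<And>j. j \<le> k \<Longrightarrow> sigma j (A x0) > 0"
    and x: "x \<in> \<Omega>" and j: "j \<le> k"
  shows "sigma j (A x) > 0"
proof -
  define S where "S = {x \<in> \<Omega>. \<forall>j\<le>k. sigma j (A x) > 0}"
  have b: "real (CARD('n) choose i) > 0" if "i \<le> k" for i using that k by simp
  have S_eq: "S = {x \<in> \<Omega>. \<forall>j\<le>k. sigma j (A x) \<ge> real (CARD('n) choose j)}"
  proof (intro set_eqI iffI)
    fix x assume "x \<in> S"
    then show "x \<in> {x \<in> \<Omega>. \<forall>j\<le>k. sigma j (A x) \<ge> real (CARD('n) choose j)}"
      unfolding S_def using maclaurin_sigma(1)[OF sA k _ sk] by blast
  next
    fix x assume "x \<in> {x \<in> \<Omega>. \<forall>j\<le>k. sigma j (A x) \<ge> real (CARD('n) choose j)}"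
    then show "x \<in> S" unfolding S_def using b less_le_trans by blast
  qed
  have cs: "continuous_on \<Omega> (\<lambda>x. sigma j (A x))" for j by (intro continuous_intros cA)
  have "S = (\<Inter>j\<in>{..k}. {x \<in> \<Omega>. sigma j (A x) > 0})" unfolding S_def by auto
  moreover have "open {x \<in> \<Omega>. sigma j (A x) > 0}" for j
    using continuous_open_preimage[OF cs \<Omega>(1) open_greaterThan[of 0]] by (simp add: vimage_def Int_def)
  ultimately have oS: "open S" by (simp add: open_INT)
  have "closedin (top_of_set \<Omega>) S"
  proof -
    have "S = (\<Inter>j\<in>{..k}. {x \<in> \<Omega>. sigma j (A x) \<ge> real (CARD('n) choose j)})" unfolding S_eq by auto
    moreover have "closedin (top_of_set \<Omega>) {x \<in> \<Omega>. sigma j (A x) \<ge> real (CARD('n) choose j)}" for j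
      using continuous_closedin_preimage[OF cs closed_atLeast[of "real (CARD('n) choose j)"]]
          by (simp add: vimage_def Int_def)
    ultimately show ?thesis by (auto intro!: closedin_INT)
  qed
  moreover have "openin (top_of_set \<Omega>) S" using oS S_def by (auto intro: open_openin_trans \<Omega>)
  ultimately have "S = {} \<or> S = \<Omega>" using \<Omega>(2) unfolding connected_clopen by blast
  moreover have "x0 \<in> S" unfolding S_def using x0 by simp
  ultimately show ?thesis using x j unfolding S_def by blast
qed

locale c2_dirichlet_neumann = c2_dirichlet \<Omega> u g A
  for \<Omega> :: "(real^'n) set" and u g A +
  fixes c :: real
  assumes connected_\<Omega>: "connected \<Omega>" and C2_boundary: "C2_boundary \<Omega>"
    and normal: "\<And>x. x \<in> frontier \<Omega> \<Longrightarrow> g x \<bullet> outer_normal \<Omega> x = c" and c_pos: "c > 0"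
begin

lemma boundary: "x \<in> frontier \<Omega> \<Longrightarrow> \<exists>V \<phi>. local_defining_function \<Omega> x V \<phi>"
  using C2_boundary unfolding C2_boundary_def by blast

lemma g_frontier: "x \<in> frontier \<Omega> \<Longrightarrow> g x = c *\<^sub>R outer_normal \<Omega> x"
  using gradient_parallel_normal[OF open_\<Omega> _ _ cont_u cont_g der_u u_frontier] boundary normal by metis

lemma norm_g: "x \<in> frontier \<Omega> \<Longrightarrow> norm (g x) = c"
  using g_frontier outer_normal_unit[OF open_\<Omega>] boundary c_pos by fastforce

text \<open>The function \<open>(|\<nabla>u|\<^sup>2 - c\<^sup>2)/2\<close> vanishes on the boundary, so its gradient \<open>D\<^sup>2u \<nabla>u\<close> is normal there
  by \<open>gradient_parallel_normal\<close>.\<close>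

lemma tangential: "x \<in> frontier \<Omega> \<Longrightarrow> \<exists>\<mu>. A x *v g x = \<mu> *\<^sub>R g x"
proof -
  assume x: "x \<in> frontier \<Omega>"
  then obtain V \<phi> where L: "local_defining_function \<Omega> x V \<phi>" using boundary by blast
  define f where "f y = (g y \<bullet> g y - c\<^sup>2) / 2" for y
  have "A x *v g x = ((A x *v g x) \<bullet> outer_normal \<Omega> x) *\<^sub>R outer_normal \<Omega> x"
  proof (rule gradient_parallel_normal[OF open_\<Omega> x L, of f "\<lambda>y. A y *v g y"])
    show "continuous_on (closure \<Omega>) f" unfolding f_def divide_inverse by (intro continuous_intros cont_g)
    show "continuous_on (closure \<Omega>) (\<lambda>y. A y *v g y)" by (intro continuous_intros cont_g cont_A)
    show "f y = 0" if "y \<in> frontier \<Omega>" for y unfolding f_def using norm_g[OF that]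
        by (simp add: dot_square_norm)
    show "(f has_derivative (\<lambda>h. (A y *v g y) \<bullet> h)) (at y)" if y: "y \<in> \<Omega>" for y
    proof -
      have "(f has_derivative (\<lambda>h. (g y \<bullet> (A y *v h) + (A y *v h) \<bullet> g y) / 2)) (at y)"
        unfolding f_def[abs_def] by (auto intro!: derivative_eq_intros der_g[OF y])
      moreover have "(A y *v h) \<bullet> g y = (A y *v g y) \<bullet> h" for h
        using symmetric_matrix_inner[OF symmetric_A[OF y], of h "g y"] by (simp add: inner_commute)
      ultimately show ?thesis by (simp add: inner_commute)
    qed
  qed
  then have "A x *v g x = (((A x *v g x) \<bullet> outer_normal \<Omega> x) / c) *\<^sub>R g x"
    unfolding g_frontier[OF x] using c_pos by simp
  then show ?thesis by blast
qed

lemma frontier_nonempty: "frontier \<Omega> \<noteq> {}"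
proof -
  have "\<Omega> \<noteq> UNIV" using bounded_\<Omega> by (metis not_bounded_UNIV)
  then show ?thesis using nonempty by (simp add: frontier_eq_empty)
qed

text \<open>Moving from a boundary point along the inner normal, \<open>u\<close> decreases from \<open>0\<close> because \<open>c > 0\<close>. This
  excludes, for even \<open>k\<close>, the concave branch of the equation.\<close>

lemma interior_negative: "\<exists>y\<in>\<Omega>. u y < 0"
proof -
  obtain x where x: "x \<in> frontier \<Omega>" using frontier_nonempty by blast
  then obtain V \<phi> where L: "local_defining_function \<Omega> x V \<phi>" using boundary by blast
  define \<nu> where "\<nu> = outer_normal \<Omega> x"
  have \<nu>: "\<nu> = sgn (grad \<phi> x)" unfolding \<nu>_def by (rule outer_normal_eq[OF open_\<Omega> x L])
  have a0: "grad \<phi> x \<noteq> 0" by (rule local_defining_functionD[OF L])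
  have "grad \<phi> x \<bullet> (- \<nu>) < 0" unfolding \<nu> using a0 by (simp add: sgn_div_norm dot_square_norm)
  then obtain s1 where s1: "s1 > 0" "\<And>s. 0 < s \<Longrightarrow> s < s1 \<Longrightarrow> x + s *\<^sub>R (- \<nu>) \<in> \<Omega>"
    using line_eventually_inside(1)[OF open_\<Omega> x L, of "- \<nu>"] by blast
  have xc: "x \<in> closure \<Omega>" using x by (simp add: frontier_def)
  have "continuous_on (closure \<Omega>) (\<lambda>y. g y \<bullet> \<nu>)" by (intro continuous_intros cont_g)
  moreover have "g x \<bullet> \<nu> = c" unfolding \<nu>_def by (rule normal[OF x])
  ultimately obtain d where d: "d > 0" "\<And>y. y \<in> closure \<Omega> \<Longrightarrow> dist y x < d \<Longrightarrow> dist (g y \<bullet> \<nu>) c < c"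
    using xc c_pos unfolding continuous_on_iff by metis
  have n\<nu>: "norm \<nu> = 1" unfolding \<nu> using a0 by (simp add: norm_sgn)
  define m where "m = min s1 d"
  define t where "t = m / 2"
  have "m > 0" unfolding m_def using s1 d by simp
  then have t: "t > 0" "t < m" unfolding t_def by simp_all
  have S: "x + s *\<^sub>R (- \<nu>) \<in> \<Omega>" if "0 < s" "s \<le> t" for s using s1(2)[of s] that t unfolding m_def by simp
  have "continuous_on {0..t} (\<lambda>s. u (x + s *\<^sub>R (- \<nu>)))"
  proof (rule continuous_on_compose2[OF cont_u])
    show "(\<lambda>s. x + s *\<^sub>R (- \<nu>)) ` {0..t} \<subseteq> closure \<Omega>"
    proof
      fix y assume "y \<in> (\<lambda>s. x + s *\<^sub>R (- \<nu>)) ` {0..t}"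
      then obtain s where s: "0 \<le> s" "s \<le> t" "y = x + s *\<^sub>R (- \<nu>)" by auto
      then show "y \<in> closure \<Omega>" using S[of s] xc closure_subset by (cases "s = 0") auto
    qed
  qed (intro continuous_intros)
  then obtain s where s: "0 < s" "s < t" "u (x + t *\<^sub>R (- \<nu>)) - u x = t * (g (x + s *\<^sub>R (- \<nu>)) \<bullet> (- \<nu>))"
    using line_mvt[OF t(1), of u g x "- \<nu>"] der_u S by (metis less_imp_le)
  have "x + s *\<^sub>R (- \<nu>) \<in> closure \<Omega>" using S[of s] s closure_subset by auto
  moreover have "dist (x + s *\<^sub>R (- \<nu>)) x < d" using s t n\<nu> unfolding m_def by (simp add: dist_norm)
  ultimately have "g (x + s *\<^sub>R (- \<nu>)) \<bullet> \<nu> > 0" using d(2) by (fastforce simp: dist_real_def)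
  then have "u (x + t *\<^sub>R (- \<nu>)) < 0" using s(3) t(1) u_frontier[OF x] by (simp add: mult_pos_pos)
  then show ?thesis using S[of t] t by blast
qed

text \<open>The Hessian is positive semidefinite at an interior minimum, hence in the cone everywhere. In particular
  \<open>\<Delta>u > 0\<close>, so \<open>u\<close> has no interior maximum and is negative, and the integral argument applies.\<close>

theorem serrin_rigidity:
  assumes k: "1 \<le> k" "k \<le> CARD('n)" and sk: "\<And>x. x \<in> \<Omega> \<Longrightarrow> sigma k (A x) = real (CARD('n) choose k)"
  shows "(\<forall>x\<in>\<Omega>. A x = mat 1) \<and> (\<forall>x\<in>\<Omega>. u x < 0)"
proof -
  have cAO: "continuous_on \<Omega> A" using cont_A closure_subset by (rule continuous_on_subset)
  obtain y where y: "y \<in> closure \<Omega>" "\<And>z. z \<in> closure \<Omega> \<Longrightarrow> u y \<le> u z"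
    using continuous_attains_inf[OF compact_closure _ cont_u] nonempty by auto
  have "u y < 0" using interior_negative y(2) closure_subset by fastforce
  then have yO: "y \<in> \<Omega>" using closure_cases[OF y(1)] u_frontier by fastforce
  have psd: "(A y *v v) \<bullet> v \<ge> 0" for v
    by (rule psd_at_interior_min[OF open_\<Omega> yO der_u der_g[OF yO]]) (use y(2) closure_subset in auto)
  have "sigma k (A y) > 0" unfolding sk[OF yO] using k by simp
  then have pos0: "sigma j (A y) > 0" if "j \<le> k" for j
      using sigma_pos_if_psd[OF symmetric_A[OF yO] psd _ that] by blast
  have pos: "sigma j (A x) > 0" if "x \<in> \<Omega>" "j \<le> k" for x j
    by (rule garding_cone_connected[OF open_\<Omega> connected_\<Omega> cAO symmetric_A k sk yO pos0 that])
  obtain z where z: "z \<in> closure \<Omega>" "\<And>w. w \<in> closure \<Omega> \<Longrightarrow> u w \<le> u z"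
    using continuous_attains_sup[OF compact_closure _ cont_u] nonempty by auto
  have max_not_interior: False if x: "x \<in> \<Omega>" and mx: "\<And>w. w \<in> \<Omega> \<Longrightarrow> u w \<le> u x" for x
  proof -
    have "(- (A x *v v)) \<bullet> v \<ge> 0" for v
    proof (rule psd_at_interior_min[OF open_\<Omega> x, of "\<lambda>x. - u x" "\<lambda>x. - g x"])
      show "((\<lambda>x. - u x) has_derivative (\<lambda>h. - g y \<bullet> h)) (at y)" if "y \<in> \<Omega>" for y
        using has_derivative_minus[OF der_u[OF that]] by simp
      show "((\<lambda>x. - g x) has_derivative (\<lambda>v. - (A x *v v))) (at x)"
          by (rule has_derivative_minus[OF der_g[OF x]])
    qed (use mx in simp)
    then have nsd: "(A x *v v) \<bullet> v \<le> 0" for v by simp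
    have "trace (A x) \<le> 0" unfolding trace_def
    proof (rule sum_nonpos)
      fix i
      show "A x $ i $ i \<le> 0" using nsd[of "axis i 1"]
        by (simp add: inner_axis matrix_vector_mult_basis column_def)
    qed
    then show False using pos[OF x k(1)] trace_eq_sigma_1[OF symmetric_A[OF x]] by simp
  qed
  have neg: "u x < 0" if x: "x \<in> \<Omega>" for x
  proof -
    have zf: "z \<in> frontier \<Omega>" using closure_cases[OF z(1)] max_not_interior[of z] z(2) closure_subset by blast
    show ?thesis
    proof (rule ccontr)
      assume "\<not> u x < 0"
      then have "u w \<le> u x" if "w \<in> \<Omega>" for w
        using z(2)[of w] that closure_subset u_frontier[OF zf] by fastforce
      then show False using max_not_interior[OF x] by blast
    qed
  qed
  interpret overdetermined \<Omega> u g A c k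
    by unfold_locales (use neg norm_g c_pos k tangential sk pos in auto)
  show ?thesis using hessian_identity neg by blast
qed

end

text \<open>Integrating twice shows that \<open>u\<close> is a paraboloid around some \<open>x0\<close>. Its sign inside and its zeros on the
  boundary confine \<open>\<Omega>\<close> to a ball and the boundary to the sphere; a connected ball that meets \<open>\<Omega>\<close> but not its
  boundary is contained in \<open>\<Omega>\<close>.\<close>

lemma quadratic_solution_ball:
  fixes u :: "real^'n \<Rightarrow> real"
  assumes \<Omega>: "open \<Omega>" "connected \<Omega>" "bounded \<Omega>" "\<Omega> \<noteq> {}" and s: "s > 0"
    and du: "\<And>x. x \<in> \<Omega> \<Longrightarrow> (u has_derivative (\<lambda>h. g x \<bullet> h)) (at x)"
    and dg: "\<And>x. x \<in> \<Omega> \<Longrightarrow> (g has_derivative (\<lambda>h. s *\<^sub>R h)) (at x)"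
    and cu: "continuous_on (closure \<Omega>) u"
    and neg: "\<And>x. x \<in> \<Omega> \<Longrightarrow> u x < 0" and z: "\<And>x. x \<in> frontier \<Omega> \<Longrightarrow> u x = 0"
  shows "\<exists>x0 R. R > 0 \<and> \<Omega> = ball x0 R \<and> (\<forall>x\<in>closure \<Omega>. u x = s * U_fun R x0 x)"
proof -
  obtain y where y: "y \<in> \<Omega>" using \<Omega>(4) by blast
  define b where "b = g y - s *\<^sub>R y"
  have g: "g x = s *\<^sub>R x + b" if x: "x \<in> \<Omega>" for x
  proof -
    have "g x - s *\<^sub>R x = g y - s *\<^sub>R y"
    proof (rule has_derivative_zero_unique_connected[OF \<Omega>(1,2) _ x y])
      show "((\<lambda>x. g x - s *\<^sub>R x) has_derivative (\<lambda>x. 0)) (at x)" if "x \<in> \<Omega>" for x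
        using has_derivative_diff[OF dg[OF that] has_derivative_scaleR_right[OF has_derivative_ident, of
            s]] by simp
    qed
    then show ?thesis unfolding b_def by (simp add: algebra_simps)
  qed
  define x0 where "x0 = - (b /\<^sub>R s)"
  have g': "g x = s *\<^sub>R (x - x0)" if "x \<in> \<Omega>" for x unfolding g[OF that] x0_def using s
      by (simp add: scaleR_diff_right scaleR_add_right)
  define d where "d x = u x - s * (norm (x - x0))\<^sup>2 / 2" for x
  have cd: "continuous_on (closure \<Omega>) d" unfolding d_def divide_inverse by (intro continuous_intros cu)
  have dO: "d x = d y" if x: "x \<in> \<Omega>" for x
  proof (rule has_derivative_zero_unique_connected[OF \<Omega>(1,2) _ x y])
    fix x assume x: "x \<in> \<Omega>"
    have "((\<lambda>x. s * ((x - x0) \<bullet> (x - x0)) / 2) has_derivative (\<lambda>h. g x \<bullet> h)) (at x)"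
    proof -
      have "((\<lambda>x. (x - x0) \<bullet> (x - x0)) has_derivative (\<lambda>h. (x - x0) \<bullet> (h - 0) + (h - 0) \<bullet> (x - x0))) (at x)"
        by (intro has_derivative_inner has_derivative_diff has_derivative_ident has_derivative_const)
      from has_derivative_mult_right[OF this, of "s / 2"] show ?thesis
        unfolding g'[OF x] by (simp add: inner_commute[of _ "x - x0"] mult.assoc)
    qed
    from has_derivative_diff[OF du[OF x] this] show "(d has_derivative (\<lambda>x. 0)) (at x)"
      unfolding d_def[abs_def] by (simp add: dot_square_norm)
  qed
  have dc: "d x = d y" if x: "x \<in> closure \<Omega>" for x
    by (rule continuous_constant_on_closure[OF cd dO x])
  define R where "R = sqrt (- 2 * d y / s)"
  have "s * (norm (y - x0))\<^sup>2 / 2 \<ge> 0" using s by simp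
  then have "d y < 0" using neg[OF y] unfolding d_def by linarith
  then have "- 2 * d y / s > 0" using s by (intro divide_pos_pos) auto
  then have R: "R > 0" "R\<^sup>2 = - 2 * d y / s" unfolding R_def by simp_all
  have u: "u x = s * U_fun R x0 x" if "x \<in> closure \<Omega>" for x
  proof -
    have "s * R\<^sup>2 = - 2 * d y" unfolding R(2) using s by simp
    moreover have "u x = d y + s * (norm (x - x0))\<^sup>2 / 2" using dc[OF that] unfolding d_def[of x] by simp
    ultimately show ?thesis unfolding U_fun_def by (simp add: right_diff_distrib diff_divide_distrib)
  qed
  have sub: "\<Omega> \<subseteq> ball x0 R"
  proof
    fix x assume x: "x \<in> \<Omega>"
    then have "s * U_fun R x0 x < 0" using u[of x] neg[OF x] closure_subset by fastforce
    then have "(norm (x - x0))\<^sup>2 < R\<^sup>2" using s unfolding U_fun_def by (simp add: mult_less_0_iff)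
    then have "norm (x - x0) < R" using R(1) by (simp add: power_less_imp_less_base)
    then show "x \<in> ball x0 R" by (simp add: dist_norm norm_minus_commute)
  qed
  have "ball x0 R \<inter> frontier \<Omega> = {}"
  proof (rule ccontr)
    assume "ball x0 R \<inter> frontier \<Omega> \<noteq> {}"
    then obtain x where x: "x \<in> ball x0 R" "x \<in> frontier \<Omega>" by blast
    then have "s * U_fun R x0 x = 0" using u[of x] z by (simp add: frontier_def)
    then have "(norm (x - x0))\<^sup>2 = R\<^sup>2" using s unfolding U_fun_def by simp
    then have "norm (x - x0) = R" using R(1) by simp
    then show False using x(1) by (simp add: dist_norm norm_minus_commute)
  qed
  moreover have "ball x0 R \<inter> \<Omega> \<noteq> {}" using sub y by blast
  ultimately have "ball x0 R - \<Omega> = {}" using connected_Int_frontier[of "ball x0 R" \<Omega>] by (metis connected_ball)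
  then have "\<Omega> = ball x0 R" using sub by blast
  then show ?thesis using R(1) u by blast
qed

section \<open>Counting solutions on a ball\<close>

lemma Lp_norm_cong:
  assumes "\<And>x. x \<in> S \<Longrightarrow> norm (f x) = norm (f' x)"
    and S: "S \<in> sets lebesgue"
  shows "Lp_norm p S f = Lp_norm p S f'"
proof -
  have sp: "space (lebesgue_on S) = S" by simp
  have "(\<lambda>x. ereal (norm (f x))) \<in> borel_measurable (lebesgue_on S)
      \<longleftrightarrow> (\<lambda>x. ereal (norm (f' x))) \<in> borel_measurable (lebesgue_on S)"
    by (rule measurable_cong) (use assms sp in auto)
  moreover have "AE x in lebesgue_on S. ereal (norm (f x)) = ereal (norm (f' x))"
    by (rule AE_I2) (use assms sp in auto)
  ultimately have "esssup (lebesgue_on S) (\<lambda>x. ereal (norm (f x)))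
      = esssup (lebesgue_on S) (\<lambda>x. ereal (norm (f' x)))"
    by (cases "(\<lambda>x. ereal (norm (f x))) \<in> borel_measurable (lebesgue_on S)")
        (auto intro: esssup_AE_cong simp: esssup_non_measurable)
  moreover have "(\<integral>x. norm (f x) powr enn2real p \<partial>lebesgue_on S)
      = (\<integral>x. norm (f' x) powr enn2real p \<partial>lebesgue_on S)"
    by (rule Bochner_Integration.integral_cong) (use assms sp in auto)
  ultimately show ?thesis unfolding Lp_norm_def by simp
qed

lemma Lp_norm_scaleR:
  assumes s: "s > 0" and p: "p > 0"
  shows "Lp_norm p S (\<lambda>x. s *\<^sub>R f x) = s * Lp_norm p S f"
proof (cases "p = \<infinity>")
  case True
  have "(\<lambda>x. ereal (norm (s *\<^sub>R f x))) = (\<lambda>x. ereal s * ereal (norm (f x)))" using s by (auto simp: fun_eq_iff)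
  then show ?thesis unfolding Lp_norm_def using True esssup_cmult[OF s, of "lebesgue_on S" "\<lambda>x. ereal
      (norm (f x))"] by simp
next
  case False
  have r: "enn2real p > 0" using False p by (simp add: enn2real_positive_iff less_top)
  have "(\<integral>x. norm (s *\<^sub>R f x) powr enn2real p \<partial>lebesgue_on S)
      = s powr enn2real p * (\<integral>x. norm (f x) powr enn2real p \<partial>lebesgue_on S)"
    using s by (simp add: powr_mult)
  then show ?thesis unfolding Lp_norm_def using False s r by (simp add: powr_mult powr_powr)
qed

text \<open>The set where \<open>f\<close> is nonzero is open, and nonempty open sets are not negligible.\<close>

lemma not_AE_zero_if_continuous:
  fixes f :: "'a::euclidean_space \<Rightarrow> 'b::real_normed_vector"
  assumes op: "open S" and cf: "continuous_on S f" and x: "x \<in> S" "f x \<noteq> 0"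
  shows "\<not> (AE x in lebesgue_on S. f x = 0)"
proof
  assume "AE x in lebesgue_on S. f x = 0"
  then have "AE x in lebesgue. x \<in> S \<longrightarrow> f x = 0" using op by (subst (asm) AE_restrict_space_iff) auto
  then have "{x \<in> space lebesgue. \<not> (x \<in> S \<longrightarrow> f x = 0)} \<in> null_sets lebesgue"
      by (simp only: completion.AE_iff_null_sets)
  then have "negligible {x \<in> S. f x \<noteq> 0}" by (simp add: negligible_iff_null_sets)
  moreover have "open {x \<in> S. f x \<noteq> 0}"
    using continuous_open_preimage[OF cf op, of "- {0}"] by (simp add: vimage_def Int_def open_Compl)
  ultimately show False using open_not_negligible x by blast
qed

lemma Lp_norm_pos:
  fixes f :: "'a::euclidean_space \<Rightarrow> 'b::euclidean_space"
  assumes op: "open S" and bd: "bounded S" and cf: "continuous_on S f" and K: "\<And>x. x \<in> S \<Longrightarrow> norm (f x) \<le> K"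
    and x: "x \<in> S" "f x \<noteq> 0" and p: "p > 0"
  shows "Lp_norm p S f > 0"
proof -
  have lm: "S \<in> lmeasurable" using op bd by (simp add: lmeasurable_open)
  have sl: "S \<in> sets lebesgue" using lm by (rule fmeasurableD)
  have fm: "f \<in> borel_measurable (lebesgue_on S)" by (rule continuous_imp_measurable_on_sets_lebesgue[OF cf sl])
  have sp: "space (lebesgue_on S) = S" by simp
  show ?thesis
  proof (cases "p = \<infinity>")
    case True
    define E where "E = esssup (lebesgue_on S) (\<lambda>x. ereal (norm (f x)))"
    have m: "(\<lambda>x. ereal (norm (f x))) \<in> borel_measurable (lebesgue_on S)" using fm by measurable
    have "E \<le> ereal K" unfolding E_def by (rule esssup_I[OF m]) (rule AE_I2, use K sp in auto)
    moreover have "E > 0"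
    proof (rule ccontr)
      assume "\<not> E > 0"
      then have "E \<le> 0" by simp
      have "AE x in lebesgue_on S. ereal (norm (f x)) \<le> E" unfolding E_def by (rule esssup_AE)
      then have "AE x in lebesgue_on S. f x = 0"
      proof (rule AE_mp, intro AE_I2 impI)
        fix x assume "ereal (norm (f x)) \<le> E"
        then have "ereal (norm (f x)) \<le> 0" using \<open>E \<le> 0\<close> by (rule order_trans)
        then show "f x = 0" by simp
      qed
      then show False using not_AE_zero_if_continuous[OF op cf x] by blast
    qed
    ultimately have "real_of_ereal E > 0" by (cases E) auto
    then show ?thesis unfolding Lp_norm_def E_def using True by simp
  next
    case False
    define r where "r = enn2real p"
    have r: "r > 0" unfolding r_def using False p by (simp add: enn2real_positive_iff less_top)
    interpret finite_measure "lebesgue_on S" by (rule finite_measure_lebesgue_on[OF lm])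
    have int: "integrable (lebesgue_on S) (\<lambda>x. norm (f x) powr r)"
    proof (rule integrable_const_bound[where B = "K powr r"])
      show "AE x in lebesgue_on S. norm (norm (f x) powr r) \<le> K powr r"
        by (rule AE_I2) (use K sp r in \<open>auto intro!: powr_mono2\<close>)
      show "(\<lambda>x. norm (f x) powr r) \<in> borel_measurable (lebesgue_on S)" using fm by measurable
    qed
    have "(\<integral>x. norm (f x) powr r \<partial>lebesgue_on S) \<noteq> 0"
    proof
      assume "(\<integral>x. norm (f x) powr r \<partial>lebesgue_on S) = 0"
      then have "AE x in lebesgue_on S. norm (f x) powr r = 0"
        by (subst (asm) integral_nonneg_eq_0_iff_AE[OF int]) auto
      then have "AE x in lebesgue_on S. f x = 0" by simp
      then show False using not_AE_zero_if_continuous[OF op cf x] by blast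
    qed
    then show ?thesis unfolding Lp_norm_def r_def using False by simp
  qed
qed

lemma bounded_on_closure:
  fixes f :: "'a::euclidean_space \<Rightarrow> 'b::real_normed_vector"
  assumes "bounded S" "continuous_on (closure S) f"
  obtains K where "\<And>x. x \<in> S \<Longrightarrow> norm (f x) \<le> K"
proof -
  have "bounded (f ` closure S)"
    using assms by (intro compact_imp_bounded compact_continuous_image) (auto simp: compact_closure)
  then show ?thesis using that closure_subset unfolding bounded_iff by (metis imageI subsetD)
qed

lemma U_fun_has_derivative: "(U_fun R x0 has_derivative (\<lambda>h. (x - x0) \<bullet> h)) (at x)"
proof -
  have "((\<lambda>x. (x - x0) \<bullet> (x - x0)) has_derivative (\<lambda>h. (x - x0) \<bullet> (h - 0) + (h - 0) \<bullet> (x - x0))) (at x)"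
    by (intro has_derivative_inner has_derivative_diff has_derivative_ident has_derivative_const)
  from has_derivative_mult_right[OF has_derivative_diff[OF this has_derivative_const], of "1/2" "R\<^sup>2"]
  show ?thesis unfolding U_fun_def[abs_def] by (simp add: dot_square_norm inner_commute)
qed

lemma grad_U_fun: "grad (U_fun R x0) x = x - x0"
  by (rule grad_eqI[OF U_fun_has_derivative])

lemma scaled_U_fun:
  fixes x0 :: "real^'n"
  assumes v: "\<forall>x\<in>ball x0 R. v x = s * U_fun R x0 x" and x: "x \<in> ball x0 R"
  shows "v differentiable (at x)" "grad v x = s *\<^sub>R (x - x0)" "grad v differentiable (at x)" "hessian v x
      = s *\<^sub>R mat 1"
proof -
  have d: "(v has_derivative (\<lambda>h. (s *\<^sub>R (y - x0)) \<bullet> h)) (at y)" if y: "y \<in> ball x0 R" for y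
  proof -
    have "((\<lambda>x. s * U_fun R x0 x) has_derivative (\<lambda>h. s * ((y - x0) \<bullet> h))) (at y)"
      by (rule has_derivative_mult_right[OF U_fun_has_derivative])
    then have "(v has_derivative (\<lambda>h. s * ((y - x0) \<bullet> h))) (at y)"
      by (rule has_derivative_transform_within_open[OF _ open_ball y]) (simp add: v)
    then show ?thesis by simp
  qed
  show "v differentiable (at x)" using d[OF x] unfolding differentiable_def by blast
  have g: "grad v y = s *\<^sub>R (y - x0)" if "y \<in> ball x0 R" for y by (rule grad_eqI[OF d[OF that]])
  show "grad v x = s *\<^sub>R (x - x0)" by (rule g[OF x])
  have "((\<lambda>y. s *\<^sub>R (y - x0)) has_derivative (\<lambda>h. s *\<^sub>R (h - 0))) (at x)"
    by (intro has_derivative_scaleR_right has_derivative_diff has_derivative_ident has_derivative_const)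
  then have "(grad v has_derivative (\<lambda>h. s *\<^sub>R (h - 0))) (at x)"
    by (rule has_derivative_transform_within_open[OF _ open_ball x]) (simp add: g)
  moreover have "(*v) (s *\<^sub>R mat 1) = (\<lambda>h::real^'n. s *\<^sub>R (h - 0))"
    by (rule ext) (simp only: scaleR_matrix_vector_assoc[symmetric] matrix_vector_mul_lid diff_zero)
  ultimately have dg: "(grad v has_derivative (*v) (s *\<^sub>R mat 1)) (at x)" by simp
  then show "grad v differentiable (at x)" unfolding differentiable_def by blast
  show "hessian v x = s *\<^sub>R mat 1" by (rule hessian_eqI[OF dg])
qed

lemma sigma_mat_1: "sigma j (mat 1 :: real^'n^'n) = real (CARD('n) choose j)"
proof -
  have "{I :: 'n set. card I = j} = {I. I \<subseteq> UNIV \<and> card I = j}" by simp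
  then have "card {I :: 'n set. card I = j} = CARD('n) choose j" by (simp only: n_subsets finite)
  moreover have "(\<chi> i. if i \<in> I then mat 1 $ i else mat 1 $ i) = (mat 1 :: real^'n^'n)" for I :: "'n set"
    by (simp add: vec_eq_iff)
  ultimately show ?thesis unfolding sigma_def by simp
qed

lemma transpose_scaled_mat_1: "transpose (s *\<^sub>R mat 1) = (s *\<^sub>R mat 1 :: real^'n^'n)"
  by (simp add: transpose_def mat_def vec_eq_iff)

lemma ball_defining_function:
  fixes x0 :: "real^'n"
  assumes R: "R > 0" and x: "x \<in> frontier (ball x0 R)"
  shows "local_defining_function (ball x0 R) x UNIV (U_fun R x0)"
proof -
  have nx: "norm (x - x0) = R" using x R by (simp add: frontier_ball dist_norm norm_minus_commute)
  have U: "U_fun R x0 differentiable (at y)" "grad (U_fun R x0) differentiable (at y)" "hessian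
      (U_fun R x0) y = mat 1" for y
  proof -
    have y: "y \<in> ball x0 (norm (y - x0) + 1)" by (simp add: dist_norm norm_minus_commute)
    define R' where "R' = norm (y - x0) + 1"
    show "U_fun R x0 differentiable (at y)" using U_fun_has_derivative unfolding differentiable_def by blast
    have e: "grad (U_fun R x0) = grad (U_fun R' x0)" by (rule ext) (simp add: grad_U_fun)
    then have "hessian (U_fun R x0) = hessian (U_fun R' x0)" unfolding hessian_def[abs_def] by simp
    then show "grad (U_fun R x0) differentiable (at y)" "hessian (U_fun R x0) y = mat 1"
      using scaled_U_fun(3,4)[of x0 R' "U_fun R' x0" 1 y] y e unfolding R'_def by simp_all
  qed
  have "y \<in> ball x0 R \<longleftrightarrow> U_fun R x0 y < 0" for y
  proof -
    have "norm (y - x0) < R \<longleftrightarrow> (norm (y - x0))\<^sup>2 < R\<^sup>2" 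
      using R power_strict_mono[of "norm (y - x0)" R 2] power2_less_imp_less[of "norm (y - x0)" R] by auto
    then show ?thesis unfolding U_fun_def by (simp add: dist_norm norm_minus_commute)
  qed
  moreover have "x \<noteq> x0" using nx R by auto
  moreover have "continuous_on UNIV (hessian (U_fun R x0))"
      by (rule continuous_on_eq[of _ "\<lambda>x. mat 1"]) (auto simp: U(3))
  ultimately show ?thesis unfolding local_defining_function_def C2_on_def using U(1,2)
      by (auto simp: grad_U_fun)
qed

lemma bounded_C2_domain_ball:
  fixes x0 :: "real^'n"
  assumes "R > 0" shows "bounded_C2_domain (ball x0 R)"
  unfolding bounded_C2_domain_def C2_boundary_def
proof (intro conjI ballI)
  show "\<exists>V \<phi>. local_defining_function (ball x0 R) x V \<phi>" if "x \<in> frontier (ball x0 R)" for x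
    using ball_defining_function[OF assms that] by blast
qed (use assms in simp_all)

lemma frontier_imp_U_zero:
  fixes x0 :: "real^'n"
  assumes "R > 0" "x \<in> frontier (ball x0 R)" shows "U_fun R x0 x = 0"
  using assms unfolding U_fun_def by (simp add: frontier_ball dist_norm norm_minus_commute)

lemma Lp_norm_scaled_U_fun:
  fixes x0 :: "real^'n"
  assumes s: "s > 0" and v: "\<forall>x\<in>ball x0 R. v x = s * U_fun R x0 x" and p: "p > 0"
  shows "Lp_norm p (ball x0 R) v = s * U_norm p R x0" "Lp_norm p (ball x0 R) (grad v) = s * grad_U_norm p R x0"
proof -
  have "Lp_norm p (ball x0 R) v = Lp_norm p (ball x0 R) (\<lambda>x. s *\<^sub>R U_fun R x0 x)"
    by (rule Lp_norm_cong) (simp_all add: v)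
  then show "Lp_norm p (ball x0 R) v = s * U_norm p R x0" unfolding U_norm_def
      using Lp_norm_scaleR[OF s p] by metis
  have "Lp_norm p (ball x0 R) (grad v) = Lp_norm p (ball x0 R) (\<lambda>x. s *\<^sub>R grad (U_fun R x0) x)"
    by (rule Lp_norm_cong) (simp_all add: grad_U_fun scaled_U_fun(2)[OF v])
  then show "Lp_norm p (ball x0 R) (grad v) = s * grad_U_norm p R x0" unfolding grad_U_norm_def
      using Lp_norm_scaleR[OF s p] by metis
qed

lemma U_norm_pos:
  fixes x0 :: "real^'n"
  assumes R: "R > 0" and p: "p > 0"
  shows "U_norm p R x0 > 0" "grad_U_norm p R x0 > 0"
proof -
  have c: "continuous_on A (U_fun R x0)" "continuous_on A (grad (U_fun R x0))" for A
    unfolding U_fun_def grad_U_fun[abs_def] divide_inverse by (intro continuous_intros)+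
  obtain K1 where K1: "\<And>x. x \<in> ball x0 R \<Longrightarrow> norm (U_fun R x0 x) \<le> K1"
    using bounded_on_closure[OF bounded_ball c(1)] by blast
  obtain K2 where K2: "\<And>x. x \<in> ball x0 R \<Longrightarrow> norm (grad (U_fun R x0) x) \<le> K2"
    using bounded_on_closure[OF bounded_ball c(2)] by blast
  have "U_fun R x0 x0 \<noteq> 0" unfolding U_fun_def using R by simp
  then show "U_norm p R x0 > 0" unfolding U_norm_def
    by (intro Lp_norm_pos[OF open_ball bounded_ball c(1) K1 _ _ p, of x0]) (use R in auto)
  obtain b :: "real^'n" where b: "norm b = R / 2" using vector_choose_size[of "R / 2"] R by auto
  have "x0 + b \<in> ball x0 R" "grad (U_fun R x0) (x0 + b) \<noteq> 0" unfolding grad_U_fun using b R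
      by (auto simp: dist_norm)
  then show "grad_U_norm p R x0 > 0" unfolding grad_U_norm_def
    by (intro Lp_norm_pos[OF open_ball bounded_ball c(2) K2 _ _ p])
qed

context
  fixes M :: "real \<Rightarrow> real \<Rightarrow> real" and k :: nat and p q :: ennreal and lam :: real
  assumes k: "1 \<le> k" "k \<le> CARD('n::finite)"
    and p: "0 < p" and q: "0 < q" and lam: "0 < lam"
    and M: "\<forall>s>0. \<forall>t>0. M s t > 0"
begin

text \<open>Both norms are positive, so \<open>M\<close> is evaluated where it is known to be positive and the equation is
  \<open>S\<^sub>k(D\<^sup>2u) = \<mu>\<close> with a constant \<open>\<mu> > 0\<close>. Dividing \<open>u\<close> by \<open>s\<close> with \<open>s\<^sup>k (N choose k) = \<mu>\<close> normalizes it.\<close>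

lemma solution_structure:
  fixes \<Omega> :: "(real^'n) set"
  assumes dom: "bounded_C2_domain \<Omega>" and sol: "is_solution \<Omega> k p q lam M u"
  shows "\<exists>x0 R s. R > 0 \<and> \<Omega> = ball x0 R \<and> s > 0 \<and> (\<forall>x\<in>closure \<Omega>. u x = s * U_fun R x0 x) \<and>
    M (Lp_norm p \<Omega> u) (Lp_norm q \<Omega> (grad u)) * s ^ k * real (CARD('n) choose k) = lam"
proof -
  have \<Omega>: "open \<Omega>" "connected \<Omega>" "bounded \<Omega>" "\<Omega> \<noteq> {}" using dom unfolding bounded_C2_domain_def by auto
  have bd: "C2_boundary \<Omega>" using dom unfolding bounded_C2_domain_def by auto
  have C2: "C2_on \<Omega> u" and cu: "continuous_on (closure \<Omega>) u"
    using sol unfolding is_solution_def C2_closure_def by auto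
  obtain G where G: "continuous_on (closure \<Omega>) G" "\<And>x. x \<in> \<Omega> \<Longrightarrow> G x = grad u x"
    using sol unfolding is_solution_def C2_closure_def by auto
  obtain H where H: "continuous_on (closure \<Omega>) H" "\<And>x. x \<in> \<Omega> \<Longrightarrow> H x = hessian u x"
    using sol unfolding is_solution_def C2_closure_def by auto
  obtain c where c: "c > 0" "\<And>x. x \<in> frontier \<Omega> \<Longrightarrow> normal_derivative \<Omega> u x = c"
    using sol unfolding is_solution_def by auto
  define a b where "a = Lp_norm p \<Omega> u" and "b = Lp_norm q \<Omega> (grad u)"
  have eq: "M a b * S_elem k (hessian u x) = lam" if "x \<in> \<Omega>" for x
    using sol that unfolding is_solution_def a_def b_def by auto
  have uf: "u x = 0" if "x \<in> frontier \<Omega>" for x using sol that unfolding is_solution_def by auto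
  have du: "(u has_derivative (\<lambda>h. G x \<bullet> h)) (at x)" if "x \<in> \<Omega>" for x
    using C2 that has_derivative_grad[of u x] unfolding C2_on_def G(2)[OF that] by blast
  have dG: "(G has_derivative (*v) (H x)) (at x)" if x: "x \<in> \<Omega>" for x
  proof -
    have "(grad u has_derivative (*v) (H x)) (at x)"
      using C2 x has_derivative_hessian[of u x] unfolding C2_on_def H(2)[OF x] by blast
    then show ?thesis by (rule has_derivative_transform_within_open[OF _ \<Omega>(1) x]) (simp add: G(2))
  qed
  have nd: "G x \<bullet> outer_normal \<Omega> x = c" if "x \<in> frontier \<Omega>" for x
    using normal_derivative_eq[OF \<Omega>(1) that G] c(2)[OF that] by simp
  interpret c2_dirichlet_neumann \<Omega> u G H c
    by unfold_locales (use \<Omega> bd du dG cu G H uf nd c in auto)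
  have a: "a > 0"
  proof -
    obtain K where K: "\<And>x. x \<in> \<Omega> \<Longrightarrow> norm (u x) \<le> K" using bounded_on_closure[OF \<Omega>(3) cu] by blast
    obtain y where "y \<in> \<Omega>" "u y \<noteq> 0" using interior_negative by force
    then show ?thesis unfolding a_def
      by (intro Lp_norm_pos[OF \<Omega>(1,3) continuous_on_subset[OF cu closure_subset] K _ _ p])
  qed
  have b: "b > 0"
  proof -
    obtain K where K: "\<And>x. x \<in> \<Omega> \<Longrightarrow> norm (G x) \<le> K" using bounded_on_closure[OF \<Omega>(3) G(1)] by blast
    have "\<exists>y\<in>\<Omega>. G y \<noteq> 0"
    proof (rule ccontr)
      assume n: "\<not> ?thesis"
      obtain x where x: "x \<in> frontier \<Omega>" using frontier_nonempty by blast
      have "G x = 0" by (rule continuous_constant_on_closure[OF G(1)]) (use n x in \<open>auto simp: frontier_def\<close>)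
      then show False using norm_g[OF x] c by simp
    qed
    then obtain y where "y \<in> \<Omega>" "G y \<noteq> 0" by blast
    then have "Lp_norm q \<Omega> G > 0"
      by (intro Lp_norm_pos[OF \<Omega>(1,3) continuous_on_subset[OF G(1) closure_subset] K _ _ q])
    moreover have "Lp_norm q \<Omega> G = b" unfolding b_def using \<Omega>(1) by (intro Lp_norm_cong) (simp_all add: G(2))
    ultimately show ?thesis by simp
  qed
  define C where "C = real (CARD('n) choose k)"
  have C: "C > 0" unfolding C_def using k by simp
  have Mab: "M a b > 0" using M a b by blast
  define \<mu> where "\<mu> = lam / M a b"
  have \<mu>: "\<mu> > 0" unfolding \<mu>_def using lam Mab by simp
  have sk: "sigma k (H x) = \<mu>" if x: "x \<in> \<Omega>" for x
    using eq[OF x] S_elem_symmetric[OF symmetric_A[OF x], of k] Mab unfolding H(2)[OF x] \<mu>_def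
        by (simp add: field_simps)
  define s where "s = root k (\<mu> / C)"
  have s: "s > 0" "s ^ k = \<mu> / C" unfolding s_def using \<mu> C k
      by (simp_all add: real_root_gt_zero real_root_pow_pos)
  define r where "r = 1 / s"
  have r: "r > 0" "r * s = 1" unfolding r_def using s by auto
  interpret scaled: c2_dirichlet_neumann \<Omega> "\<lambda>x. r * u x" "\<lambda>x. r *\<^sub>R G x" "\<lambda>x. r *\<^sub>R H x" "r * c"
  proof unfold_locales
    fix x assume x: "x \<in> \<Omega>"
    show "((\<lambda>x. r * u x) has_derivative (\<lambda>h. (r *\<^sub>R G x) \<bullet> h)) (at x)"
      using has_derivative_mult_right[OF du[OF x], of r] by simp
    show "((\<lambda>x. r *\<^sub>R G x) has_derivative (*v) (r *\<^sub>R H x)) (at x)"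
      using has_derivative_scaleR_right[OF dG[OF x], of r] by (simp add: scaleR_matrix_vector_assoc)
  qed (use \<Omega> bd cu G(1) H(1) uf nd c r in \<open>auto intro!: continuous_intros\<close>)
  have "(\<forall>x\<in>\<Omega>. r *\<^sub>R H x = mat 1) \<and> (\<forall>x\<in>\<Omega>. r * u x < 0)"
  proof (rule scaled.serrin_rigidity[OF k])
    fix x assume x: "x \<in> \<Omega>"
    have "sigma k (r *\<^sub>R H x) = r ^ k * (s ^ k * C)" unfolding sigma_scaleR sk[OF x] s(2) using C by simp
    also have "\<dots> = C" using r(2) by (metis mult.assoc mult_1 power_mult_distrib power_one)
    finally show "sigma k (r *\<^sub>R H x) = real (CARD('n) choose k)" unfolding C_def .
  qed
  then have HI: "H x = s *\<^sub>R mat 1" and neg: "u x < 0" if "x \<in> \<Omega>" for x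
  proof -
    assume *: "(\<forall>x\<in>\<Omega>. r *\<^sub>R H x = mat 1) \<and> (\<forall>x\<in>\<Omega>. r * u x < 0)"
    have "s *\<^sub>R (r *\<^sub>R H x) = s *\<^sub>R mat 1" using * that by simp
    then show "H x = s *\<^sub>R mat 1" using r(2) by (simp add: mult.commute)
    show "u x < 0" using * that r(1) by (auto simp: mult_less_0_iff)
  qed
  have "\<exists>x0 R. R > 0 \<and> \<Omega> = ball x0 R \<and> (\<forall>x\<in>closure \<Omega>. u x = s * U_fun R x0 x)"
  proof (rule quadratic_solution_ball[OF \<Omega> s(1) du _ cu neg uf])
    show "(G has_derivative (\<lambda>h. s *\<^sub>R h)) (at x)" if "x \<in> \<Omega>" for x
    proof -
      have "(*v) (s *\<^sub>R mat 1) = (\<lambda>h::real^'n. s *\<^sub>R h)"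
        by (rule ext) (simp only: scaleR_matrix_vector_assoc[symmetric] matrix_vector_mul_lid)
      then show ?thesis using dG[OF that] unfolding HI[OF that] by metis
    qed
  qed
  moreover have "M a b * s ^ k * real (CARD('n) choose k) = lam"
    unfolding s(2) C_def[symmetric] \<mu>_def using C Mab by simp
  ultimately show ?thesis using s(1) unfolding a_def b_def by blast
qed

text \<open>The factors \<open>s\<close> for which \<open>s U\<close> solves the problem on the ball. All three solution sets of the theorem
  are images of this set under injective maps.\<close>

definition amplitudes :: "real \<Rightarrow> real^'n \<Rightarrow> real set" where
  "amplitudes R x0 = {s. s > 0 \<and> M (s * U_norm p R x0) (s * grad_U_norm q R x0) * s ^ k
      * real (CARD('n) choose k) = lam}"

lemma ball_solutionD:
  fixes x0 :: "real^'n"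
  assumes R: "R > 0" and sol: "is_solution (ball x0 R) k p q lam M u"
  obtains s where "s \<in> amplitudes R x0" "\<And>x. x \<in> closure (ball x0 R) \<Longrightarrow> u x = s * U_fun R x0 x"
proof -
  obtain x1 R1 s where s: "R1 > 0" "ball x0 R = ball x1 R1" "s > 0" "\<And>x. x \<in> closure (ball x0 R)
      \<Longrightarrow> u x = s * U_fun R1 x1 x"
    "M (Lp_norm p (ball x0 R) u) (Lp_norm q (ball x0 R) (grad u)) * s ^ k * real (CARD('n) choose k) = lam"
    using solution_structure[OF bounded_C2_domain_ball[OF R] sol] by blast
  have "x1 = x0" "R1 = R" using s(1,2) R ball_eq_ball_iff[of x0 R x1 R1] by auto
  then have u: "u x = s * U_fun R x0 x" if "x \<in> closure (ball x0 R)" for x using s(4) that by simp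
  then have u': "\<forall>x\<in>ball x0 R. u x = s * U_fun R x0 x" using closure_subset by blast
  have "s \<in> amplitudes R x0" unfolding amplitudes_def
    using s(3,5) Lp_norm_scaled_U_fun(1)[OF s(3) u' p] Lp_norm_scaled_U_fun(2)[OF s(3) u' q] by simp
  then show ?thesis using that u by blast
qed

lemma ball_solutionI:
  fixes x0 :: "real^'n"
  assumes R: "R > 0" and s: "s \<in> amplitudes R x0" and v: "\<And>x. x \<in> closure (ball x0 R) \<Longrightarrow> v x = s * U_fun R x0 x"
  shows "is_solution (ball x0 R) k p q lam M v"
proof -
  have s0: "s > 0" using s unfolding amplitudes_def by simp
  have v': "\<forall>x\<in>ball x0 R. v x = s * U_fun R x0 x" using v closure_subset by blast
  note V = scaled_U_fun[OF v']
  have cU: "continuous_on A (\<lambda>x. s * U_fun R x0 x)" for A unfolding U_fun_def divide_inverse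
      by (intro continuous_intros)
  have cg: "continuous_on A (\<lambda>x. s *\<^sub>R (x - x0))" for A by (intro continuous_intros)
  show ?thesis unfolding is_solution_def
  proof (intro conjI ballI)
    show "C2_closure (ball x0 R) v" unfolding C2_closure_def C2_on_def
    proof (intro conjI ballI)
      show "continuous_on (ball x0 R) (hessian v)"
        by (rule continuous_on_eq[of _ "\<lambda>x. s *\<^sub>R mat 1"]) (auto simp: V(4))
      show "continuous_on (closure (ball x0 R)) v" by (rule continuous_on_eq[OF cU]) (simp add: v)
      show "\<exists>G. continuous_on (closure (ball x0 R)) G \<and> (\<forall>x\<in>ball x0 R. G x = grad v x)"
        using cg V(2) by (intro exI[of _ "\<lambda>x. s *\<^sub>R (x - x0)"]) auto
      show "\<exists>H. continuous_on (closure (ball x0 R)) H \<and> (\<forall>x\<in>ball x0 R. H x = hessian v x)"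
        using V(4) by (intro exI[of _ "\<lambda>x. s *\<^sub>R mat 1"]) auto
    qed (use V in auto)
    show "M (Lp_norm p (ball x0 R) v) (Lp_norm q (ball x0 R) (grad v)) * S_elem k (hessian v x) = lam"
        if x: "x \<in> ball x0 R" for x
      unfolding V(4)[OF x] S_elem_symmetric[OF transpose_scaled_mat_1] sigma_scaleR sigma_mat_1
        Lp_norm_scaled_U_fun(1)[OF s0 v' p] Lp_norm_scaled_U_fun(2)[OF s0 v' q]
      using s unfolding amplitudes_def by (simp add: mult.assoc)
    show "v x = 0" if "x \<in> frontier (ball x0 R)" for x
      using v[of x] frontier_imp_U_zero[OF R that] that by (simp add: frontier_def)
    show "\<exists>c>0. \<forall>x\<in>frontier (ball x0 R). normal_derivative (ball x0 R) v x = c"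
    proof (intro exI[of _ "s * R"] conjI ballI)
      show "s * R > 0" using s0 R by simp
      fix x assume x: "x \<in> frontier (ball x0 R)"
      then have nx: "norm (x - x0) = R" using R by (simp add: frontier_ball dist_norm norm_minus_commute)
      have "normal_derivative (ball x0 R) v x = (s *\<^sub>R (x - x0)) \<bullet> outer_normal (ball x0 R) x"
        by (rule normal_derivative_eq[OF open_ball x cg]) (simp add: V(2))
      also have "outer_normal (ball x0 R) x = sgn (x - x0)"
        using outer_normal_eq[OF open_ball x ball_defining_function[OF R x]] by (simp add: grad_U_fun)
      finally show "normal_derivative (ball x0 R) v x = s * R"
        using nx R by (simp add: sgn_div_norm dot_square_norm power2_eq_square)
    qed
  qed
qed

lemma solution_set_eqpoll:
  fixes x0 :: "real^'n"
  assumes R: "R > 0"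
  shows "solution_set (ball x0 R) k p q lam M \<approx> amplitudes R x0"
proof -
  define F where "F s = restrict (\<lambda>x. s * U_fun R x0 x) (closure (ball x0 R))" for s
  have "solution_set (ball x0 R) k p q lam M = F ` amplitudes R x0"
  proof (intro set_eqI iffI)
    fix u assume u: "u \<in> solution_set (ball x0 R) k p q lam M"
    then have "is_solution (ball x0 R) k p q lam M u" unfolding solution_set_def by simp
    then obtain s where s: "s \<in> amplitudes R x0" "\<And>x. x \<in> closure (ball x0 R) \<Longrightarrow> u x = s * U_fun R x0 x"
      using ball_solutionD[OF R] by blast
    have "u = F s"
    proof (rule extensionalityI[of _ "closure (ball x0 R)"])
      show "u \<in> extensional (closure (ball x0 R))" using u unfolding solution_set_def by simp
      show "F s \<in> extensional (closure (ball x0 R))" unfolding F_def by simp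
      show "u x = F s x" if "x \<in> closure (ball x0 R)" for x using s(2)[OF that] that unfolding F_def by simp
    qed
    then show "u \<in> F ` amplitudes R x0" using s(1) by blast
  next
    fix u assume "u \<in> F ` amplitudes R x0"
    then obtain s where s: "s \<in> amplitudes R x0" "u = F s" by blast
    have "is_solution (ball x0 R) k p q lam M u"
      by (rule ball_solutionI[OF R s(1)]) (simp add: s(2) F_def)
    then show "u \<in> solution_set (ball x0 R) k p q lam M" unfolding solution_set_def s(2) F_def by simp
  qed
  moreover have "inj_on F (amplitudes R x0)"
  proof (rule inj_onI)
    fix s t assume "F s = F t"
    then have "F s x0 = F t x0" by simp
    moreover have "x0 \<in> closure (ball x0 R)" using R by simp
    ultimately have "s * U_fun R x0 x0 = t * U_fun R x0 x0" unfolding F_def by simp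
    then show "s = t" using R unfolding U_fun_def by simp
  qed
  ultimately show ?thesis using inj_on_image_eqpoll_self by metis
qed

text \<open>In a solution of the system the common factor is the amplitude: \<open>(m C / \<lambda>) powr (- 1 / k) = s\<close> is the equation
  \<open>m s\<^sup>k C = \<lambda>\<close>.\<close>

lemma system_solutions_eqpoll:
  fixes x0 :: "real^'n"
  assumes R: "R > 0"
  shows "system_solutions R x0 k p q lam M \<approx> amplitudes R x0"
proof -
  define a b C where "a = U_norm p R x0" and "b = grad_U_norm q R x0" and "C = real (CARD('n) choose k)"
  have a: "a > 0" and b: "b > 0" unfolding a_def b_def using U_norm_pos[OF R] p q by auto
  have C: "C > 0" unfolding C_def using k by simp
  have key: "(m / lam * C) powr (- 1 / real k) = s \<longleftrightarrow> m * s ^ k * C = lam" if m: "m > 0" and s: "s > 0" for m s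
  proof -
    have pos: "m / lam * C > 0" using m lam C by simp
    have sp: "s powr (- real k) = 1 / s ^ k" using s by (simp add: powr_minus powr_realpow divide_inverse)
    have "(m / lam * C) powr (- 1 / real k) = s \<longleftrightarrow> m / lam * C = s powr (- real k)"
    proof
      assume "(m / lam * C) powr (- 1 / real k) = s"
      then have "s powr (- real k) = (m / lam * C) powr ((- 1 / real k) * (- real k))" by (metis powr_powr)
      also have "(- 1 / real k) * (- real k) = 1" using k by simp
      finally show "m / lam * C = s powr (- real k)" using powr_one[of "m / lam * C"] pos by simp
    next
      assume "m / lam * C = s powr (- real k)"
      then have "(m / lam * C) powr (- 1 / real k) = s powr ((- real k) * (- 1 / real k))"
          by (simp only: powr_powr)
      then show "(m / lam * C) powr (- 1 / real k) = s" using k s by simp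
    qed
    also have "\<dots> \<longleftrightarrow> m * s ^ k * C = lam" unfolding sp using lam s by (auto simp: field_simps)
    finally show ?thesis .
  qed
  have "system_solutions R x0 k p q lam M = (\<lambda>s. (s * a, s * b)) ` amplitudes R x0"
  proof (intro set_eqI iffI)
    fix z assume "z \<in> system_solutions R x0 k p q lam M"
    then obtain S T where z: "z = (S, T)" "S > 0" "T > 0"
      "S = (M S T / lam * C) powr (- 1 / real k) * a" "T = (M S T / lam * C) powr (- 1 / real k) * b"
      unfolding system_solutions_def a_def b_def C_def by auto
    define s where "s = (M S T / lam * C) powr (- 1 / real k)"
    have m: "M S T > 0" using M z(2,3) by blast
    have s: "s > 0" unfolding s_def using m lam C by simp
    have "M S T * s ^ k * C = lam" using key[OF m s] unfolding s_def by simp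
    moreover have ST: "S = s * a" "T = s * b" using z(4,5) unfolding s_def by auto
    ultimately have "s \<in> amplitudes R x0" unfolding amplitudes_def a_def b_def C_def using s by simp
    then show "z \<in> (\<lambda>s. (s * a, s * b)) ` amplitudes R x0" using z(1) ST by blast
  next
    fix z assume "z \<in> (\<lambda>s. (s * a, s * b)) ` amplitudes R x0"
    then obtain s where z: "z = (s * a, s * b)" and s: "s > 0" "M (s * a) (s * b) * s ^ k * C = lam"
      unfolding amplitudes_def a_def b_def C_def by auto
    have m: "M (s * a) (s * b) > 0" using M s a b by simp
    have 1: "(M (s * a) (s * b) / lam * C) powr (- 1 / real k) = s" using key[OF m s(1)] s(2) by simp
    show "z \<in> system_solutions R x0 k p q lam M"
      unfolding system_solutions_def z a_def[symmetric] b_def[symmetric] C_def[symmetric] mem_Collect_eq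
          prod.case 1 using s(1) a b by simp
  qed
  moreover have "inj_on (\<lambda>s. (s * a, s * b)) (amplitudes R x0)" using a by (auto simp: inj_on_def)
  ultimately show ?thesis by (simp only: inj_on_image_eqpoll_self)
qed

lemma equation_solutions_eq:
  fixes x0 :: "real^'n"
  assumes R: "R > 0"
  shows "equation_solutions R x0 k p q lam M = (\<lambda>s. s * U_norm p R x0) ` amplitudes R x0"
proof -
  define a b C where "a = U_norm p R x0" and "b = grad_U_norm q R x0" and "C = real (CARD('n) choose k)"
  have a: "a > 0" and b: "b > 0" unfolding a_def b_def using U_norm_pos[OF R] p q by auto
  have key: "(s * a) ^ k * M (s * a) (b / a * (s * a)) * C = lam * a ^ k
      \<longleftrightarrow> M (s * a) (s * b) * s ^ k * C = lam" for s
  proof -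
    have "b / a * (s * a) = s * b" using a by simp
    then have e: "(s * a) ^ k * M (s * a) (b / a * (s * a)) * C = (M (s * a) (s * b) * s ^ k * C) * a ^ k"
      by (simp only: power_mult_distrib mult_ac)
    have "a ^ k \<noteq> 0" using a by simp
    then show ?thesis unfolding e by (rule mult_right_cancel)
  qed
  show ?thesis
  proof (intro set_eqI iffI)
    fix S assume "S \<in> equation_solutions R x0 k p q lam M"
    then have S: "S > 0" "S ^ k * M S (b / a * S) * C = lam * a ^ k"
      unfolding equation_solutions_def g_fun_def a_def b_def C_def by auto
    define s where "s = S / a"
    have Ss: "S = s * a" "s > 0" unfolding s_def using a S by simp_all
    then have "s \<in> amplitudes R x0" using S(2) key[of s] unfolding amplitudes_def a_def b_def C_def by simp
    then show "S \<in> (\<lambda>s. s * U_norm p R x0) ` amplitudes R x0" using Ss(1) unfolding a_def by blast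
  next
    fix S assume "S \<in> (\<lambda>s. s * U_norm p R x0) ` amplitudes R x0"
    then obtain s where s: "S = s * a" "s > 0" "M (s * a) (s * b) * s ^ k * C = lam"
      unfolding amplitudes_def a_def b_def C_def by auto
    then show "S \<in> equation_solutions R x0 k p q lam M"
      using key[of s] a unfolding equation_solutions_def g_fun_def a_def b_def C_def by simp
  qed
qed

lemma equation_solutions_eqpoll:
  fixes x0 :: "real^'n"
  assumes R: "R > 0"
  shows "equation_solutions R x0 k p q lam M \<approx> amplitudes R x0"
proof -
  have "inj_on (\<lambda>s. s * U_norm p R x0) (amplitudes R x0)" using U_norm_pos(1)[OF R p, of x0]
      by (auto simp: inj_on_def)
  then show ?thesis unfolding equation_solutions_eq[OF R] by (rule inj_on_image_eqpoll_self)
qed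

end

theorem theorem1:
  fixes M :: "real \<Rightarrow> real \<Rightarrow> real"
    and k :: nat
    and p q :: ennreal
    and lam :: real
  assumes k: "1 \<le> k" "k \<le> CARD('n::finite)"
    and p: "0 < p"
    and q: "0 < q"
    and lam: "0 < lam"
    and M: "\<And>s t. s > 0 \<Longrightarrow> t > 0 \<Longrightarrow> M s t > 0"
  shows
    "(\<forall>(\<Omega> :: (real^'n) set) u.
        bounded_C2_domain \<Omega> \<longrightarrow> is_solution \<Omega> k p q lam M u \<longrightarrow>
        (\<exists>x0 R. R > 0 \<and> \<Omega> = ball x0 R \<and> radially_symmetric_on (closure \<Omega>) x0 u)) \<and>
     (\<forall>(x0 :: real^'n) R. R > 0 \<longrightarrow>
        solution_set (ball x0 R) k p q lam M \<approx> system_solutions R x0 k p q lam M) \<and>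
     (\<forall>(x0 :: real^'n) R. R > 0 \<longrightarrow>
        system_solutions R x0 k p q lam M \<approx> equation_solutions R x0 k p q lam M) \<and>
     (\<forall>(x0 :: real^'n) R u. R > 0 \<longrightarrow> is_solution (ball x0 R) k p q lam M u \<longrightarrow>
        (\<exists>s \<in> equation_solutions R x0 k p q lam M.
           \<forall>x \<in> closure (ball x0 R). u x = s * (U_fun R x0 x / U_norm p R x0)))"
  proof -
  have M': "\<forall>s>0. \<forall>t>0. M s t > 0" using M by blast
  show ?thesis
  proof (intro conjI allI impI)
  fix \<Omega> :: "(real^'n) set" and u
  assume dom: "bounded_C2_domain \<Omega>" and sol: "is_solution \<Omega> k p q lam M u"
  obtain x0 R s where *: "R > 0" "\<Omega> = ball x0 R" "\<forall>x\<in>closure \<Omega>. u x = s * U_fun R x0 x"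
    using solution_structure[OF k p q lam M' dom sol] by blast
  have "radially_symmetric_on (closure \<Omega>) x0 u" unfolding radially_symmetric_on_def
    using *(3) by (intro exI[of _ "\<lambda>r. s * ((r\<^sup>2 - R\<^sup>2) / 2)"]) (simp add: U_fun_def)
  then show "\<exists>x0 R. R > 0 \<and> \<Omega> = ball x0 R \<and> radially_symmetric_on (closure \<Omega>) x0 u" using * by blast
next
  fix x0 :: "real^'n" and R :: real
  assume R: "R > 0"
  show "solution_set (ball x0 R) k p q lam M \<approx> system_solutions R x0 k p q lam M"
    by (rule eqpoll_trans[OF solution_set_eqpoll[OF k p q lam M' R] eqpoll_sym[OF
        system_solutions_eqpoll[OF k p q lam M' R]]])
  show "system_solutions R x0 k p q lam M \<approx> equation_solutions R x0 k p q lam M"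
    by (rule eqpoll_trans[OF system_solutions_eqpoll[OF k p q lam M' R] eqpoll_sym[OF
        equation_solutions_eqpoll[OF k p q lam M' R]]])
next
  fix x0 :: "real^'n" and R :: real and u
  assume R: "R > 0" and sol: "is_solution (ball x0 R) k p q lam M u"
  obtain s where s: "s \<in> amplitudes M k p q lam R x0" "\<And>x. x \<in> closure (ball x0 R) \<Longrightarrow> u x = s * U_fun R x0 x"
    using ball_solutionD[OF k p q lam M' R sol] by blast
  have a: "U_norm p R x0 > 0" by (rule U_norm_pos(1)[OF R p])
  show "\<exists>s\<in>equation_solutions R x0 k p q lam M. \<forall>x\<in>closure (ball x0 R). u x
      = s * (U_fun R x0 x / U_norm p R x0)"
  proof (rule bexI[of _ "s * U_norm p R x0"])
    show "\<forall>x\<in>closure (ball x0 R). u x = s * U_norm p R x0 * (U_fun R x0 x / U_norm p R x0)"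
      using s(2) a by simp
    show "s * U_norm p R x0 \<in> equation_solutions R x0 k p q lam M"
      unfolding equation_solutions_eq[OF k p q lam M' R] using s(1) by blast
  qed
qed
qed

end
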